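(* Let $\Omega\subset\mathbb C^n$ be an open set, $K\subset\Omega$ a compact set and $\mathcal U\subset PSH(\Omega)$ a compact class. Then $$\vartheta:=\sup\{\vartheta_u(z):u\in\mathcal U,\ z\in K\}<+\infty,$$ and for any $\nu>\vartheta$ there exist constants $C=C(K,\nu)>0$ and $0<\eta_0<1$ such that for any real number $0<\eta\le\eta_0$, any real number $0<\alpha\le2$ and any function $u\in\mathcal U$, the lower bound $$u(z)\ \ge\ -\nu\log(C/\eta)$$ holds for any $z\in K$ outside the union of a countable family of balls of radii $(r_j)$ less than $\eta$ which satisfy $$\sum_j r_j^{2n-2+\alpha}<N\,9^{n-1}\eta^\alpha/\alpha,$$ where $N$ is an integer depending only on $(K,\Omega)$.
   Context: $PSH(\Omega)$ is the cone of plurisubharmonic functions on $\Omega$ that are not identically $-\infty$ (on any connected component of $\Omega$), viewed as a closed subset of $L^1_{loc}(\Omega)$ and equipped with the $L^1_{loc}$-topology; compactness of $\mathcal U$ refers to this topology. The balls are Euclidean balls in $\mathbb C^n$. The Lelong number of $u\in PSH(\Omega)$ at $a\in\Omega$ is $\vartheta_u(a)=\lim_{r\to0^+}\frac{\max_{|z-a|=r}u(z)}{\log r}$ (equivalently, the limit as $r\to0^+$ of $\int_{|z-a|\le r}dd^cu\wedge(dd^c\log|z-a|)^{n-1}$ with $dd^c=\frac i\pi\partial\overline\partial$). *)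

theory Defs
  imports "HOL-Analysis.Analysis"
begin

text \<open>
  Functions on an open set of \<open>\<complex>\<^sup>n\<close> are modelled as total functions
  \<^typ>\<open>complex ^ 'n \<Rightarrow> ereal\<close>; every notion below that is relative to \<open>\<Omega>\<close> only looks at
  their values on \<open>\<Omega>\<close>.
\<close>

definition usc_on :: "(complex ^ 'n) set \<Rightarrow> (complex ^ 'n \<Rightarrow> ereal) \<Rightarrow> bool" where
  "usc_on \<Omega> u \<longleftrightarrow> (\<forall>c. openin (top_of_set \<Omega>) {z \<in> \<Omega>. u z < c})"

text \<open>
  The mean value of an extended real function over \<open>[0, 2\<pi>]\<close>, as the integral of its positive
  part minus the integral of its negative part (\<^const>\<open>e2ennreal\<close> truncates negative values to
  zero). For functions bounded above, such as upper semicontinuous functions on a circle, the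
  first integral is finite, so the difference is meaningful and may be \<open>-\<infinity>\<close>.
\<close>

definition circle_mean :: "(real \<Rightarrow> ereal) \<Rightarrow> ereal" where
  "circle_mean f =
     (enn2ereal (\<integral>\<^sup>+\<theta>\<in>{0..2*pi}. e2ennreal (f \<theta>) \<partial>lborel)
      - enn2ereal (\<integral>\<^sup>+\<theta>\<in>{0..2*pi}. e2ennreal (- f \<theta>) \<partial>lborel)) / ereal (2*pi)"

definition plurisubharmonic_on ::
    "(complex ^ 'n) set \<Rightarrow> (complex ^ 'n \<Rightarrow> ereal) \<Rightarrow> bool" where
  "plurisubharmonic_on \<Omega> u \<longleftrightarrow>
     (\<forall>z\<in>\<Omega>. u z < \<infinity>) \<and> usc_on \<Omega> u \<and>
     (\<forall>a w. (\<forall>\<zeta>. cmod \<zeta> \<le> 1 \<longrightarrow> a + \<zeta> *s w \<in> \<Omega>) \<longrightarrow>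
        u a \<le> circle_mean (\<lambda>\<theta>. u (a + cis \<theta> *s w)))"

definition PSH :: "(complex ^ 'n) set \<Rightarrow> (complex ^ 'n \<Rightarrow> ereal) set" where
  "PSH \<Omega> = {u. plurisubharmonic_on \<Omega> u \<and> (\<forall>D\<in>components \<Omega>. \<exists>z\<in>D. u z \<noteq> -\<infinity>)}"

definition L1loc :: "(complex ^ 'n) set \<Rightarrow> (complex ^ 'n \<Rightarrow> ereal) set" where
  "L1loc \<Omega> = {u. u \<in> borel_measurable (restrict_space lebesgue \<Omega>) \<and>
     (\<forall>L. compact L \<and> L \<subseteq> \<Omega> \<longrightarrow> (\<integral>\<^sup>+z\<in>L. e2ennreal \<bar>u z\<bar> \<partial>lebesgue) < \<infinity>)}"

text \<open>
  The topology given by the seminorms \<open>\<integral>\<^sub>L \<bar>u\<bar>\<close>, \<open>L\<close> compact in \<open>\<Omega>\<close>. Functions are not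
  identified when they agree almost everywhere on \<open>\<Omega>\<close>, so it is not Hausdorff on \<open>L1loc \<Omega>\<close>; a
  set is compact iff its image in the usual quotient space is.
\<close>

definition L1loc_topology :: "(complex ^ 'n) set \<Rightarrow> (complex ^ 'n \<Rightarrow> ereal) topology" where
  "L1loc_topology \<Omega> = topology_generated_by
     {{v \<in> L1loc \<Omega>. (\<integral>\<^sup>+z\<in>L. e2ennreal \<bar>u z - v z\<bar> \<partial>lebesgue) < ennreal \<epsilon>} | u L \<epsilon>.
        u \<in> L1loc \<Omega> \<and> compact L \<and> L \<subseteq> \<Omega> \<and> 0 < \<epsilon>}"

text \<open>
  For \<open>u \<in> PSH \<Omega>\<close> and \<open>a \<in> \<Omega>\<close> the supremum over a small sphere is a maximum, by upper
  semicontinuity, and the limit exists.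
\<close>

definition lelong_number :: "(complex ^ 'n \<Rightarrow> ereal) \<Rightarrow> complex ^ 'n \<Rightarrow> ereal" where
  "lelong_number u a = Lim (at_right 0) (\<lambda>r. (SUP z\<in>sphere a r. u z) / ereal (ln r))"

end

theory Submission
  imports Defs
begin

text \<open>
  Write \<open>m(z, r)\<close> for the supremum of \<open>u\<close> over the closed ball of radius \<open>r\<close> about \<open>z\<close>. At scale
  \<open>\<eta>\<close> the Lelong numbers decide how negative \<open>m\<close> can be; below that scale only an exceptional set
  is lost, and its size is controlled by the total mass of the Laplacian of \<open>u\<close>.

  \<^bold>\<open>The scale \<open>\<eta>\<close>.\<close> By the three-circle theorem \<open>m(z, r)\<close> is convex in \<open>log r\<close>, and its slopes
  decrease to the Lelong number as \<open>r \<rightarrow> 0\<close> (\<open>lelong_number_eq_lim_slope\<close>). If \<open>\<nu>\<close> exceeds the Lelong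
  number of \<open>u\<close> at \<open>z\<close>, some slope is below \<open>\<nu>\<close>. The ball mean inequality shows that this persists
  for \<open>L\<^sup>1\<close>-close functions and nearby points, with slightly changed radii. Compactness of
  \<open>U \<times> K\<close> then gives \<open>m(z, \<eta>) \<ge> \<nu> log \<eta> - c\<close> uniformly (\<open>ball_sup_uniform_lower_bound\<close>). The
  exact coefficient \<open>\<nu>\<close> enters here and nowhere else; every later loss is a constant absorbed in \<open>C\<close>.
  A uniform \<open>L\<^sup>1\<close>-bound also bounds all slopes, whence \<open>\<theta> < \<infinity>\<close>, and it bounds the mean of
  \<open>m(z, 4\<rho>) - u\<close> over the ball of radius \<open>2\<rho>\<close> (\<open>psh_mean_oscillation\<close>).

  \<^bold>\<open>From scale \<open>\<eta>\<close> to the point.\<close> Let \<open>q = (\<tau> - \<bar>x - z\<bar>\<^sup>2)\<^sub>+\<close>. The weighted mean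
  \<open>\<tau>\<^bsup>-n-2\<^esup> \<integral> f q\<^sup>2\<close> of \<open>f = B - u\<close> has derivative \<open>-\<tau>\<^bsup>-n-3\<^esup> E\<close> in \<open>\<tau>\<close>, where the excess
  \<open>E = \<integral> f ((n + 2) q\<^sup>2 - 2 \<tau> q)\<close> is, up to a negative constant, the integral of \<open>f\<close> against the
  Laplacian of \<open>q\<^sup>3\<close>. If \<open>E\<close> is at most a constant times \<open>\<alpha> \<tau>\<^bsup>n+2+\<alpha>/2\<^esup> \<eta>\<^bsup>-\<alpha>\<^esup>\<close> for all small \<open>\<tau>\<close>, the
  derivative integrates to a constant, and by upper semicontinuity of \<open>u\<close> the mean of \<open>f\<close> at scale
  \<open>\<eta>\<close> bounds \<open>f z\<close> up to constants (\<open>psh_lower_bound_of_small_excess\<close>). Lowering \<open>B\<close> to \<open>m(z, 4\<rho>)\<close>,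
  with \<open>\<rho>\<close> comparable to \<open>\<eta>\<close>, does not increase the excess (\<open>excess_deficit_mono\<close>) and makes that mean
  bounded, so \<open>u z\<close> is at least \<open>m(z, 4\<rho>)\<close> minus a constant. The identity for the
  derivative replaces the Riesz measure of \<open>u\<close> and works in all dimensions alike.

  \<^bold>\<open>The exceptional set.\<close> Subharmonicity tested against nonnegative combinations of the caps \<open>q\<^sup>3\<close>
  (\<open>excess_combination_nonneg\<close>) bounds the total normalised excess of disjoint balls by a constant
  \<open>M\<close> depending only on the family (\<open>excess_disjoint_balls\<close>). A Vitali selection among the balls of
  large excess therefore has \<open>\<Sum> r\<^sub>j\<^bsup>2n-2+\<alpha>\<^esup>\<close> at most \<open>M \<eta>\<^bsup>\<alpha>\<^esup> / \<alpha>\<close> divided by the constant in the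
  threshold (\<open>exceptional_balls\<close>). That constant may depend on the family, since it only affects
  \<open>C\<close>; choosing it large compared with \<open>M\<close> makes \<open>N = 1\<close> possible.
\<close>

section \<open>Rotations and circle means\<close>

lemma norm_cscale: "norm (c *s x) = cmod c * norm x" for x :: "complex ^ 'n"
  by (simp add: norm_vec_def L2_set_def norm_mult power_mult_distrib real_sqrt_mult
      flip: sum_distrib_left)

lemma continuous_on_cscale [continuous_intros]:
  fixes g :: "'a::topological_space \<Rightarrow> complex ^ 'n"
  assumes "continuous_on S f" "continuous_on S g"
  shows "continuous_on S (\<lambda>x. f x *s g x)"
  unfolding vector_scalar_mult_def
  by (intro continuous_intros continuous_on_vec_lambda assms)

lemma borel_measurable_cscale [measurable (raw)]:
  fixes g :: "'a \<Rightarrow> complex ^ 'n"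
  assumes [measurable]: "f \<in> borel_measurable M" "g \<in> borel_measurable M"
  shows "(\<lambda>x. f x *s g x) \<in> borel_measurable M"
proof -
  have "(\<lambda>p. fst p *s snd p :: complex ^ 'n) \<in> borel_measurable borel"
    by (intro borel_measurable_continuous_onI continuous_intros)
  then have "(\<lambda>x. fst (f x, g x) *s snd (f x, g x)) \<in> borel_measurable M"
    by (rule measurable_compose_rev) measurable
  then show ?thesis by simp
qed

lemma borel_measurable_cis [measurable]: "cis \<in> borel_measurable borel"
  by (intro borel_measurable_continuous_onI continuous_intros)

lemma nn_integral_lborel_translate:
  fixes c :: "'a::euclidean_space"
  assumes "F \<in> borel_measurable borel"
  shows "(\<integral>\<^sup>+x. F (c + x) \<partial>lborel) = (\<integral>\<^sup>+x. F x \<partial>lborel)"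
proof -
  have "(\<integral>\<^sup>+x. F x \<partial>lborel) = (\<integral>\<^sup>+x. F x \<partial>(distr lborel borel ((+) c)))"
    by (simp add: lborel_distr_plus)
  also have "\<dots> = (\<integral>\<^sup>+x. F (c + x) \<partial>lborel)"
    using assms by (subst nn_integral_distr) auto
  finally show ?thesis ..
qed

text \<open>Uniqueness of Haar measure, specialised: the image of Lebesgue measure under a unitary
  scalar is translation invariant, hence a multiple of Lebesgue measure, and the factor is one
  because the unit ball is preserved. Fubini turns this into a direct computation.\<close>

lemma nn_integral_lborel_rotate:
  fixes F :: "complex ^ 'n \<Rightarrow> ennreal"
  assumes [measurable]: "F \<in> borel_measurable borel" and c: "cmod c = 1"
  shows "(\<integral>\<^sup>+x. F (c *s x) \<partial>lborel) = (\<integral>\<^sup>+x. F x \<partial>lborel)"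
proof -
  define g :: "complex ^ 'n \<Rightarrow> ennreal" where "g x = indicator (ball 0 1) x" for x
  have [measurable]: "g \<in> borel_measurable borel"
    unfolding g_def by (intro borel_measurable_indicator) auto
  have gc: "g (c *s x) = g x" "g (- x) = g x" for x
    using c by (simp_all add: g_def indicator_def norm_cscale)
  have "c \<noteq> 0" using c by auto
  then have cinv: "c *s (inverse c *s y) = y" for y :: "complex ^ 'n"
    by (simp add: vector_smult_assoc)
  define V where "V = (\<integral>\<^sup>+y. g y \<partial>lborel)"
  have V: "V = emeasure lborel (ball (0::complex^'n) 1)"
    unfolding V_def g_def by simp
  have "V * (\<integral>\<^sup>+x. F (c *s x) \<partial>lborel) = (\<integral>\<^sup>+x. F (c *s x) * V \<partial>lborel)"
    by (subst nn_integral_multc) (auto simp: mult.commute)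
  also have "\<dots> = (\<integral>\<^sup>+x. (\<integral>\<^sup>+y. F (c *s x) * g (- (c *s x) + y) \<partial>lborel) \<partial>lborel)"
    unfolding V_def
    by (intro nn_integral_cong, subst nn_integral_cmult,
        simp, subst nn_integral_lborel_translate) auto
  also have "\<dots> = (\<integral>\<^sup>+y. (\<integral>\<^sup>+x. F (c *s x) * g (- (c *s x) + y) \<partial>lborel) \<partial>lborel)"
    by (rule lborel_pair.Fubini') simp
  also have "\<dots> = (\<integral>\<^sup>+y. (\<integral>\<^sup>+x. F (y + c *s x) * g (c *s x) \<partial>lborel) \<partial>lborel)"
  proof (rule nn_integral_cong)
    fix y :: "complex ^ 'n"
    have minus_y: "- y + - z + y = - z" for z by (simp add: add.commute)
    have "(\<integral>\<^sup>+x. F (c *s x) * g (- (c *s x) + y) \<partial>lborel)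
        = (\<integral>\<^sup>+x. F (c *s (inverse c *s y + x)) * g (- (c *s (inverse c *s y + x)) + y) \<partial>lborel)"
      by (rule nn_integral_lborel_translate[symmetric]) simp
    also have "\<dots> = (\<integral>\<^sup>+x. F (y + c *s x) * g (c *s x) \<partial>lborel)"
      by (simp only: vector_add_ldistrib cinv minus_add_distrib minus_y gc)
    finally show "(\<integral>\<^sup>+x. F (c *s x) * g (- (c *s x) + y) \<partial>lborel)
        = (\<integral>\<^sup>+x. F (y + c *s x) * g (c *s x) \<partial>lborel)" .
  qed
  also have "\<dots> = (\<integral>\<^sup>+x. (\<integral>\<^sup>+y. F (y + c *s x) * g (c *s x) \<partial>lborel) \<partial>lborel)"
    by (rule lborel_pair.Fubini') simp
  also have "\<dots> = (\<integral>\<^sup>+x. (\<integral>\<^sup>+y. F y \<partial>lborel) * g x \<partial>lborel)"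
  proof (rule nn_integral_cong)
    fix x :: "complex ^ 'n"
    show "(\<integral>\<^sup>+y. F (y + c *s x) * g (c *s x) \<partial>lborel) = (\<integral>\<^sup>+y. F y \<partial>lborel) * g x"
      using nn_integral_lborel_translate[of F "c *s x"]
      by (subst nn_integral_multc) (auto simp: gc add.commute)
  qed
  also have "\<dots> = V * (\<integral>\<^sup>+y. F y \<partial>lborel)"
    unfolding V_def by (subst nn_integral_cmult) (auto simp: mult.commute)
  finally have eq: "V * (\<integral>\<^sup>+x. F (c *s x) \<partial>lborel) = V * (\<integral>\<^sup>+y. F y \<partial>lborel)" .
  have "V = ennreal (unit_ball_vol DIM(complex ^ 'n))"
    unfolding V by (subst emeasure_ball) simp_all
  moreover have "0 < unit_ball_vol DIM(complex ^ 'n)"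
    by (rule unit_ball_vol_pos) simp
  ultimately have "V \<noteq> 0" "V \<noteq> top"
    by (metis ennreal_eq_0_iff not_le, metis ennreal_neq_top)
  with eq show ?thesis
    by (simp only: ennreal_mult_cancel_left simp_thms)
qed

text \<open>A superharmonic function in nonnegative form: \<open>B - u\<close> for \<open>u\<close> plurisubharmonic and bounded by
  \<open>B\<close>. With values in \<^typ>\<open>ennreal\<close> Tonelli's theorem applies without integrability conditions.\<close>

definition circle_super :: "(complex ^ 'n \<Rightarrow> ennreal) \<Rightarrow> (complex ^ 'n) set \<Rightarrow> bool" where
  "circle_super F L \<longleftrightarrow>
     (\<forall>a w. (\<forall>\<zeta>. cmod \<zeta> \<le> 1 \<longrightarrow> a + \<zeta> *s w \<in> L) \<longrightarrow>
        (\<integral>\<^sup>+\<theta>\<in>{0..2*pi}. F (a + cis \<theta> *s w) \<partial>lborel) \<le> ennreal (2*pi) * F a)"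

lemma circle_superD:
  assumes "circle_super F L" "\<And>\<zeta>. cmod \<zeta> \<le> 1 \<Longrightarrow> a + \<zeta> *s w \<in> L"
  shows "(\<integral>\<^sup>+\<theta>\<in>{0..2*pi}. F (a + cis \<theta> *s w) \<partial>lborel) \<le> ennreal (2*pi) * F a"
  using assms unfolding circle_super_def by blast

lemma circle_super_disc_in:
  fixes x y :: "complex ^ 'n"
  assumes "cball x r \<subseteq> L" "norm y \<le> r" "cmod \<zeta> \<le> 1"
  shows "x + \<zeta> *s y \<in> L"
proof -
  have "cmod \<zeta> * norm y \<le> 1 * r"
    using assms by (intro mult_mono) auto
  then have "x + \<zeta> *s y \<in> cball x r"
    by (simp add: dist_norm norm_cscale)
  then show ?thesis using assms by blast
qed

text \<open>Averaging the circle inequality over all circles about the centre of a ball gives the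
  ball inequality, since every rotation preserves the integral over the ball.\<close>

lemma circle_super_cball:
  fixes F :: "complex ^ 'n \<Rightarrow> ennreal"
  assumes F[measurable]: "F \<in> borel_measurable borel" and sup: "circle_super F L"
    and r: "cball x r \<subseteq> L"
  shows "(\<integral>\<^sup>+y\<in>cball x r. F y \<partial>lborel) \<le> emeasure lborel (cball x r) * F x"
proof -
  define I where "I = (\<integral>\<^sup>+y\<in>cball x r. F y \<partial>lborel)"
  define h where "h y = F (x + y) * indicator (cball 0 r) y" for y
  have [measurable]: "cball (0::complex^'n) r \<in> sets borel" "cball x r \<in> sets borel" by simp_all
  have [measurable]: "h \<in> borel_measurable borel" unfolding h_def by measurable
  have ind: "indicator (cball x r) (x + y) = (indicator (cball 0 r) y :: ennreal)" for y
    by (simp add: indicator_def dist_norm)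
  have I1: "I = (\<integral>\<^sup>+y. h y \<partial>lborel)"
    unfolding I_def h_def
    by (subst nn_integral_lborel_translate[of _ x, symmetric]) (auto simp: ind)
  have rot: "I = (\<integral>\<^sup>+y. F (x + cis \<theta> *s y) * indicator (cball 0 r) y \<partial>lborel)" for \<theta>
    using nn_integral_lborel_rotate[of h "cis \<theta>"]
    by (simp add: I1 h_def indicator_def norm_cscale)
  have "ennreal (2*pi) * I = (\<integral>\<^sup>+\<theta>. I * indicator {0..2*pi} \<theta> \<partial>lborel)"
    by (subst nn_integral_cmult) (auto simp: mult.commute)
  also have "\<dots> = (\<integral>\<^sup>+\<theta>. (\<integral>\<^sup>+y. F (x + cis \<theta> *s y) * indicator (cball 0 r) y * indicator {0..2*pi} \<theta> \<partial>lborel) \<partial>lborel)"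
  proof (rule nn_integral_cong)
    fix \<theta> :: real
    show "I * indicator {0..2*pi} \<theta> = (\<integral>\<^sup>+y. F (x + cis \<theta> *s y) * indicator (cball 0 r) y * indicator {0..2*pi} \<theta> \<partial>lborel)"
      by (subst rot[of \<theta>], subst nn_integral_multc) auto
  qed
  also have "\<dots> = (\<integral>\<^sup>+y. (\<integral>\<^sup>+\<theta>. F (x + cis \<theta> *s y) * indicator (cball 0 r) y * indicator {0..2*pi} \<theta> \<partial>lborel) \<partial>lborel)"
    by (rule lborel_pair.Fubini') simp
  also have "\<dots> \<le> (\<integral>\<^sup>+y. ennreal (2*pi) * F x * indicator (cball (0::complex^'n) r) y \<partial>lborel)"
  proof (rule nn_integral_mono)
    fix y :: "complex ^ 'n"
    show "(\<integral>\<^sup>+\<theta>. F (x + cis \<theta> *s y) * indicator (cball 0 r) y * indicator {0..2*pi} \<theta> \<partial>lborel)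
        \<le> ennreal (2*pi) * F x * indicator (cball 0 r) y"
    proof (cases "norm y \<le> r")
      case True
      then have "(\<integral>\<^sup>+\<theta>\<in>{0..2*pi}. F (x + cis \<theta> *s y) \<partial>lborel) \<le> ennreal (2*pi) * F x"
        using circle_superD[OF sup] circle_super_disc_in[OF r] by blast
      then show ?thesis using True by simp
    qed (simp add: indicator_def)
  qed
  also have "\<dots> = ennreal (2*pi) * (F x * emeasure lborel (cball (0::complex^'n) r))"
    by (subst nn_integral_cmult) (simp_all only: nn_integral_indicator mult.assoc sets_lborel borel_closed closed_cball, measurable)
  also have "emeasure lborel (cball (0::complex^'n) r) = emeasure lborel (cball x r)"
    using emeasure_cball[of r "0::complex^'n"] emeasure_cball[of r x]
    by (cases "r \<ge> 0") auto
  finally have "ennreal (2*pi) * I \<le> ennreal (2*pi) * (F x * emeasure lborel (cball x r))" .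
  then have "I \<le> F x * emeasure lborel (cball x r)"
    by (subst (asm) ennreal_mult_le_mult_iff) simp_all
  then show ?thesis
    unfolding I_def by (simp only: mult.commute)
qed

section \<open>Upper semicontinuity and integrability\<close>

lemma usc_on_subset: "usc_on \<Omega> u \<Longrightarrow> T \<subseteq> \<Omega> \<Longrightarrow> usc_on T u"
  unfolding usc_on_def openin_open by fast

lemma usc_on_borel_measurable:
  fixes u :: "complex ^ 'n \<Rightarrow> ereal"
  assumes "open \<Omega>" "usc_on \<Omega> u"
  shows "(\<lambda>x. if x \<in> \<Omega> then u x else -\<infinity>) \<in> borel_measurable borel"
proof (rule borel_measurable_ereal_iff_Iio[THEN iffD2], intro allI)
  fix c :: ereal
  have "openin (top_of_set \<Omega>) {z \<in> \<Omega>. u z < c}"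
    using assms(2) unfolding usc_on_def by blast
  then have "open {z \<in> \<Omega>. u z < c}"
    using assms(1) openin_open_trans by blast
  moreover have "(\<lambda>x. if x \<in> \<Omega> then u x else -\<infinity>) -` {..<c} =
      {z \<in> \<Omega>. u z < c} \<union> (if c = -\<infinity> then {} else - \<Omega>)"
    by auto
  ultimately show "(\<lambda>x. if x \<in> \<Omega> then u x else -\<infinity>) -` {..<c} \<inter> space borel \<in> sets borel"
    using assms(1) by auto
qed

lemma usc_on_attains_sup:
  fixes g :: "complex ^ 'n \<Rightarrow> ereal"
  assumes "compact T" "T \<noteq> {}" "usc_on T g"
  shows "\<exists>x\<in>T. \<forall>y\<in>T. g y \<le> g x"
proof (rule ccontr)
  assume "\<not> ?thesis"
  then have *: "\<forall>x\<in>T. \<exists>y\<in>T. g x < g y" by (meson not_le)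
  define \<C> where "\<C> = (\<lambda>y. {z \<in> T. g z < g y}) ` T"
  have "\<forall>c\<in>\<C>. openin (top_of_set T) c" "T \<subseteq> \<Union>\<C>"
    using assms(3) * unfolding \<C>_def usc_on_def by auto
  then obtain \<D> where "\<D> \<subseteq> \<C>" "finite \<D>" "T \<subseteq> \<Union>\<D>"
    using assms(1) unfolding compact_eq_openin_cover by metis
  then obtain Y where Y: "Y \<subseteq> T" "finite Y" "T \<subseteq> (\<Union>y\<in>Y. {z \<in> T. g z < g y})"
    unfolding \<C>_def by (metis (no_types, lifting) finite_subset_image)
  then have "Y \<noteq> {}" using assms(2) by auto
  then have "Max (g ` Y) \<in> g ` Y" using Y by (intro Max_in) auto
  then obtain y where y: "y \<in> Y" "g y = Max (g ` Y)" by auto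
  then obtain y' where "y' \<in> Y" "g y < g y'" using Y(1,3) by blast
  moreover have "g y' \<le> g y" using y Y \<open>y' \<in> Y\<close> by simp
  ultimately show False by simp
qed

lemma psh_usc: "plurisubharmonic_on \<Omega> u \<Longrightarrow> usc_on \<Omega> u"
  and psh_less_infty: "plurisubharmonic_on \<Omega> u \<Longrightarrow> z \<in> \<Omega> \<Longrightarrow> u z < \<infinity>"
  unfolding plurisubharmonic_on_def by auto

lemma psh_circle_mean:
  "plurisubharmonic_on \<Omega> u \<Longrightarrow> (\<And>\<zeta>. cmod \<zeta> \<le> 1 \<Longrightarrow> a + \<zeta> *s w \<in> \<Omega>)
    \<Longrightarrow> u a \<le> circle_mean (\<lambda>\<theta>. u (a + cis \<theta> *s w))"
  unfolding plurisubharmonic_on_def by blast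

lemma psh_bounded_above:
  fixes u :: "complex ^ 'n \<Rightarrow> ereal"
  assumes "plurisubharmonic_on \<Omega> u" "compact T" "T \<subseteq> \<Omega>"
  obtains B :: real where "0 \<le> B" "\<And>x. x \<in> T \<Longrightarrow> u x \<le> ereal B"
proof (cases "T = {}")
  case False
  obtain x where x: "x \<in> T" "\<forall>y\<in>T. u y \<le> u x"
    using usc_on_attains_sup[OF assms(2) False usc_on_subset[OF psh_usc[OF assms(1)] assms(3)]] by auto
  have "u x < \<infinity>" using psh_less_infty[OF assms(1)] x assms(3) by blast
  then have "u x \<le> ereal (max 0 (real_of_ereal (u x)))" by (cases "u x") auto
  then show ?thesis
    using that[of "max 0 (real_of_ereal (u x))"] x(2) by (meson max.cobounded1 order_trans)
qed (use that[of 0] in auto)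

text \<open>Translates the mean inequality, with its difference of two integrals, into a single
  inequality between nonnegative integrals. Since \<open>f \<le> B\<close>, the integral of the positive part is
  finite and can be moved to the other side.\<close>

lemma circle_mean_upper:
  fixes f :: "real \<Rightarrow> ereal"
  assumes [measurable]: "f \<in> borel_measurable borel" and B: "0 \<le> B"
    and fB: "\<And>\<theta>. f \<theta> \<le> ereal B" and a: "a \<le> circle_mean f" "a < \<infinity>"
  shows "(\<integral>\<^sup>+\<theta>\<in>{0..2*pi}. e2ennreal (ereal B - f \<theta>) \<partial>lborel) \<le> ennreal (2*pi) * e2ennreal (ereal B - a)"
proof (cases "a = -\<infinity>")
  case True
  then show ?thesis by (simp add: ennreal_mult_top)
next
  case False
  then obtain a' where a': "a = ereal a'" using a(2) by (cases a) auto
  define P where "P = (\<integral>\<^sup>+\<theta>\<in>{0..2*pi}. e2ennreal (f \<theta>) \<partial>lborel)"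
  define Q where "Q = (\<integral>\<^sup>+\<theta>\<in>{0..2*pi}. e2ennreal (- f \<theta>) \<partial>lborel)"
  define X where "X = (\<integral>\<^sup>+\<theta>\<in>{0..2*pi}. e2ennreal (ereal B - f \<theta>) \<partial>lborel)"
  have [measurable]: "(\<lambda>\<theta>. e2ennreal (f \<theta>)) \<in> borel_measurable borel"
    "(\<lambda>\<theta>. e2ennreal (- f \<theta>)) \<in> borel_measurable borel"
    "(\<lambda>\<theta>. e2ennreal (ereal B - f \<theta>)) \<in> borel_measurable borel"
    by measurable
  have "P \<le> (\<integral>\<^sup>+\<theta>\<in>{0..2*pi}. ennreal B \<partial>lborel)"
    unfolding P_def using e2ennreal_mono[OF fB]
    by (intro nn_integral_mono) (auto simp: indicator_def)
  also have "\<dots> = ennreal (2 * pi * B)"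
    using B by (subst nn_integral_cmult) (auto simp: ennreal_mult mult.commute)
  finally have Pfin: "P < top" using ennreal_less_top le_less_trans by blast
  have eq: "e2ennreal (ereal B - f \<theta>) + e2ennreal (f \<theta>) = ennreal B + e2ennreal (- f \<theta>)" for \<theta>
  proof (cases "f \<theta>")
    case (real c)
    then have "c \<le> B" using fB[of \<theta>] by simp
    with real B show ?thesis
      by (cases "0 \<le> c") (simp_all add: ennreal_neg flip: ennreal_plus)
  qed (use fB[of \<theta>] in auto)
  have "X + P = (\<integral>\<^sup>+\<theta>. (e2ennreal (ereal B - f \<theta>) + e2ennreal (f \<theta>)) * indicator {0..2*pi} \<theta> \<partial>lborel)"
    unfolding X_def P_def by (subst nn_integral_add[symmetric]) (auto simp: distrib_right)
  also have "\<dots> = (\<integral>\<^sup>+\<theta>. ennreal B * indicator {0..2*pi} \<theta> \<partial>lborel) + Q"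
    unfolding Q_def eq by (subst nn_integral_add[symmetric]) (auto simp: distrib_right)
  also have "(\<integral>\<^sup>+\<theta>. ennreal B * indicator {0..2*pi} \<theta> \<partial>lborel) = ennreal (2 * pi * B)"
    using B by (subst nn_integral_cmult) (auto simp: ennreal_mult mult.commute)
  finally have XP: "X + P = ennreal (2 * pi * B) + Q" .
  have mean: "ereal a' \<le> (enn2ereal P - enn2ereal Q) / ereal (2*pi)"
    using a(1) unfolding circle_mean_def P_def Q_def a' .
  obtain p where p: "P = ennreal p" "0 \<le> p" using Pfin by (cases P) auto
  have "Q \<noteq> top"
  proof
    assume "Q = top"
    then show False using mean p by auto
  qed
  then obtain q where q: "Q = ennreal q" "0 \<le> q" by (cases Q) auto
  have le: "2 * pi * a' \<le> p - q"
    using mean p q by (simp add: pos_le_divide_eq mult.commute)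
  have "X \<noteq> top" using XP q B by (auto simp flip: ennreal_plus)
  then obtain x where x: "X = ennreal x" "0 \<le> x" by (cases X) auto
  have "x + p = 2 * pi * B + q"
    using XP x p q B by (simp flip: ennreal_plus)
  then have "x \<le> 2 * pi * (B - a')" using le by (simp add: algebra_simps)
  moreover have "a' \<le> B"
  proof -
    have "0 \<le> 2 * pi * (B - a')" using x calculation by linarith
    then show ?thesis using pi_gt_zero by (simp add: zero_le_mult_iff)
  qed
  ultimately show ?thesis
    unfolding X_def[symmetric] x a' by (simp flip: ennreal_mult add: ennreal_leI)
qed

text \<open>The value \<open>0\<close> off \<open>L\<close> makes \<open>deficit u B L\<close> a globally integrable function for compact \<open>L\<close>;
  the circle inequality is then only claimed for discs inside \<open>L\<close>.\<close>

definition deficit :: "(complex ^ 'n \<Rightarrow> ereal) \<Rightarrow> real \<Rightarrow> (complex ^ 'n) set \<Rightarrow> complex ^ 'n \<Rightarrow> ennreal" where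
  "deficit u B L x = (if x \<in> L then e2ennreal (ereal B - u x) else 0)"

lemma deficit_borel_measurable:
  fixes u :: "complex ^ 'n \<Rightarrow> ereal"
  assumes \<Omega>: "open \<Omega>" and u: "plurisubharmonic_on \<Omega> u" and L: "L \<subseteq> \<Omega>" and [measurable]: "L \<in> sets borel"
  shows "deficit u B L \<in> borel_measurable borel"
proof -
  define G where "G x = (if x \<in> \<Omega> then u x else -\<infinity>)" for x
  have [measurable]: "G \<in> borel_measurable borel"
    using usc_on_borel_measurable[OF \<Omega> psh_usc[OF u]] by (simp add: G_def[abs_def])
  have "deficit u B L = (\<lambda>x. if x \<in> L then e2ennreal (ereal B - G x) else 0)"
    using L by (auto simp: deficit_def G_def fun_eq_iff)
  then show ?thesis by simp
qed

lemma circle_super_deficit: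
  fixes u :: "complex ^ 'n \<Rightarrow> ereal"
  assumes \<Omega>: "open \<Omega>" and u: "plurisubharmonic_on \<Omega> u" and L: "L \<subseteq> \<Omega>" and B: "0 \<le> B"
    and uB: "\<And>x. x \<in> L \<Longrightarrow> u x \<le> ereal B"
  shows "circle_super (deficit u B L) L"
  unfolding circle_super_def
proof (intro allI impI)
  fix a w :: "complex ^ 'n"
  assume *: "\<forall>\<zeta>. cmod \<zeta> \<le> 1 \<longrightarrow> a + \<zeta> *s w \<in> L"
  have aL: "a \<in> L" using *[rule_format, of 0] by simp
  have L': "a + cis \<theta> *s w \<in> L" for \<theta> using * by simp
  define G where "G x = (if x \<in> \<Omega> then u x else -\<infinity>)" for x
  have [measurable]: "G \<in> borel_measurable borel"
    using usc_on_borel_measurable[OF \<Omega> psh_usc[OF u]] by (simp add: G_def[abs_def])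
  have "(\<lambda>\<theta>. G (a + cis \<theta> *s w)) \<in> borel_measurable borel" by measurable
  moreover have "G (a + cis \<theta> *s w) = u (a + cis \<theta> *s w)" for \<theta>
    using L'[of \<theta>] L by (auto simp: G_def)
  ultimately have m: "(\<lambda>\<theta>. u (a + cis \<theta> *s w)) \<in> borel_measurable borel" by simp
  have "u a \<le> circle_mean (\<lambda>\<theta>. u (a + cis \<theta> *s w))"
    using * L by (intro psh_circle_mean[OF u]) auto
  moreover have "u a < \<infinity>" using psh_less_infty[OF u] aL L by blast
  ultimately have "(\<integral>\<^sup>+\<theta>\<in>{0..2*pi}. e2ennreal (ereal B - u (a + cis \<theta> *s w)) \<partial>lborel)
      \<le> ennreal (2*pi) * e2ennreal (ereal B - u a)"
    by (intro circle_mean_upper[OF m B]) (use uB L' in auto)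
  then show "(\<integral>\<^sup>+\<theta>\<in>{0..2*pi}. deficit u B L (a + cis \<theta> *s w) \<partial>lborel) \<le> ennreal (2*pi) * deficit u B L a"
    using L' aL by (simp add: deficit_def)
qed

text \<open>The real version of \<open>u\<close>, with value \<open>0\<close> where \<open>u = -\<infinity>\<close>; for locally integrable \<open>u\<close> these
  points form a null set.\<close>

definition rval :: "(complex ^ 'n \<Rightarrow> ereal) \<Rightarrow> complex ^ 'n \<Rightarrow> real" where
  "rval u x = real_of_ereal (u x)"

lemma psh_L1loc_integrable:
  fixes u :: "complex ^ 'n \<Rightarrow> ereal"
  assumes \<Omega>: "open \<Omega>" and u: "plurisubharmonic_on \<Omega> u" and u1: "u \<in> L1loc \<Omega>"
    and T: "compact T" "T \<subseteq> \<Omega>"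
  shows "AE x in lborel. x \<in> T \<longrightarrow> \<bar>u x\<bar> \<noteq> \<infinity>" (is ?A)
    and "set_integrable lborel T (rval u)" (is ?B)
    and "(\<integral>\<^sup>+x\<in>T. e2ennreal \<bar>u x\<bar> \<partial>lborel) = ennreal (LINT x:T|lborel. \<bar>rval u x\<bar>)" (is ?C)
proof -
  define G where "G x = (if x \<in> \<Omega> then u x else -\<infinity>)" for x
  have [measurable]: "G \<in> borel_measurable borel"
    using usc_on_borel_measurable[OF \<Omega> psh_usc[OF u]] by (simp add: G_def[abs_def])
  have [measurable]: "T \<in> sets borel" using T(1) by (simp add: borel_compact)
  have GT: "x \<in> T \<Longrightarrow> G x = u x" for x using T by (auto simp: G_def)
  have "(\<integral>\<^sup>+x\<in>T. e2ennreal \<bar>u x\<bar> \<partial>lebesgue) < \<infinity>"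
    using u1 T unfolding L1loc_def by blast
  then have fin: "(\<integral>\<^sup>+x\<in>T. e2ennreal \<bar>u x\<bar> \<partial>lborel) < \<infinity>"
    by (simp add: nn_integral_completion)
  have uG: "e2ennreal \<bar>u x\<bar> * indicator T x = e2ennreal \<bar>G x\<bar> * indicator T x" for x
    using GT[of x] by (auto simp: indicator_def)
  have "AE x in lborel. e2ennreal \<bar>G x\<bar> * indicator T x \<noteq> \<infinity>"
    using fin unfolding uG by (intro nn_integral_PInf_AE) auto
  then show A: ?A
    by eventually_elim (auto simp: GT indicator_def)
  have reG: "indicator T x *\<^sub>R rval u x = indicator T x *\<^sub>R real_of_ereal (G x)" for x
    using GT[of x] by (auto simp: indicator_def rval_def)
  have nn: "(\<integral>\<^sup>+x. ennreal (indicator T x *\<^sub>R \<bar>rval u x\<bar>) \<partial>lborel) = (\<integral>\<^sup>+x\<in>T. e2ennreal \<bar>u x\<bar> \<partial>lborel)"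
  proof (rule nn_integral_cong_AE, use A in eventually_elim)
    fix x assume "x \<in> T \<longrightarrow> \<bar>u x\<bar> \<noteq> \<infinity>"
    then show "ennreal (indicator T x *\<^sub>R \<bar>rval u x\<bar>) = e2ennreal \<bar>u x\<bar> * indicator T x"
      by (cases "u x") (auto simp: indicator_def rval_def)
  qed
  have nn': "(\<integral>\<^sup>+x. ennreal (norm (indicator T x *\<^sub>R rval u x)) \<partial>lborel) = (\<integral>\<^sup>+x\<in>T. e2ennreal \<bar>u x\<bar> \<partial>lborel)"
    unfolding nn[symmetric] by (intro nn_integral_cong) (auto simp: indicator_def)
  show B: ?B
    unfolding set_integrable_def
  proof (rule integrableI_bounded)
    show "(\<lambda>x. indicator T x *\<^sub>R rval u x) \<in> borel_measurable lborel"
      unfolding reG by measurable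
  qed (use fin nn' in simp)
  then have "set_integrable lborel T (\<lambda>x. \<bar>rval u x\<bar>)" by (rule set_integrable_abs)
  then show ?C
    unfolding set_integrable_def set_lebesgue_integral_def nn[symmetric]
    by (intro nn_integral_eq_integral) auto
qed

lemma measure_cball_pos: "0 < r \<Longrightarrow> 0 < measure lborel (cball x r)" for x :: "complex ^ 'n"
  by (simp add: content_cball)

lemma emeasure_cball_eq: "emeasure lborel (cball x r) = ennreal (measure lborel (cball x r))" for x :: "complex ^ 'n"
  by (intro emeasure_eq_ennreal_measure) (use emeasure_compact_finite[OF compact_cball, of x r] in auto)

lemma nn_integral_deficit:
  fixes u :: "complex ^ 'n \<Rightarrow> ereal"
  assumes \<Omega>: "open \<Omega>" and u: "plurisubharmonic_on \<Omega> u" and u1: "u \<in> L1loc \<Omega>"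
    and T: "compact T" "T \<subseteq> \<Omega>" and uB: "\<And>x. x \<in> T \<Longrightarrow> u x \<le> ereal B"
  shows "(\<integral>\<^sup>+x\<in>T. e2ennreal (ereal B - u x) \<partial>lborel) = ennreal (LINT x:T|lborel. B - rval u x)"
    and "AE x in lborel. x \<in> T \<longrightarrow> 0 \<le> B - rval u x"
    and "set_integrable lborel T (\<lambda>x. B - rval u x)"
proof -
  note I = psh_L1loc_integrable[OF \<Omega> u u1 T]
  have fm: "T \<in> sets lborel" "emeasure lborel T < \<infinity>"
    using T emeasure_compact_finite[OF T(1)] by (auto simp: borel_compact)
  show S: "set_integrable lborel T (\<lambda>x. B - rval u x)"
    using I(2) fm by (intro set_integral_diff) (auto simp: set_integrable_def)
  show P: "AE x in lborel. x \<in> T \<longrightarrow> 0 \<le> B - rval u x"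
    using I(1)
  proof eventually_elim
    fix x assume "x \<in> T \<longrightarrow> \<bar>u x\<bar> \<noteq> \<infinity>"
    then show "x \<in> T \<longrightarrow> 0 \<le> B - rval u x" using uB[of x] by (cases "u x") (auto simp: rval_def)
  qed
  have "(\<integral>\<^sup>+x\<in>T. e2ennreal (ereal B - u x) \<partial>lborel) = (\<integral>\<^sup>+x. ennreal (indicator T x *\<^sub>R (B - rval u x)) \<partial>lborel)"
  proof (rule nn_integral_cong_AE, use I(1) in eventually_elim)
    fix x assume "x \<in> T \<longrightarrow> \<bar>u x\<bar> \<noteq> \<infinity>"
    then show "e2ennreal (ereal B - u x) * indicator T x = ennreal (indicator T x *\<^sub>R (B - rval u x))"
      by (cases "u x") (auto simp: indicator_def rval_def)
  qed
  also have "\<dots> = ennreal (LINT x:T|lborel. B - rval u x)"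
    unfolding set_lebesgue_integral_def
    using S P by (intro nn_integral_eq_integral) (auto simp: set_integrable_def indicator_def)
  finally show "(\<integral>\<^sup>+x\<in>T. e2ennreal (ereal B - u x) \<partial>lborel) = ennreal (LINT x:T|lborel. B - rval u x)" .
qed

lemma psh_ball_submean:
  fixes u :: "complex ^ 'n \<Rightarrow> ereal"
  assumes \<Omega>: "open \<Omega>" and u: "plurisubharmonic_on \<Omega> u" and u1: "u \<in> L1loc \<Omega>"
    and r: "0 < r" "cball x r \<subseteq> \<Omega>"
  shows "u x \<le> ereal ((LINT y:cball x r|lborel. rval u y) / measure lborel (cball x r))"
proof -
  obtain B where B: "0 \<le> B" "\<And>y. y \<in> cball x r \<Longrightarrow> u y \<le> ereal B"
    using psh_bounded_above[OF u compact_cball r(2)] by blast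
  define F where "F = deficit u B (cball x r)"
  note D = nn_integral_deficit[OF \<Omega> u u1 compact_cball r(2) B(2)]
  have "(\<integral>\<^sup>+y\<in>cball x r. F y \<partial>lborel) \<le> emeasure lborel (cball x r) * F x"
    unfolding F_def
    by (rule circle_super_cball[OF _ circle_super_deficit[OF \<Omega> u r(2) B]])
       (auto intro!: deficit_borel_measurable[OF \<Omega> u r(2)])
  also have "(\<integral>\<^sup>+y\<in>cball x r. F y \<partial>lborel) = (\<integral>\<^sup>+y\<in>cball x r. e2ennreal (ereal B - u y) \<partial>lborel)"
    unfolding F_def by (intro nn_integral_cong) (auto simp: deficit_def indicator_def)
  also have "\<dots> = ennreal (LINT y:cball x r|lborel. B - rval u y)"
    by (rule D(1))
  also have "(LINT y:cball x r|lborel. B - rval u y) = B * measure lborel (cball x r) - (LINT y:cball x r|lborel. rval u y)"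
    using psh_L1loc_integrable(2)[OF \<Omega> u u1 compact_cball r(2)]
      emeasure_compact_finite[OF compact_cball, of x r]
    by (subst set_integral_diff) (auto simp: set_integrable_def set_lebesgue_integral_def)
  finally have le: "ennreal (B * measure lborel (cball x r) - (LINT y:cball x r|lborel. rval u y))
      \<le> ennreal (measure lborel (cball x r)) * F x"
    unfolding emeasure_cball_eq .
  show ?thesis
  proof (cases "u x")
    case (real c)
    have cB: "c \<le> B" using B(2)[of x] r real by auto
    have "F x = ennreal (B - c)" using real r by (simp add: F_def deficit_def)
    with le cB have "B * measure lborel (cball x r) - (LINT y:cball x r|lborel. rval u y)
        \<le> measure lborel (cball x r) * (B - c)"
      by (simp flip: ennreal_mult)
    then show ?thesis using measure_cball_pos[OF r(1), of x] real
      by (simp add: pos_le_divide_eq algebra_simps)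
  next
    case PInf
    moreover have "x \<in> \<Omega>" using r by (auto simp: subset_iff)
    ultimately show ?thesis using psh_less_infty[OF u, of x] by auto
  qed auto
qed

section \<open>Maximum principle and convexity of spherical suprema\<close>

lemma ln_le_cubic:
  fixes y :: real
  assumes "-1 < y"
  shows "ln (1 + y) \<le> y - y\<^sup>2 / 2 + y ^ 3 / 3"
proof -
  define g where "g y = y - y\<^sup>2 / 2 + y ^ 3 / 3 - ln (1 + y)" for y :: real
  have D: "(g has_real_derivative (y ^ 3 / (1 + y))) (at y)" if "-1 < y" for y
    unfolding g_def using that
    by (auto intro!: derivative_eq_intros simp: field_simps power2_eq_square power3_eq_cube)
  have "g 0 \<le> g y"
  proof (cases "0 \<le> y")
    case True
    show ?thesis
      by (rule DERIV_nonneg_imp_nondecreasing[OF True]) (use D in \<open>force intro: divide_nonneg_pos\<close>)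
  next
    case False
    then have y0: "y \<le> 0" by simp
    have "\<exists>d. (g has_real_derivative d) (at x) \<and> d \<le> 0" if "y \<le> x" "x \<le> 0" for x
      using D[of x] that assms
      by (intro exI[of _ "x ^ 3 / (1 + x)"])
         (auto simp: divide_nonpos_pos power3_eq_cube mult_nonneg_nonpos)
    then show ?thesis
      by (intro DERIV_nonpos_imp_nonincreasing[OF y0]) auto
  qed
  then show ?thesis by (simp add: g_def)
qed

text \<open>The second-order term is a pure multiple of \<open>cos (2 * \<theta>)\<close>, without constant part, because the
  logarithm is harmonic; so the circle mean of the right-hand side is of third order in \<open>\<rho>\<close>.\<close>

lemma ln_cmod_one_plus_le:
  assumes "0 < \<rho>" "\<rho> < 1"
  shows "ln (cmod (1 + of_real \<rho> * cis \<theta>)) \<le> \<rho> * cos \<theta> - \<rho>\<^sup>2 * cos (2 * \<theta>) / 2 + 11 * \<rho> ^ 3 / 2"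
proof -
  define y where "y = 2 * \<rho> * cos \<theta> + \<rho>\<^sup>2"
  have sq: "(cmod (1 + of_real \<rho> * cis \<theta>))\<^sup>2 = 1 + y"
  proof -
    have "(cmod (1 + of_real \<rho> * cis \<theta>))\<^sup>2 = (1 + \<rho> * cos \<theta>)\<^sup>2 + (\<rho> * sin \<theta>)\<^sup>2"
      by (simp add: cmod_power2)
    also have "\<dots> = 1 + 2 * \<rho> * cos \<theta> + \<rho>\<^sup>2 * ((sin \<theta>)\<^sup>2 + (cos \<theta>)\<^sup>2)"
      by (simp only: power2_eq_square) algebra
    finally show ?thesis by (simp add: y_def)
  qed
  have "cmod (of_real \<rho> * cis \<theta>) < 1" using assms by (simp add: norm_mult)
  then have ne: "1 + of_real \<rho> * cis \<theta> \<noteq> 0"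
    by (metis add_eq_0_iff norm_minus_cancel norm_one less_irrefl)
  then have pos: "0 < cmod (1 + of_real \<rho> * cis \<theta>)" by simp
  then have y1: "-1 < y" using sq by (smt (verit) zero_less_power)
  have "2 * ln (cmod (1 + of_real \<rho> * cis \<theta>)) = ln (1 + y)"
    using pos sq by (metis ln_realpow of_nat_numeral)
  also have "\<dots> \<le> y - y\<^sup>2 / 2 + y ^ 3 / 3" by (rule ln_le_cubic[OF y1])
  also have "\<dots> \<le> 2 * \<rho> * cos \<theta> - \<rho>\<^sup>2 * cos (2 * \<theta>) + 11 * \<rho> ^ 3"
  proof -
    have "\<bar>\<rho> * cos \<theta>\<bar> \<le> \<rho>" using assms by (simp add: abs_mult mult_left_le)
    moreover have "\<rho>\<^sup>2 \<le> \<rho>" using assms by (simp add: power2_eq_square mult_left_le)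
    moreover have "0 \<le> \<rho>\<^sup>2" by simp
    ultimately have y3: "\<bar>y\<bar> \<le> 3 * \<rho>" unfolding y_def abs_le_iff using assms by linarith
    have "y ^ 3 \<le> \<bar>y\<bar> ^ 3" by (metis abs_ge_self power_abs)
    also have "\<dots> \<le> (3 * \<rho>) ^ 3" using y3 by (intro power_mono) auto
    finally have c: "y ^ 3 / 3 \<le> 9 * \<rho> ^ 3" by (simp add: power_mult_distrib)
    have "y\<^sup>2 = 4 * \<rho>\<^sup>2 * (cos \<theta>)\<^sup>2 + 4 * \<rho> ^ 3 * cos \<theta> + \<rho> ^ 4"
      by (simp add: y_def power2_eq_square power3_eq_cube power4_eq_xxxx algebra_simps)
    moreover have "\<rho> ^ 3 * cos \<theta> \<ge> - (\<rho> ^ 3)"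
      using assms mult_left_mono[of "-1" "cos \<theta>" "\<rho> ^ 3"] by simp
    moreover have "0 \<le> \<rho> ^ 4" by simp
    ultimately have "4 * \<rho>\<^sup>2 * (cos \<theta>)\<^sup>2 - 4 * \<rho> ^ 3 \<le> y\<^sup>2" by linarith
    moreover have "\<rho>\<^sup>2 * cos (2 * \<theta>) = 2 * \<rho>\<^sup>2 * (cos \<theta>)\<^sup>2 - \<rho>\<^sup>2"
      by (simp only: cos_double_cos) algebra
    ultimately show ?thesis using c unfolding y_def by linarith
  qed
  finally show ?thesis by simp
qed

lemma circle_mean_mono:
  assumes "\<And>\<theta>. f \<theta> \<le> g \<theta>"
  shows "circle_mean f \<le> circle_mean g"
  unfolding circle_mean_def
proof (intro ereal_divide_right_mono ereal_minus_mono)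
  show "enn2ereal (\<integral>\<^sup>+\<theta>\<in>{0..2*pi}. e2ennreal (f \<theta>) \<partial>lborel) \<le> enn2ereal (\<integral>\<^sup>+\<theta>\<in>{0..2*pi}. e2ennreal (g \<theta>) \<partial>lborel)"
    using assms by (subst less_eq_ennreal.rep_eq[symmetric])
      (intro nn_integral_mono mult_right_mono e2ennreal_mono, auto)
  show "enn2ereal (\<integral>\<^sup>+\<theta>\<in>{0..2*pi}. e2ennreal (- g \<theta>) \<partial>lborel) \<le> enn2ereal (\<integral>\<^sup>+\<theta>\<in>{0..2*pi}. e2ennreal (- f \<theta>) \<partial>lborel)"
    using assms by (subst less_eq_ennreal.rep_eq[symmetric])
      (intro nn_integral_mono mult_right_mono e2ennreal_mono, auto)
qed auto

lemma circle_mean_trig: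
  "circle_mean (\<lambda>\<theta>. ereal (A + B * cos \<theta> + C * cos (2 * \<theta>))) = ereal A"
proof -
  define h where "h \<theta> = A + B * cos \<theta> + C * cos (2 * \<theta>)" for \<theta>
  define F where "F \<theta> = A * \<theta> + B * sin \<theta> + C * sin (2 * \<theta>) / 2" for \<theta>
  have D: "(F has_real_derivative h \<theta>) (at \<theta>)" for \<theta>
    unfolding F_def h_def by (auto intro!: derivative_eq_intros)
  have C: "isCont h \<theta>" for \<theta> unfolding h_def by (intro continuous_intros)
  have int: "integrable lborel (\<lambda>\<theta>. h \<theta> * indicator {0..2*pi} \<theta>)"
    "(LINT \<theta>|lborel. h \<theta> * indicator {0..2*pi} \<theta>) = F (2*pi) - F 0"
    using has_bochner_integral_FTC_Icc_real[of 0 "2*pi" F h] D C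
    by (auto simp: has_bochner_integral_iff)
  define P where "P = (\<integral>\<^sup>+\<theta>\<in>{0..2*pi}. e2ennreal (ereal (h \<theta>)) \<partial>lborel)"
  define Q where "Q = (\<integral>\<^sup>+\<theta>\<in>{0..2*pi}. e2ennreal (- ereal (h \<theta>)) \<partial>lborel)"
  have P: "P = (\<integral>\<^sup>+\<theta>. ennreal (h \<theta> * indicator {0..2*pi} \<theta>) \<partial>lborel)"
    unfolding P_def by (intro nn_integral_cong) (auto simp: indicator_def)
  have Q: "Q = (\<integral>\<^sup>+\<theta>. ennreal (- (h \<theta> * indicator {0..2*pi} \<theta>)) \<partial>lborel)"
    unfolding Q_def by (intro nn_integral_cong) (auto simp: indicator_def)
  have fin: "P \<noteq> \<infinity>" "Q \<noteq> \<infinity>"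
    using int(1) unfolding real_integrable_def P Q by auto
  obtain p where p: "P = ennreal p" "0 \<le> p" using fin(1) by (cases P) auto
  obtain q where q: "Q = ennreal q" "0 \<le> q" using fin(2) by (cases Q) auto
  have "p - q = F (2*pi) - F 0"
    using real_lebesgue_integral_def[OF int(1)] int(2) p q unfolding P[symmetric] Q[symmetric] by simp
  also have "F (2*pi) - F 0 = 2 * pi * A"
    unfolding F_def using sin_2npi[of 2] by simp
  finally show ?thesis
    unfolding circle_mean_def h_def[symmetric] P_def[symmetric] Q_def[symmetric] using p q by simp
qed

lemma circle_mean_le_trig:
  assumes "\<And>\<theta>. f \<theta> \<le> ereal (A + B * cos \<theta> + C * cos (2 * \<theta>))"
  shows "circle_mean f \<le> ereal A"
  using circle_mean_mono[of f, OF assms] unfolding circle_mean_trig .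

lemma norm_disc_point:
  fixes x z :: "complex ^ 'n"
  shows "norm (x + c *s (x - z) - z) = cmod (1 + c) * norm (x - z)"
proof -
  have "x + c *s (x - z) - z = (1 + c) *s (x - z)"
    by (simp add: vec_eq_iff algebra_simps)
  then show ?thesis by (simp only: norm_cscale)
qed

text \<open>Around \<open>x\<close>, on the complex line through \<open>z\<close>, the majorant is a multiple of the logarithm of
  the distance from \<open>z\<close>, whose circle mean vanishes up to third order, minus a quadratic term, which
  lowers the mean by a second-order amount. Small circles thus violate the mean inequality for \<open>u\<close>.\<close>

lemma psh_no_touching:
  fixes u :: "complex ^ 'n \<Rightarrow> ereal" and x z :: "complex ^ 'n"
  assumes u: "plurisubharmonic_on \<Omega> u" and c: "u x = ereal c" and a: "0 \<le> a" and \<delta>: "0 < \<delta>" and R: "0 < R"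
    and disc: "\<And>\<zeta>. cmod \<zeta> < R \<Longrightarrow> x + \<zeta> *s (x - z) \<in> \<Omega>"
    and le: "\<And>\<zeta>. cmod \<zeta> < R \<Longrightarrow>
      u (x + \<zeta> *s (x - z)) \<le> ereal (c + a * ln (cmod (1 + \<zeta>)) - \<delta> * ((cmod (1 + \<zeta>))\<^sup>2 - 1))"
  shows False
proof -
  \<comment> \<open>The third-order error is \<open>11 * a * \<rho> ^ 3 / 2\<close>, which \<open>\<rho>\<close> makes smaller than \<open>\<delta> * \<rho>\<^sup>2\<close>.\<close>
  define \<rho> where "\<rho> = min (min (R / 2) (1 / 2)) (\<delta> / (11 * a + 1))"
  have \<rho>: "0 < \<rho>" "\<rho> < 1" "\<rho> < R" "\<rho> \<le> \<delta> / (11 * a + 1)"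
    using R \<delta> a by (auto simp: \<rho>_def)
  define A where "A = c + 11 * a * \<rho> ^ 3 / 2 - \<delta> * \<rho>\<^sup>2"
  have "(11 * a + 1) * \<rho> \<le> \<delta>"
    using \<rho>(4) a by (simp add: pos_le_divide_eq mult.commute)
  then have "\<rho>\<^sup>2 * ((11 * a + 1) * \<rho>) \<le> \<rho>\<^sup>2 * \<delta>"
    by (intro mult_left_mono) auto
  then have "11 * a * \<rho> ^ 3 + \<rho> ^ 3 \<le> \<delta> * \<rho>\<^sup>2"
    by (simp add: power2_eq_square power3_eq_cube algebra_simps)
  moreover have "0 < \<rho> ^ 3" "0 \<le> a * \<rho> ^ 3" using \<rho>(1) a by auto
  ultimately have Ac: "A < c" unfolding A_def by linarith
  have "u x \<le> circle_mean (\<lambda>\<theta>. u (x + cis \<theta> *s (of_real \<rho> *s (x - z))))"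
  proof (rule psh_circle_mean[OF u])
    fix \<zeta> :: complex assume "cmod \<zeta> \<le> 1"
    then have "cmod (\<zeta> * of_real \<rho>) < R"
      using \<rho> by (simp add: norm_mult) (smt (verit) mult_left_le_one_le norm_ge_zero)
    then show "x + \<zeta> *s (of_real \<rho> *s (x - z)) \<in> \<Omega>"
      using disc by (simp add: vector_smult_assoc)
  qed
  also have "\<dots> \<le> ereal A"
  proof (rule circle_mean_le_trig)
    fix \<theta>
    let ?\<zeta> = "of_real \<rho> * cis \<theta>"
    have sq: "(cmod (1 + ?\<zeta>))\<^sup>2 - 1 = 2 * \<rho> * cos \<theta> + \<rho>\<^sup>2"
    proof -
      have "(cmod (1 + ?\<zeta>))\<^sup>2 = (1 + \<rho> * cos \<theta>)\<^sup>2 + (\<rho> * sin \<theta>)\<^sup>2"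
        by (simp add: cmod_power2)
      also have "\<dots> = 1 + 2 * \<rho> * cos \<theta> + \<rho>\<^sup>2 * ((sin \<theta>)\<^sup>2 + (cos \<theta>)\<^sup>2)"
        by (simp only: power2_eq_square) algebra
      finally show ?thesis by simp
    qed
    have "cmod ?\<zeta> < R" using \<rho> by (simp add: norm_mult)
    then have "u (x + ?\<zeta> *s (x - z)) \<le> ereal (c + a * ln (cmod (1 + ?\<zeta>)) - \<delta> * (2 * \<rho> * cos \<theta> + \<rho>\<^sup>2))"
      using le[of ?\<zeta>] sq by simp
    also have "a * ln (cmod (1 + ?\<zeta>)) \<le> a * (\<rho> * cos \<theta> - \<rho>\<^sup>2 * cos (2 * \<theta>) / 2 + 11 * \<rho> ^ 3 / 2)"
      using ln_cmod_one_plus_le[OF \<rho>(1,2)] a by (rule mult_left_mono)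
    also have "c + a * (\<rho> * cos \<theta> - \<rho>\<^sup>2 * cos (2 * \<theta>) / 2 + 11 * \<rho> ^ 3 / 2) - \<delta> * (2 * \<rho> * cos \<theta> + \<rho>\<^sup>2)
        = A + (a * \<rho> - 2 * \<delta> * \<rho>) * cos \<theta> + (- a * \<rho>\<^sup>2 / 2) * cos (2 * \<theta>)"
      by (simp add: A_def algebra_simps)
    finally show "u (x + cis \<theta> *s (of_real \<rho> *s (x - z)))
        \<le> ereal (A + (a * \<rho> - 2 * \<delta> * \<rho>) * cos \<theta> + (- a * \<rho>\<^sup>2 / 2) * cos (2 * \<theta>))"
      by (simp add: vector_smult_assoc mult.commute)
  qed
  finally show False using c Ac by simp
qed

lemma usc_on_minus_continuous:
  fixes g :: "complex ^ 'n \<Rightarrow> ereal"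
  assumes g: "usc_on T g" and h: "continuous_on T h"
  shows "usc_on T (\<lambda>x. g x - ereal (h x))"
  unfolding usc_on_def
proof
  fix c :: ereal
  have eq: "{z \<in> T. g z - ereal (h z) < c} = (\<Union>d. {z \<in> T. g z < ereal d} \<inter> {z \<in> T. ereal d < c + ereal (h z)})"
  proof -
    have "g z - ereal (h z) < c \<longleftrightarrow> (\<exists>d. g z < ereal d \<and> ereal d < c + ereal (h z))" for z
    proof -
      have "g z - ereal (h z) < c \<longleftrightarrow> g z < c + ereal (h z)"
        by (cases "g z"; cases c) auto
      also have "\<dots> \<longleftrightarrow> (\<exists>d. g z < ereal d \<and> ereal d < c + ereal (h z))"
        using ereal_dense2 less_trans by blast
      finally show ?thesis .
    qed
    then show ?thesis by auto
  qed
  have "openin (top_of_set T) {z \<in> T. ereal d < c + ereal (h z)}" for d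
  proof (cases c)
    case (real c')
    have "{z \<in> T. ereal d < c + ereal (h z)} = T \<inter> h -` {d - c'<..}"
      using real by (auto simp: algebra_simps)
    then show ?thesis using continuous_openin_preimage_gen[OF h open_greaterThan] by simp
  qed auto
  then show "openin (top_of_set T) {z \<in> T. g z - ereal (h z) < c}"
    unfolding eq using g unfolding usc_on_def by (intro openin_Union) auto
qed

text \<open>The maximum principle behind both comparison results below. If \<open>u\<close> exceeded the
  majorant \<open>a log \<bar>x - z\<bar> + b\<close> somewhere, then so it would after adding the small strictly
  superharmonic term \<open>\<epsilon> (t\<^sup>2 - \<bar>x - z\<bar>\<^sup>2)\<close>, and the maximum of the difference would be
  attained at a point around which a whole disc in the radial complex line lies in \<open>T\<close>.\<close>

lemma psh_radial_comparison:
  fixes u :: "complex ^ 'n \<Rightarrow> ereal" and z :: "complex ^ 'n"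
  assumes u: "plurisubharmonic_on \<Omega> u" and T: "compact T" "T \<subseteq> \<Omega>" "T \<subseteq> cball z t" and a: "0 \<le> a"
    and cont: "continuous_on T (\<lambda>x. a * ln (norm (x - z)))"
    and interior: "\<And>p. p \<in> T \<Longrightarrow> \<not> u p \<le> ereal (a * ln (norm (p - z)) + b) \<Longrightarrow>
      p \<noteq> z \<and> (\<exists>R>0. R \<le> 1 \<and> (\<forall>\<zeta>. cmod \<zeta> < R \<longrightarrow> p + \<zeta> *s (p - z) \<in> T))"
    and x: "x \<in> T"
  shows "u x \<le> ereal (a * ln (norm (x - z)) + b)"
proof -
  have key: "u x \<le> ereal (a * ln (norm (x - z)) + b + \<epsilon> * (t\<^sup>2 - (norm (x - z))\<^sup>2))" if \<epsilon>: "0 < \<epsilon>" for \<epsilon>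
  proof -
    define h where "h x = a * ln (norm (x - z)) + b + \<epsilon> * (t\<^sup>2 - (norm (x - z))\<^sup>2)" for x
    have hc: "continuous_on T h" unfolding h_def by (intro continuous_intros cont)
    obtain p where p: "p \<in> T" and pmax: "\<And>y. y \<in> T \<Longrightarrow> u y - ereal (h y) \<le> u p - ereal (h p)"
      using usc_on_attains_sup[OF T(1) _ usc_on_minus_continuous[OF usc_on_subset[OF psh_usc[OF u] T(2)] hc]] x by blast
    have "u p \<le> ereal (h p)"
    proof (rule ccontr)
      assume neg: "\<not> u p \<le> ereal (h p)"
      then obtain c where c: "u p = ereal c"
        using psh_less_infty[OF u, of p] p T(2) by (cases "u p") auto
      have "norm (p - z) \<le> t" using p T(3) by (auto simp: dist_norm norm_minus_commute subset_iff)
      then have "(norm (p - z))\<^sup>2 \<le> t\<^sup>2" by (intro power_mono) auto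
      then have "0 \<le> \<epsilon> * (t\<^sup>2 - (norm (p - z))\<^sup>2)" using \<epsilon> by simp
      then have "\<not> u p \<le> ereal (a * ln (norm (p - z)) + b)"
        using neg c by (simp add: h_def)
      from interior[OF p this] obtain R where R: "p \<noteq> z" "0 < R" "R \<le> 1"
        and inT: "\<And>\<zeta>. cmod \<zeta> < R \<Longrightarrow> p + \<zeta> *s (p - z) \<in> T" by blast
      define D where "D = norm (p - z)"
      have D0: "0 < D" using R(1) by (simp add: D_def)
      have hdiff: "h (p + \<zeta> *s (p - z)) = h p + a * ln (cmod (1 + \<zeta>)) - \<epsilon> * D\<^sup>2 * ((cmod (1 + \<zeta>))\<^sup>2 - 1)"
        if "cmod \<zeta> < R" for \<zeta>
      proof -
        have "1 - cmod \<zeta> \<le> cmod (1 + \<zeta>)" using norm_triangle_ineq2[of 1 "- \<zeta>"] by simp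
        then have "0 < cmod (1 + \<zeta>)" using that R(3) by linarith
        then have "ln (cmod (1 + \<zeta>) * D) = ln (cmod (1 + \<zeta>)) + ln D" using D0 by (simp add: ln_mult)
        then show ?thesis
          unfolding h_def norm_disc_point D_def[symmetric] by (simp add: power_mult_distrib algebra_simps)
      qed
      show False
      proof (rule psh_no_touching[OF u c a _ R(2)])
        show "0 < \<epsilon> * D\<^sup>2" using \<epsilon> D0 by simp
        show "p + \<zeta> *s (p - z) \<in> \<Omega>" if "cmod \<zeta> < R" for \<zeta> using inT[OF that] T(2) by blast
        show "u (p + \<zeta> *s (p - z)) \<le> ereal (c + a * ln (cmod (1 + \<zeta>)) - \<epsilon> * D\<^sup>2 * ((cmod (1 + \<zeta>))\<^sup>2 - 1))"
          if "cmod \<zeta> < R" for \<zeta>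
        proof -
          have "u (p + \<zeta> *s (p - z)) - ereal (h (p + \<zeta> *s (p - z))) \<le> ereal (c - h p)"
            using pmax[OF inT[OF that]] c by simp
          then have "u (p + \<zeta> *s (p - z)) \<le> ereal (c - h p + h (p + \<zeta> *s (p - z)))"
            by (cases "u (p + \<zeta> *s (p - z))") auto
          moreover have "c - h p + h (p + \<zeta> *s (p - z)) = c + a * ln (cmod (1 + \<zeta>)) - \<epsilon> * D\<^sup>2 * ((cmod (1 + \<zeta>))\<^sup>2 - 1)"
            using hdiff[OF that] by linarith
          ultimately show ?thesis by (simp only:)
        qed
      qed
    qed
    then have "u p - ereal (h p) \<le> 0" by (cases "u p") auto
    then have "u x - ereal (h x) \<le> 0" using pmax[OF x] by (rule order_trans[rotated])
    then show ?thesis unfolding h_def[symmetric] by (cases "u x") auto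
  qed
  show ?thesis
  proof (cases "u x")
    case (real v)
    have le: "v \<le> a * ln (norm (x - z)) + b + \<epsilon> * (t\<^sup>2 - (norm (x - z))\<^sup>2)" if "0 < \<epsilon>" for \<epsilon>
      using key[OF that] real by simp
    have "((\<lambda>\<epsilon>. a * ln (norm (x - z)) + b + \<epsilon> * (t\<^sup>2 - (norm (x - z))\<^sup>2)) \<longlongrightarrow>
        a * ln (norm (x - z)) + b + 0 * (t\<^sup>2 - (norm (x - z))\<^sup>2)) (at_right 0)"
      by (intro tendsto_intros)
    then have "v \<le> a * ln (norm (x - z)) + b + 0 * (t\<^sup>2 - (norm (x - z))\<^sup>2)"
      by (rule tendsto_lowerbound) (auto simp: eventually_at_filter intro!: always_eventually le)
    then show ?thesis using real by simp
  next
    case PInf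
    then show ?thesis using key[of 1] by simp
  qed simp
qed

lemma psh_shell_comparison:
  fixes u :: "complex ^ 'n \<Rightarrow> ereal" and z :: "complex ^ 'n"
  assumes u: "plurisubharmonic_on \<Omega> u" and ball: "cball z t \<subseteq> \<Omega>" and r: "0 < r" and a: "0 \<le> a"
    and out: "\<And>x. norm (x - z) = t \<Longrightarrow> u x \<le> ereal (a * ln t + b)"
    and inn: "\<And>x. norm (x - z) = r \<Longrightarrow> u x \<le> ereal (a * ln r + b)"
    and x: "r \<le> norm (x - z)" "norm (x - z) \<le> t"
  shows "u x \<le> ereal (a * ln (norm (x - z)) + b)"
proof (rule psh_radial_comparison[OF u _ _ _ a])
  let ?T = "cball z t - ball z r"
  have mem: "y \<in> ?T \<longleftrightarrow> r \<le> norm (y - z) \<and> norm (y - z) \<le> t" for y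
    by (auto simp: dist_norm norm_minus_commute)
  show "x \<in> ?T" using x mem by blast
  show "compact ?T" by (simp add: compact_diff)
  show "?T \<subseteq> \<Omega>" "?T \<subseteq> cball z t" using ball by auto
  show "continuous_on ?T (\<lambda>x. a * ln (norm (x - z)))"
    by (intro continuous_intros) (use r mem in auto)
  fix p assume p: "p \<in> ?T" and neg: "\<not> u p \<le> ereal (a * ln (norm (p - z)) + b)"
  define D where "D = norm (p - z)"
  have "D \<noteq> r" "D \<noteq> t" using neg inn[of p] out[of p] unfolding D_def by metis+
  then have D: "r < D" "D < t" "0 < D" using p r unfolding mem D_def[symmetric] by auto
  define R where "R = min (t / D - 1) (1 - r / D)"
  have R: "0 < R" "R \<le> 1" using D r by (simp_all add: R_def min_le_iff_disj)
  have "p + \<zeta> *s (p - z) \<in> ?T" if "cmod \<zeta> < R" for \<zeta>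
  proof -
    have "cmod (1 + \<zeta>) \<le> 1 + cmod \<zeta>" "1 - cmod \<zeta> \<le> cmod (1 + \<zeta>)"
      using norm_triangle_ineq[of 1 \<zeta>] norm_triangle_ineq2[of 1 "- \<zeta>"] by simp_all
    then have "cmod (1 + \<zeta>) \<le> t / D" "r / D \<le> cmod (1 + \<zeta>)"
      using that by (auto simp: R_def)
    then show ?thesis
      using D unfolding mem norm_disc_point D_def[symmetric] by (simp add: field_simps)
  qed
  then show "p \<noteq> z \<and> (\<exists>R>0. R \<le> 1 \<and> (\<forall>\<zeta>. cmod \<zeta> < R \<longrightarrow> p + \<zeta> *s (p - z) \<in> ?T))"
    using R D by (auto simp: D_def)
qed

lemma psh_sphere_max:
  fixes u :: "complex ^ 'n \<Rightarrow> ereal" and z :: "complex ^ 'n"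
  assumes u: "plurisubharmonic_on \<Omega> u" and ball: "cball z t \<subseteq> \<Omega>" and t: "0 < t"
    and out: "\<And>x. norm (x - z) = t \<Longrightarrow> u x \<le> ereal b" and x: "norm (x - z) \<le> t"
  shows "u x \<le> ereal b"
proof -
  \<comment> \<open>The radial discs degenerate at the centre, where one circle of radius \<open>t\<close> suffices.\<close>
  obtain w :: "complex ^ 'n" where w: "norm w = t"
    using vector_choose_size[of t] t by auto
  have "u z \<le> circle_mean (\<lambda>\<theta>. u (z + cis \<theta> *s w))"
    using circle_super_disc_in[OF ball] w by (intro psh_circle_mean[OF u]) auto
  also have "\<dots> \<le> ereal b"
    using circle_mean_le_trig[of "\<lambda>\<theta>. u (z + cis \<theta> *s w)" b 0 0] out w by (simp add: norm_cscale)
  finally have uz: "u z \<le> ereal b" .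
  have mem: "y \<in> cball z t \<longleftrightarrow> norm (y - z) \<le> t" for y
    by (auto simp: dist_norm norm_minus_commute)
  have "u x \<le> ereal (0 * ln (norm (x - z)) + b)"
  proof (rule psh_radial_comparison[OF u compact_cball ball subset_refl order_refl])
    show "x \<in> cball z t" using x mem by blast
    show "continuous_on (cball z t) (\<lambda>x. 0 * ln (norm (x - z)))" by simp
    fix p assume p: "p \<in> cball z t" and neg: "\<not> u p \<le> ereal (0 * ln (norm (p - z)) + b)"
    define D where "D = norm (p - z)"
    have "p \<noteq> z" "D \<noteq> t" using neg uz out[of p] unfolding D_def by auto
    then have D: "0 < D" "D < t" using p unfolding mem by (auto simp: D_def)
    define R where "R = min 1 (t / D - 1)"
    have R: "0 < R" "R \<le> 1" using D by (auto simp: R_def field_simps)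
    have "p + \<zeta> *s (p - z) \<in> cball z t" if "cmod \<zeta> < R" for \<zeta>
    proof -
      have "cmod (1 + \<zeta>) \<le> t / D" using norm_triangle_ineq[of 1 \<zeta>] that by (simp add: R_def)
      then show ?thesis
        using D unfolding mem norm_disc_point D_def[symmetric] by (simp add: field_simps)
    qed
    then show "p \<noteq> z \<and> (\<exists>R>0. R \<le> 1 \<and> (\<forall>\<zeta>. cmod \<zeta> < R \<longrightarrow> p + \<zeta> *s (p - z) \<in> cball z t))"
      using R \<open>p \<noteq> z\<close> by auto
  qed
  then show ?thesis by simp
qed

definition ball_sup :: "(complex ^ 'n \<Rightarrow> ereal) \<Rightarrow> complex ^ 'n \<Rightarrow> real \<Rightarrow> real" where
  "ball_sup u z r = real_of_ereal (SUP x\<in>cball z r. u x)"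

lemma ball_sup_eq:
  fixes u :: "complex ^ 'n \<Rightarrow> ereal"
  assumes \<Omega>: "open \<Omega>" and u: "plurisubharmonic_on \<Omega> u" and u1: "u \<in> L1loc \<Omega>"
    and r: "0 < r" "cball z r \<subseteq> \<Omega>"
  shows "(SUP x\<in>cball z r. u x) = ereal (ball_sup u z r)"
proof -
  obtain B where B: "0 \<le> B" "\<And>y. y \<in> cball z r \<Longrightarrow> u y \<le> ereal B"
    using psh_bounded_above[OF u compact_cball r(2)] by blast
  then have "(SUP x\<in>cball z r. u x) \<le> ereal B" by (intro SUP_least) auto
  moreover have "(SUP x\<in>cball z r. u x) \<noteq> -\<infinity>"
  proof
    assume "(SUP x\<in>cball z r. u x) = -\<infinity>"
    then have inf: "u x = -\<infinity>" if "x \<in> cball z r" for x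
      using SUP_upper[OF that, of u] by simp
    have "AE x in lborel. x \<notin> cball z r"
      using psh_L1loc_integrable(1)[OF \<Omega> u u1 compact_cball r(2)] inf by (auto elim!: eventually_mono)
    then have "emeasure lborel (cball z r) = 0"
      by (subst (asm) AE_iff_measurable[of "cball z r"]) auto
    then show False using measure_cball_pos[OF r(1), of z] by (simp add: measure_def)
  qed
  ultimately show ?thesis unfolding ball_sup_def by (cases "SUP x\<in>cball z r. u x") auto
qed

lemma ball_sup_upper:
  fixes u :: "complex ^ 'n \<Rightarrow> ereal"
  assumes "open \<Omega>" "plurisubharmonic_on \<Omega> u" "u \<in> L1loc \<Omega>" "0 < r" "cball z r \<subseteq> \<Omega>" "x \<in> cball z r"
  shows "u x \<le> ereal (ball_sup u z r)"
  unfolding ball_sup_eq[OF assms(1-5), symmetric] using assms(6) by (intro SUP_upper)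

lemma ball_sup_le:
  fixes u :: "complex ^ 'n \<Rightarrow> ereal"
  assumes "open \<Omega>" "plurisubharmonic_on \<Omega> u" "u \<in> L1loc \<Omega>" "0 < r" "cball z r \<subseteq> \<Omega>"
    and "\<And>x. x \<in> cball z r \<Longrightarrow> u x \<le> ereal b"
  shows "ball_sup u z r \<le> b"
proof -
  have "ereal (ball_sup u z r) \<le> ereal b"
    unfolding ball_sup_eq[OF assms(1-5), symmetric] using assms(6) by (intro SUP_least)
  then show ?thesis by simp
qed

lemma ball_sup_le_sphere:
  fixes u :: "complex ^ 'n \<Rightarrow> ereal"
  assumes "open \<Omega>" "plurisubharmonic_on \<Omega> u" "u \<in> L1loc \<Omega>" "0 < r" "cball z r \<subseteq> \<Omega>"
    and "\<And>x. norm (x - z) = r \<Longrightarrow> u x \<le> ereal b"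
  shows "ball_sup u z r \<le> b"
  using psh_sphere_max[OF assms(2,5,4,6)]
  by (intro ball_sup_le[OF assms(1-5)]) (auto simp: dist_norm norm_minus_commute)

lemma ball_sup_mono:
  fixes u :: "complex ^ 'n \<Rightarrow> ereal"
  assumes "open \<Omega>" "plurisubharmonic_on \<Omega> u" "u \<in> L1loc \<Omega>" "0 < r" "cball z t \<subseteq> \<Omega>" "cball w r \<subseteq> cball z t" "0 < t"
  shows "ball_sup u w r \<le> ball_sup u z t"
  using assms by (intro ball_sup_le[OF assms(1-4)] ball_sup_upper[of \<Omega>]) auto

lemma SUP_sphere_eq_ball_sup:
  fixes u :: "complex ^ 'n \<Rightarrow> ereal"
  assumes "open \<Omega>" "plurisubharmonic_on \<Omega> u" "u \<in> L1loc \<Omega>" "0 < r" "cball z r \<subseteq> \<Omega>"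
  shows "(SUP x\<in>sphere z r. u x) = ereal (ball_sup u z r)"
proof (rule antisym)
  show "(SUP x\<in>sphere z r. u x) \<le> ereal (ball_sup u z r)"
    by (intro SUP_least ball_sup_upper[OF assms]) auto
  show "ereal (ball_sup u z r) \<le> (SUP x\<in>sphere z r. u x)"
  proof (rule dense_le)
    fix y assume "y < ereal (ball_sup u z r)"
    show "y \<le> (SUP x\<in>sphere z r. u x)"
    proof (rule ccontr)
      assume *: "\<not> y \<le> (SUP x\<in>sphere z r. u x)"
      then have "y \<noteq> -\<infinity>" by auto
      then obtain y' where y': "y = ereal y'" using \<open>y < ereal _\<close> by (cases y) auto
      have "ball_sup u z r \<le> y'"
      proof (rule ball_sup_le_sphere[OF assms])
        fix x assume "norm (x - z) = r"
        then have "u x \<le> (SUP x\<in>sphere z r. u x)" by (intro SUP_upper) (simp add: dist_norm norm_minus_commute)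
        then show "u x \<le> ereal y'" using * y' by simp
      qed
      then show False using \<open>y < ereal _\<close> y' by simp
    qed
  qed
qed

text \<open>Hadamard's three-circle theorem. The majorant \<open>a log r + b\<close> agreeing with the supremum at the
  two outer radii bounds \<open>u\<close> on both boundary spheres, hence on the shell between them.\<close>

lemma ball_sup_three_circles:
  fixes u :: "complex ^ 'n \<Rightarrow> ereal"
  assumes \<Omega>: "open \<Omega>" "plurisubharmonic_on \<Omega> u" "u \<in> L1loc \<Omega>" and r: "0 < r" "r < s" "s \<le> t" and t: "cball z t \<subseteq> \<Omega>"
  shows "ball_sup u z s \<le> ball_sup u z r + (ball_sup u z t - ball_sup u z r) / (ln t - ln r) * (ln s - ln r)"
proof -
  define a where "a = (ball_sup u z t - ball_sup u z r) / (ln t - ln r)"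
  define b where "b = ball_sup u z r - a * ln r"
  have sub: "cball z r \<subseteq> cball z t" "cball z s \<subseteq> cball z t" using r by (auto intro: subset_cball)
  have pos: "0 < s" "0 < t" using r by auto
  have ln: "ln r < ln t" using r by simp
  have a: "0 \<le> a" unfolding a_def
    using ball_sup_mono[OF \<Omega> r(1) t sub(1) pos(2)] ln by simp
  have bt: "a * ln t + b = ball_sup u z t"
  proof -
    have "a * (ln t - ln r) = ball_sup u z t - ball_sup u z r" unfolding a_def using ln by simp
    then show ?thesis by (simp add: b_def algebra_simps)
  qed
  have "ball_sup u z s \<le> a * ln s + b"
  proof (rule ball_sup_le_sphere[OF \<Omega> pos(1)])
    show "cball z s \<subseteq> \<Omega>" using sub t by blast
    fix x assume x: "norm (x - z) = s"
    have rO: "cball z r \<subseteq> \<Omega>" using sub t by blast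
    have "u x \<le> ereal (a * ln (norm (x - z)) + b)"
    proof (rule psh_shell_comparison[OF \<Omega>(2) t r(1) a])
      show "u y \<le> ereal (a * ln t + b)" if "norm (y - z) = t" for y
        unfolding bt using that by (intro ball_sup_upper[OF \<Omega> pos(2) t]) (simp add: dist_norm norm_minus_commute)
      show "u y \<le> ereal (a * ln r + b)" if "norm (y - z) = r" for y
        unfolding b_def using ball_sup_upper[OF \<Omega> r(1) rO, of y] that by (simp add: dist_norm norm_minus_commute)
    qed (use x r in auto)
    then show "u x \<le> ereal (a * ln s + b)" using x by simp
  qed
  then show ?thesis unfolding b_def a_def[symmetric] by (simp add: algebra_simps)
qed

section \<open>Lelong numbers as limits of slopes\<close>

definition slope :: "(complex ^ 'n \<Rightarrow> ereal) \<Rightarrow> complex ^ 'n \<Rightarrow> real \<Rightarrow> real \<Rightarrow> real" where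
  "slope u z r t = (ball_sup u z t - ball_sup u z r) / (ln t - ln r)"

lemma slope_nonneg:
  fixes u :: "complex ^ 'n \<Rightarrow> ereal"
  assumes "open \<Omega>" "plurisubharmonic_on \<Omega> u" "u \<in> L1loc \<Omega>" "0 < r" "r < t" "cball z t \<subseteq> \<Omega>"
  shows "0 \<le> slope u z r t"
  unfolding slope_def
  using ball_sup_mono[of \<Omega> u r z t z] assms by (simp add: subset_cball)

lemma slope_mono:
  fixes u :: "complex ^ 'n \<Rightarrow> ereal"
  assumes "open \<Omega>" "plurisubharmonic_on \<Omega> u" "u \<in> L1loc \<Omega>" and r: "0 < r" "r < s" "s < t" and "cball z t \<subseteq> \<Omega>"
  shows "slope u z r s \<le> slope u z r t" and "slope u z r t \<le> slope u z s t"
proof -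
  have le: "ball_sup u z s \<le> ball_sup u z r + slope u z r t * (ln s - ln r)"
    unfolding slope_def by (rule ball_sup_three_circles) (use assms in auto)
  have ln: "0 < ln s - ln r" "0 < ln t - ln s" "0 < ln t - ln r" using r by auto
  show "slope u z r s \<le> slope u z r t"
    using le ln unfolding slope_def[of u z r s] by (simp add: pos_divide_le_eq)
  have "slope u z r t * (ln t - ln r) = ball_sup u z t - ball_sup u z r"
    unfolding slope_def using ln by simp
  then have "slope u z r t * (ln t - ln s) \<le> ball_sup u z t - ball_sup u z s"
    using le by (simp add: algebra_simps)
  then show "slope u z r t \<le> slope u z s t"
    using ln unfolding slope_def[of u z s t] by (simp add: pos_le_divide_eq)
qed

text \<open>The slopes from \<open>r\<close> to \<open>\<delta>\<close> decrease as \<open>r \<rightarrow> 0\<close>, so they converge to their infimum. The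
  quotient of the supremum by \<open>ln r\<close> has the same limit, since \<open>ln \<delta>\<close> and the supremum at radius \<open>\<delta>\<close>
  are negligible against \<open>ln r\<close>; in particular the limit in the definition exists.\<close>

lemma lelong_number_eq_lim_slope:
  fixes u :: "complex ^ 'n \<Rightarrow> ereal"
  assumes \<Omega>: "open \<Omega>" "plurisubharmonic_on \<Omega> u" "u \<in> L1loc \<Omega>" and \<delta>: "0 < \<delta>" "cball z \<delta> \<subseteq> \<Omega>"
  obtains l where "lelong_number u z = ereal l" "0 \<le> l" "\<And>r. 0 < r \<Longrightarrow> r < \<delta> \<Longrightarrow> l \<le> slope u z r \<delta>"
    "((\<lambda>r. slope u z r \<delta>) \<longlongrightarrow> l) (at_right 0)"
proof -
  define S where "S = (\<lambda>r. slope u z r \<delta>) ` {0<..<\<delta>}"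
  define l where "l = Inf S"
  have ne: "S \<noteq> {}" using \<delta>(1) by (auto simp: S_def dense)
  have nn: "0 \<le> x" if "x \<in> S" for x using that slope_nonneg[OF \<Omega> _ _ \<delta>(2)] by (auto simp: S_def)
  then have bdd: "bdd_below S" by (rule bdd_belowI)
  have l0: "0 \<le> l" unfolding l_def by (rule cInf_greatest[OF ne nn])
  have le: "l \<le> slope u z r \<delta>" if "0 < r" "r < \<delta>" for r
    unfolding l_def using that by (intro cInf_lower[OF _ bdd]) (auto simp: S_def)
  have ev: "eventually (\<lambda>r. 0 < r \<and> r < \<delta>) (at_right (0::real))"
    using \<delta>(1) eventually_at_right_real[of 0 \<delta>] by (auto elim: eventually_mono)
  have lim: "((\<lambda>r. slope u z r \<delta>) \<longlongrightarrow> l) (at_right 0)"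
  proof (rule decreasing_tendsto)
    show "eventually (\<lambda>r. l \<le> slope u z r \<delta>) (at_right 0)"
      using ev by eventually_elim (use le in auto)
    fix x assume "l < x"
    then obtain r where r: "0 < r" "r < \<delta>" "slope u z r \<delta> < x"
      unfolding l_def using cInf_less_iff[OF ne bdd] by (auto simp: S_def)
    have "eventually (\<lambda>s. 0 < s \<and> s < r) (at_right (0::real))"
      using r(1) eventually_at_right_real[of 0 r] by (auto elim: eventually_mono)
    then show "eventually (\<lambda>s. slope u z s \<delta> < x) (at_right 0)"
    proof eventually_elim
      fix s assume "0 < s \<and> s < r"
      then show "slope u z s \<delta> < x"
        using slope_mono(2)[OF \<Omega> _ _ r(2) \<delta>(2), of s] r(3) by auto
    qed
  qed
  have ev1: "eventually (\<lambda>r. 0 < r \<and> r < min \<delta> 1) (at_right (0::real))"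
    using \<delta>(1) eventually_at_right_real[of 0 "min \<delta> 1"] by (auto elim: eventually_mono)
  have ln0: "LIM r (at_right 0). ln r :: real :> at_bot" by (rule ln_at_0)
  have inv: "((\<lambda>r. inverse (ln r)) \<longlongrightarrow> (0::real)) (at_right 0)"
    by (rule filterlim_compose[OF tendsto_inverse_0])
       (rule filterlim_mono[OF ln0 at_bot_le_at_infinity order_refl])
  have "((\<lambda>r. ball_sup u z \<delta> * inverse (ln r) - slope u z r \<delta> * (ln \<delta> * inverse (ln r) - 1)) \<longlongrightarrow>
      ball_sup u z \<delta> * 0 - l * (ln \<delta> * 0 - 1)) (at_right 0)"
    by (intro tendsto_intros inv lim)
  moreover have "eventually (\<lambda>r. ball_sup u z \<delta> * inverse (ln r) - slope u z r \<delta> * (ln \<delta> * inverse (ln r) - 1)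
      = ball_sup u z r / ln r) (at_right 0)"
    using ev1
  proof eventually_elim
    fix r :: real assume r: "0 < r \<and> r < min \<delta> 1"
    then have ln: "ln r < 0" "ln r < ln \<delta>" by auto
    then have "slope u z r \<delta> * (ln \<delta> - ln r) = ball_sup u z \<delta> - ball_sup u z r"
      unfolding slope_def by simp
    moreover have "ln \<delta> * inverse (ln r) - 1 = (ln \<delta> - ln r) / ln r" using ln by (simp add: field_simps)
    ultimately show "ball_sup u z \<delta> * inverse (ln r) - slope u z r \<delta> * (ln \<delta> * inverse (ln r) - 1) = ball_sup u z r / ln r"
      using ln by (simp add: field_simps)
  qed
  ultimately have "((\<lambda>r. ball_sup u z r / ln r) \<longlongrightarrow> ball_sup u z \<delta> * 0 - l * (ln \<delta> * 0 - 1)) (at_right 0)"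
    by (rule Lim_transform_eventually)
  then have "((\<lambda>r. ereal (ball_sup u z r / ln r)) \<longlongrightarrow> ereal l) (at_right 0)"
    by simp
  moreover have "eventually (\<lambda>r. ereal (ball_sup u z r / ln r) = (SUP x\<in>sphere z r. u x) / ereal (ln r)) (at_right 0)"
    using ev1
  proof eventually_elim
    fix r :: real assume r: "0 < r \<and> r < min \<delta> 1"
    then have "cball z r \<subseteq> \<Omega>" using \<delta>(2) subset_cball[of r \<delta> z] by auto
    then show "ereal (ball_sup u z r / ln r) = (SUP x\<in>sphere z r. u x) / ereal (ln r)"
      using SUP_sphere_eq_ball_sup[OF \<Omega>, of r z] r by simp
  qed
  ultimately have "((\<lambda>r. (SUP x\<in>sphere z r. u x) / ereal (ln r)) \<longlongrightarrow> ereal l) (at_right 0)"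
    by (rule Lim_transform_eventually)
  then have "lelong_number u z = ereal l"
    unfolding lelong_number_def by (intro tendsto_Lim) auto
  then show ?thesis using that l0 le lim by blast
qed

section \<open>Compactness\<close>

lemma compactin_L1loc_subset: "compactin (L1loc_topology \<Omega>) U \<Longrightarrow> U \<subseteq> L1loc \<Omega>"
  using compactin_subset_topspace unfolding L1loc_topology_def topology_generated_by_topspace by fastforce

lemma L1loc_dist_eq:
  fixes u v :: "complex ^ 'n \<Rightarrow> ereal"
  assumes \<Omega>: "open \<Omega>" and u: "plurisubharmonic_on \<Omega> u" "u \<in> L1loc \<Omega>" and v: "plurisubharmonic_on \<Omega> v" "v \<in> L1loc \<Omega>"
    and L: "compact L" "L \<subseteq> \<Omega>"
  shows "(\<integral>\<^sup>+x\<in>L. e2ennreal \<bar>u x - v x\<bar> \<partial>lebesgue) = ennreal (LINT x:L|lborel. \<bar>rval u x - rval v x\<bar>)"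
proof -
  note Iu = psh_L1loc_integrable[OF \<Omega> u L] and Iv = psh_L1loc_integrable[OF \<Omega> v L]
  have "set_integrable lborel L (\<lambda>x. \<bar>rval u x - rval v x\<bar>)"
    by (intro set_integrable_abs set_integral_diff Iu(2) Iv(2))
  then have "ennreal (LINT x:L|lborel. \<bar>rval u x - rval v x\<bar>) = (\<integral>\<^sup>+x. ennreal (indicator L x *\<^sub>R \<bar>rval u x - rval v x\<bar>) \<partial>lborel)"
    unfolding set_integrable_def set_lebesgue_integral_def by (intro nn_integral_eq_integral[symmetric]) auto
  also have "\<dots> = (\<integral>\<^sup>+x\<in>L. e2ennreal \<bar>u x - v x\<bar> \<partial>lborel)"
  proof (rule nn_integral_cong_AE, use Iu(1) Iv(1) in eventually_elim)
    fix x assume "x \<in> L \<longrightarrow> \<bar>u x\<bar> \<noteq> \<infinity>" "x \<in> L \<longrightarrow> \<bar>v x\<bar> \<noteq> \<infinity>"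
    then show "ennreal (indicator L x *\<^sub>R \<bar>rval u x - rval v x\<bar>) = e2ennreal \<bar>u x - v x\<bar> * indicator L x"
      by (cases "u x"; cases "v x") (auto simp: indicator_def rval_def)
  qed
  finally show ?thesis by (simp add: nn_integral_completion)
qed

lemma L1loc_neighbourhood:
  fixes u :: "complex ^ 'n \<Rightarrow> ereal"
  assumes \<Omega>: "open \<Omega>" and u: "plurisubharmonic_on \<Omega> u" "u \<in> L1loc \<Omega>" and L: "compact L" "L \<subseteq> \<Omega>" and \<kappa>: "0 < \<kappa>"
  obtains V where "openin (L1loc_topology \<Omega>) V" "u \<in> V"
    "\<And>v. v \<in> V \<Longrightarrow> plurisubharmonic_on \<Omega> v \<Longrightarrow> (LINT x:L|lborel. \<bar>rval u x - rval v x\<bar>) < \<kappa>"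
proof -
  define V where "V = {v \<in> L1loc \<Omega>. (\<integral>\<^sup>+x\<in>L. e2ennreal \<bar>u x - v x\<bar> \<partial>lebesgue) < ennreal \<kappa>}"
  have "openin (L1loc_topology \<Omega>) V"
    unfolding L1loc_topology_def V_def using u L \<kappa> by (intro topology_generated_by_Basis) blast
  moreover have "u \<in> V"
    unfolding V_def mem_Collect_eq L1loc_dist_eq[OF \<Omega> u u L] using u \<kappa> by (simp add: set_lebesgue_integral_def)
  moreover have "(LINT x:L|lborel. \<bar>rval u x - rval v x\<bar>) < \<kappa>" if "v \<in> V" "plurisubharmonic_on \<Omega> v" for v
  proof -
    have "v \<in> L1loc \<Omega>" "(\<integral>\<^sup>+x\<in>L. e2ennreal \<bar>u x - v x\<bar> \<partial>lebesgue) < ennreal \<kappa>" using that(1) by (auto simp: V_def)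
    then show ?thesis unfolding L1loc_dist_eq[OF \<Omega> u that(2) \<open>v \<in> L1loc \<Omega>\<close> L]
      using \<kappa> by (simp add: ennreal_less_iff set_lebesgue_integral_def)
  qed
  ultimately show ?thesis using that by blast
qed

text \<open>A bound that holds locally on \<open>U \<times> K\<close>, with constants depending on the place, holds globally:
  the sum of the finitely many constants of a subcover serves everywhere by monotonicity.\<close>

lemma compactin_uniform_constant:
  fixes Q :: "real \<Rightarrow> 'a \<Rightarrow> 'b::metric_space \<Rightarrow> bool"
  assumes U: "compactin X U" and K: "compact K"
    and mono: "\<And>c d u z. c \<le> d \<Longrightarrow> Q c u z \<Longrightarrow> Q d u z"
    and loc: "\<And>u z. u \<in> U \<Longrightarrow> z \<in> K \<Longrightarrow> \<exists>V \<tau> c. openin X V \<and> u \<in> V \<and> 0 < \<tau> \<and> (\<forall>v\<in>V \<inter> U. \<forall>w\<in>ball z \<tau> \<inter> K. Q c v w)"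
  shows "\<exists>c. \<forall>u\<in>U. \<forall>z\<in>K. Q c u z"
proof -
  define \<W> where "\<W> = {V \<times> ball z \<tau> | V z \<tau>. openin X V \<and> 0 < \<tau> \<and> (\<exists>c. \<forall>v\<in>V \<inter> U. \<forall>w\<in>ball z \<tau> \<inter> K. Q c v w)}"
  have "compactin (prod_topology X euclidean) (U \<times> K)"
    using U K by (simp add: compactin_Times)
  moreover have "openin (prod_topology X euclidean) W" if "W \<in> \<W>" for W
    using that by (auto simp: \<W>_def openin_prod_Times_iff)
  moreover have "U \<times> K \<subseteq> \<Union>\<W>"
  proof clarify
    fix u z assume "u \<in> U" "z \<in> K"
    from loc[OF this] obtain V \<tau> c where *: "openin X V" "u \<in> V" "0 < \<tau>" "\<forall>v\<in>V \<inter> U. \<forall>w\<in>ball z \<tau> \<inter> K. Q c v w" by blast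
    then have "V \<times> ball z \<tau> \<in> \<W>" unfolding \<W>_def by blast
    moreover have "(u, z) \<in> V \<times> ball z \<tau>" using * by simp
    ultimately show "(u, z) \<in> \<Union>\<W>" by blast
  qed
  ultimately obtain \<F> where \<F>: "finite \<F>" "\<F> \<subseteq> \<W>" "U \<times> K \<subseteq> \<Union>\<F>"
    unfolding compactin_def by metis
  have "\<exists>c. \<forall>v w. (v, w) \<in> W \<and> v \<in> U \<and> w \<in> K \<longrightarrow> Q c v w" if "W \<in> \<F>" for W
  proof -
    have "W \<in> \<W>" using that \<F>(2) by blast
    then show ?thesis unfolding \<W>_def by fast
  qed
  then obtain f where f: "\<And>W v w. W \<in> \<F> \<Longrightarrow> (v, w) \<in> W \<Longrightarrow> v \<in> U \<Longrightarrow> w \<in> K \<Longrightarrow> Q (f W) v w"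
    by metis
  have "Q (\<Sum>W\<in>\<F>. \<bar>f W\<bar>) u z" if uz: "u \<in> U" "z \<in> K" for u z
  proof -
    obtain W where W: "W \<in> \<F>" "(u, z) \<in> W" using \<F>(3) uz by blast
    have "f W \<le> \<bar>f W\<bar>" by simp
    also have "\<dots> \<le> (\<Sum>W\<in>\<F>. \<bar>f W\<bar>)" using W(1) \<F>(1) by (intro member_le_sum) auto
    finally show ?thesis using mono f[OF W uz] by blast
  qed
  then show ?thesis by blast
qed

lemma compact_uniform_L1_bound:
  fixes U :: "(complex ^ 'n \<Rightarrow> ereal) set"
  assumes \<Omega>: "open \<Omega>" and U: "U \<subseteq> PSH \<Omega>" "compactin (L1loc_topology \<Omega>) U" and L: "compact L" "L \<subseteq> \<Omega>"
  obtains M where "0 \<le> M" "\<And>u. u \<in> U \<Longrightarrow> (LINT x:L|lborel. \<bar>rval u x\<bar>) \<le> M"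
proof -
  have psh: "plurisubharmonic_on \<Omega> u" "u \<in> L1loc \<Omega>" if "u \<in> U" for u
    using that U(1) compactin_L1loc_subset[OF U(2)] by (auto simp: PSH_def)
  have "\<exists>c. \<forall>u\<in>U. \<forall>z\<in>{0::real}. (LINT x:L|lborel. \<bar>rval u x\<bar>) \<le> c"
  proof (rule compactin_uniform_constant[OF U(2)])
    fix u z assume u: "u \<in> U" and "z \<in> {0::real}"
    obtain V where V: "openin (L1loc_topology \<Omega>) V" "u \<in> V"
      "\<And>v. v \<in> V \<Longrightarrow> plurisubharmonic_on \<Omega> v \<Longrightarrow> (LINT x:L|lborel. \<bar>rval u x - rval v x\<bar>) < 1"
      using L1loc_neighbourhood[OF \<Omega> psh[OF u] L, of 1] by auto
    have "(LINT x:L|lborel. \<bar>rval v x\<bar>) \<le> 1 + (LINT x:L|lborel. \<bar>rval u x\<bar>)" if "v \<in> V \<inter> U" for v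
    proof -
      note Iu = psh_L1loc_integrable(2)[OF \<Omega> psh[OF u] L]
      have "v \<in> U" using that by simp
      note Iv = psh_L1loc_integrable(2)[OF \<Omega> psh[OF this] L]
      have "(LINT x:L|lborel. \<bar>rval v x\<bar>) \<le> (LINT x:L|lborel. \<bar>rval u x - rval v x\<bar> + \<bar>rval u x\<bar>)"
        by (intro set_integral_mono set_integrable_abs set_integral_add set_integral_diff Iu Iv) auto
      also have "\<dots> = (LINT x:L|lborel. \<bar>rval u x - rval v x\<bar>) + (LINT x:L|lborel. \<bar>rval u x\<bar>)"
        by (intro set_integral_add set_integrable_abs set_integral_diff Iu Iv)
      also have "\<dots> \<le> 1 + (LINT x:L|lborel. \<bar>rval u x\<bar>)"
        using V(3)[of v] psh(1)[OF \<open>v \<in> U\<close>] that by simp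
      finally show ?thesis .
    qed
    then show "\<exists>V \<tau> c. openin (L1loc_topology \<Omega>) V \<and> u \<in> V \<and> 0 < \<tau> \<and>
        (\<forall>v\<in>V \<inter> U. \<forall>w\<in>ball z \<tau> \<inter> {0}. (LINT x:L|lborel. \<bar>rval v x\<bar>) \<le> c)"
      using V(1,2)
      by (rule_tac x = V in exI, rule_tac x = 1 in exI, rule_tac x = "1 + (LINT x:L|lborel. \<bar>rval u x\<bar>)" in exI) auto
  qed auto
  then obtain c where "\<And>u. u \<in> U \<Longrightarrow> (LINT x:L|lborel. \<bar>rval u x\<bar>) \<le> c" by auto
  then show ?thesis using that[of "max 0 c"] by (meson max.cobounded1 max.coboundedI2)
qed

lemma set_integral_mono_superset:
  fixes f :: "'a \<Rightarrow> real"
  assumes L: "set_integrable M L f" and T: "T \<in> sets M" "T \<subseteq> L" and f: "AE x in M. x \<in> L \<longrightarrow> 0 \<le> f x"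
  shows "(LINT x:T|M. f x) \<le> (LINT x:L|M. f x)"
proof -
  have "(LINT x:T|M. f x) = (LINT x|M. indicator T x *\<^sub>R (indicator L x *\<^sub>R f x))"
    unfolding set_lebesgue_integral_def using T(2) by (intro Bochner_Integration.integral_cong) (auto simp: indicator_def)
  also have "\<dots> \<le> (LINT x:L|M. f x)"
    unfolding set_lebesgue_integral_def
  proof (rule integral_mono_AE)
    show "AE x in M. indicator T x *\<^sub>R (indicator L x *\<^sub>R f x) \<le> indicator L x *\<^sub>R f x"
      using f by eventually_elim (auto simp: indicator_def)
    show "integrable M (\<lambda>x. indicator L x *\<^sub>R f x)" using L by (simp add: set_integrable_def)
    then show "integrable M (\<lambda>x. indicator T x *\<^sub>R indicator L x *\<^sub>R f x)"
      by (rule integrable_mult_indicator[OF T(1)])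
  qed
  finally show ?thesis .
qed

text \<open>Hartogs' lemma in its simplest quantitative form: an \<open>L\<^sup>1\<close>-bound on \<open>u - v\<close> transfers
  upper bounds from \<open>v\<close> to \<open>u\<close> on slightly smaller sets, by the ball mean inequality.\<close>

lemma psh_upper_bound_transfer:
  fixes u v :: "complex ^ 'n \<Rightarrow> ereal"
  assumes \<Omega>: "open \<Omega>" and u: "plurisubharmonic_on \<Omega> u" "u \<in> L1loc \<Omega>" and v: "plurisubharmonic_on \<Omega> v" "v \<in> L1loc \<Omega>"
    and L: "compact L" "L \<subseteq> \<Omega>" and \<tau>: "0 < \<tau>" "cball x \<tau> \<subseteq> L"
    and b: "\<And>y. y \<in> cball x \<tau> \<Longrightarrow> v y \<le> ereal b"
    and \<kappa>: "(LINT x:L|lborel. \<bar>rval u x - rval v x\<bar>) \<le> \<kappa>"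
  shows "u x \<le> ereal (b + \<kappa> / measure lborel (cball x \<tau>))"
proof -
  have T: "compact (cball x \<tau>)" "cball x \<tau> \<subseteq> \<Omega>" using \<tau> L by auto
  note Iu = psh_L1loc_integrable[OF \<Omega> u T] and Iv = psh_L1loc_integrable[OF \<Omega> v T]
  have IL: "set_integrable lborel L (\<lambda>x. \<bar>rval u x - rval v x\<bar>)"
    by (intro set_integrable_abs set_integral_diff psh_L1loc_integrable(2)[OF \<Omega> _ _ L] u v)
  have I: "set_integrable lborel (cball x \<tau>) (\<lambda>x. \<bar>rval u x - rval v x\<bar>)"
    by (intro set_integrable_abs set_integral_diff Iu Iv)
  have Ib: "set_integrable lborel (cball x \<tau>) (\<lambda>_. b)"
    using emeasure_compact_finite[OF T(1)] by (auto simp: set_integrable_def)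
  have "(LINT y:cball x \<tau>|lborel. rval u y) \<le> (LINT y:cball x \<tau>|lborel. b + \<bar>rval u y - rval v y\<bar>)"
  proof (rule set_integral_mono_AE[OF Iu(2) set_integral_add(1)[OF Ib I]], use Iv(1) in eventually_elim)
    fix y assume "y \<in> cball x \<tau> \<longrightarrow> \<bar>v y\<bar> \<noteq> \<infinity>"
    then show "y \<in> cball x \<tau> \<longrightarrow> rval u y \<le> b + \<bar>rval u y - rval v y\<bar>"
      using b[of y] by (cases "v y") (auto simp: rval_def)
  qed
  also have "\<dots> = b * measure lborel (cball x \<tau>) + (LINT y:cball x \<tau>|lborel. \<bar>rval u y - rval v y\<bar>)"
    using set_integral_add(2)[OF Ib I] emeasure_compact_finite[OF T(1)]
    by (simp add: set_lebesgue_integral_def)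
  also have "(LINT y:cball x \<tau>|lborel. \<bar>rval u y - rval v y\<bar>) \<le> (LINT x:L|lborel. \<bar>rval u x - rval v x\<bar>)"
    by (rule set_integral_mono_superset[OF IL]) (use \<tau> in auto)
  finally have "(LINT y:cball x \<tau>|lborel. rval u y) \<le> b * measure lborel (cball x \<tau>) + \<kappa>"
    using \<kappa> by linarith
  then have "(LINT y:cball x \<tau>|lborel. rval u y) / measure lborel (cball x \<tau>) \<le> b + \<kappa> / measure lborel (cball x \<tau>)"
    using measure_cball_pos[OF \<tau>(1), of x] by (simp add: field_simps)
  then show ?thesis
    using psh_ball_submean[OF \<Omega> u \<tau>(1) T(2)] by (meson ereal_less_eq(3) order_trans)
qed

text \<open>A slope of \<open>u\<close> at \<open>z\<close> below \<open>\<nu>\<close> yields one for every \<open>v\<close> near \<open>u\<close> at every \<open>w\<close> near \<open>z\<close>: the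
  outer radius is decreased and the inner one increased by \<open>2 * \<tau>\<close>, to make room for the shift of the
  centre and for the mean inequality on balls of radius \<open>\<tau>\<close>. By convexity all slopes at smaller
  radii are then at most \<open>\<nu>\<close>. The bound \<open>s * c \<le> 1\<close> encodes that \<open>s\<close> is small in terms of \<open>c\<close>, so
  that one constant serves both purposes and enlarging it weakens the claim.\<close>

lemma ball_sup_uniform_lower_bound:
  fixes U :: "(complex ^ 'n \<Rightarrow> ereal) set"
  assumes \<Omega>: "open \<Omega>" and U: "U \<subseteq> PSH \<Omega>" "compactin (L1loc_topology \<Omega>) U" and K: "compact K" "K \<subseteq> \<Omega>"
    and \<nu>: "\<And>u z. u \<in> U \<Longrightarrow> z \<in> K \<Longrightarrow> lelong_number u z < ereal \<nu>"
  shows "\<exists>c. \<forall>u\<in>U. \<forall>z\<in>K. \<forall>s>0. s * c \<le> 1 \<longrightarrow> \<nu> * ln s - c \<le> ball_sup u z s"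
proof (rule compactin_uniform_constant[OF U(2) K(1)])
  have psh: "plurisubharmonic_on \<Omega> u" "u \<in> L1loc \<Omega>" if "u \<in> U" for u
    using that U(1) compactin_L1loc_subset[OF U(2)] by (auto simp: PSH_def)
  show "\<forall>s>0. s * d \<le> 1 \<longrightarrow> \<nu> * ln s - d \<le> ball_sup u z s"
    if "c \<le> d" "\<forall>s>0. s * c \<le> 1 \<longrightarrow> \<nu> * ln s - c \<le> ball_sup u z s" for c d u z
  proof (intro allI impI)
    fix s :: real assume s: "0 < s" "s * d \<le> 1"
    then have "s * c \<le> 1" using mult_left_mono[OF that(1), of s] by linarith
    then show "\<nu> * ln s - d \<le> ball_sup u z s" using that s(1) by force
  qed
  fix u z assume uU: "u \<in> U" and zK: "z \<in> K"
  note u = psh[OF uU]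
  obtain R where R: "0 < R" "cball z R \<subseteq> \<Omega>"
    using \<Omega> K(2) zK open_contains_cball by blast
  obtain l where l: "lelong_number u z = ereal l" "((\<lambda>r. slope u z r R) \<longlongrightarrow> l) (at_right 0)"
    using lelong_number_eq_lim_slope[OF \<Omega> u R] by metis
  have "l < \<nu>" using \<nu>[OF uU zK] l(1) by simp
  then have "eventually (\<lambda>r. slope u z r R < \<nu>) (at_right 0)"
    using l(2) by (rule order_tendstoD(2)[rotated])
  moreover have "eventually (\<lambda>r. 0 < r \<and> r < R) (at_right (0::real))"
    using R(1) eventually_at_right_real[of 0 R] by (auto elim: eventually_mono)
  ultimately have "eventually (\<lambda>r. slope u z r R < \<nu> \<and> 0 < r \<and> r < R) (at_right 0)"
    by eventually_elim auto
  then obtain r1 where r1: "slope u z r1 R < \<nu>" "0 < r1" "r1 < R"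
    using eventually_happens'[OF trivial_limit_at_right_real] by blast
  \<comment> \<open>An upper bound for the slope at the perturbed function, point and radii.\<close>
  define f where "f \<tau> = (ball_sup u z R - ball_sup u z r1 + 2 * \<tau>) / (ln (R - 2 * \<tau>) - ln (r1 + 2 * \<tau>))" for \<tau>
  have "(f \<longlongrightarrow> (ball_sup u z R - ball_sup u z r1 + 2 * 0) / (ln (R - 2 * 0) - ln (r1 + 2 * 0))) (at_right 0)"
    unfolding f_def using r1 by (intro tendsto_intros) auto
  then have "eventually (\<lambda>\<tau>. f \<tau> < \<nu>) (at_right 0)"
    using r1(1) by (intro order_tendstoD(2)) (auto simp: slope_def)
  moreover have "eventually (\<lambda>\<tau>. 0 < \<tau> \<and> \<tau> < (R - r1) / 8) (at_right (0::real))"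
    using r1 eventually_at_right_real[of 0 "(R - r1) / 8"] by (auto elim: eventually_mono)
  ultimately have "eventually (\<lambda>\<tau>. f \<tau> < \<nu> \<and> 0 < \<tau> \<and> \<tau> < (R - r1) / 8) (at_right 0)"
    by eventually_elim auto
  then obtain \<tau> where \<tau>: "f \<tau> < \<nu>" "0 < \<tau>" "\<tau> < (R - r1) / 8"
    using eventually_happens'[OF trivial_limit_at_right_real] by blast
  define r where "r = r1 + 2 * \<tau>"
  define \<delta> where "\<delta> = R - 2 * \<tau>"
  have r\<delta>: "0 < r" "r < \<delta>" "\<delta> < R" using \<tau> r1 by (auto simp: r_def \<delta>_def field_simps)
  \<comment> \<open>Chosen so that an \<open>L\<^sup>1\<close>-distance below \<open>\<kappa>\<close> changes ball suprema by at most \<open>\<tau>\<close>.\<close>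
  define \<kappa> where "\<kappa> = \<tau> * measure lborel (cball (0::complex^'n) \<tau>)"
  have vol: "\<kappa> / measure lborel (cball x \<tau>) = \<tau>" for x :: "complex^'n"
  proof -
    have "measure lborel (cball x \<tau>) = measure lborel (cball (0::complex^'n) \<tau>)"
      using \<tau>(2) by (simp add: content_cball)
    then show ?thesis
      unfolding \<kappa>_def using measure_cball_pos[OF \<tau>(2), of "0::complex^'n"] by (simp only: nonzero_mult_div_cancel_right)
  qed
  have \<kappa>: "0 < \<kappa>" using \<tau>(2) measure_cball_pos[OF \<tau>(2)] by (simp add: \<kappa>_def)
  obtain V where V: "openin (L1loc_topology \<Omega>) V" "u \<in> V"
    "\<And>v. v \<in> V \<Longrightarrow> plurisubharmonic_on \<Omega> v \<Longrightarrow> (LINT x:cball z R|lborel. \<bar>rval u x - rval v x\<bar>) < \<kappa>"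
    using L1loc_neighbourhood[OF \<Omega> u compact_cball R(2) \<kappa>] by metis
  define c where "c = max (1 / r) (\<bar>ball_sup u z r1 - \<tau> - \<nu> * ln r\<bar>)"
  have main: "\<nu> * ln s - c \<le> ball_sup v w s"
    if v: "v \<in> V \<inter> U" and w: "w \<in> ball z \<tau> \<inter> K" and s: "0 < s" "s * c \<le> 1" for v w s
  proof -
    have vp: "plurisubharmonic_on \<Omega> v" "v \<in> L1loc \<Omega>" using v psh[of v] by auto
    have dist: "(LINT x:cball z R|lborel. \<bar>rval u x - rval v x\<bar>) \<le> \<kappa>"
      "(LINT x:cball z R|lborel. \<bar>rval v x - rval u x\<bar>) \<le> \<kappa>"
      using V(3)[of v] v vp by (auto simp: abs_minus_commute less_imp_le)
    have dzw: "dist z w < \<tau>" using w by simp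
    have sub1: "cball x \<tau> \<subseteq> cball z R" if "x \<in> cball w \<delta>" for x
      using dzw that by (intro cball_subset_cball_iff[THEN iffD2] disjI1)
        (smt (verit, best) \<delta>_def dist_commute dist_triangle mem_cball)
    have sub1': "cball w \<delta> \<subseteq> cball z R"
      using sub1 \<tau>(2) by (meson centre_in_cball less_imp_le subset_iff)
    have sub2: "cball x \<tau> \<subseteq> cball w r" if "x \<in> cball z r1" for x
      using dzw that by (intro cball_subset_cball_iff[THEN iffD2] disjI1)
        (smt (verit, best) r_def dist_commute dist_triangle mem_cball)
    have wr: "cball w r \<subseteq> cball w \<delta>" using r\<delta> by (intro subset_cball) simp
    have w\<Omega>: "cball w \<delta> \<subseteq> \<Omega>" using sub1' R by blast
    have r\<Omega>: "cball w r \<subseteq> \<Omega>" using wr w\<Omega> by blast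
    have \<delta>0: "0 < \<delta>" using r\<delta> by simp
    have "ball_sup v w \<delta> \<le> ball_sup u z R + \<tau>"
    proof (rule ball_sup_le[OF \<Omega> vp \<delta>0 w\<Omega>])
      fix x assume x: "x \<in> cball w \<delta>"
      have "v x \<le> ereal (ball_sup u z R + \<kappa> / measure lborel (cball x \<tau>))"
        by (rule psh_upper_bound_transfer[OF \<Omega> vp u compact_cball R(2) \<tau>(2) sub1[OF x] _ dist(2)])
           (use sub1[OF x] ball_sup_upper[OF \<Omega> u R] in blast)
      then show "v x \<le> ereal (ball_sup u z R + \<tau>)" unfolding vol .
    qed
    moreover have low: "ball_sup u z r1 \<le> ball_sup v w r + \<tau>"
    proof (rule ball_sup_le[OF \<Omega> u r1(2)])
      show "cball z r1 \<subseteq> \<Omega>" using R(2) r1(3) subset_cball[of r1 R z] by auto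
      fix x assume x: "x \<in> cball z r1"
      have "u x \<le> ereal (ball_sup v w r + \<kappa> / measure lborel (cball x \<tau>))"
        by (rule psh_upper_bound_transfer[OF \<Omega> u vp compact_cball R(2) \<tau>(2) _ _ dist(1)])
           (use sub2[OF x] wr sub1' ball_sup_upper[OF \<Omega> vp r\<delta>(1) r\<Omega>] in blast)+
      then show "u x \<le> ereal (ball_sup v w r + \<tau>)" unfolding vol .
    qed
    ultimately have "ball_sup v w \<delta> - ball_sup v w r \<le> ball_sup u z R - ball_sup u z r1 + 2 * \<tau>"
      by simp
    then have "slope v w r \<delta> \<le> f \<tau>"
      unfolding slope_def f_def r_def[symmetric] \<delta>_def[symmetric] using r\<delta> by (intro divide_right_mono) auto
    then have sl: "slope v w r \<delta> \<le> \<nu>" using \<tau>(1) by simp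
    have "s * (1 / r) \<le> 1" using mult_left_mono[of "1 / r" c s] s by (simp add: c_def)
    then have sr: "s \<le> r" using r\<delta>(1) by (simp add: field_simps)
    have "ball_sup v w r - \<nu> * (ln r - ln s) \<le> ball_sup v w s"
    proof (cases "s = r")
      case False
      then have sr: "s < r" using sr by simp
      have "slope v w s r \<le> slope v w s \<delta>" by (rule slope_mono(1)[OF \<Omega> vp s(1) sr r\<delta>(2) w\<Omega>])
      also have "\<dots> \<le> slope v w r \<delta>" by (rule slope_mono(2)[OF \<Omega> vp s(1) sr r\<delta>(2) w\<Omega>])
      finally have "slope v w s r \<le> \<nu>" using sl by simp
      moreover have "0 < ln r - ln s" using s sr by simp
      ultimately show ?thesis unfolding slope_def by (simp add: pos_divide_le_eq)
    qed simp
    moreover have "ball_sup u z r1 - \<tau> - \<nu> * ln r \<ge> - c" unfolding c_def by linarith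
    ultimately show ?thesis using low by (simp add: algebra_simps)
  qed
  then show "\<exists>V \<tau> c. openin (L1loc_topology \<Omega>) V \<and> u \<in> V \<and> 0 < \<tau> \<and>
      (\<forall>v\<in>V \<inter> U. \<forall>w\<in>ball z \<tau> \<inter> K. \<forall>s>0. s * c \<le> 1 \<longrightarrow> \<nu> * ln s - c \<le> ball_sup v w s)"
    using V(1,2) \<tau>(2) by blast
qed

lemma psh_le_L1:
  fixes u :: "complex ^ 'n \<Rightarrow> ereal"
  assumes \<Omega>: "open \<Omega>" and u: "plurisubharmonic_on \<Omega> u" "u \<in> L1loc \<Omega>"
    and L: "compact L" "L \<subseteq> \<Omega>" and M: "(LINT x:L|lborel. \<bar>rval u x\<bar>) \<le> M" and r: "0 < r" "cball x r \<subseteq> L"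
  shows "u x \<le> ereal (M / measure lborel (cball x r))"
proof -
  have T: "cball x r \<subseteq> \<Omega>" using r L by auto
  note I = psh_L1loc_integrable(2)[OF \<Omega> u]
  have "(LINT y:cball x r|lborel. rval u y) \<le> (LINT y:cball x r|lborel. \<bar>rval u y\<bar>)"
    by (intro set_integral_mono set_integrable_abs I T) auto
  also have "\<dots> \<le> (LINT x:L|lborel. \<bar>rval u x\<bar>)"
    by (rule set_integral_mono_superset) (use r in \<open>auto intro!: set_integrable_abs I L\<close>)
  finally have "(LINT y:cball x r|lborel. rval u y) / measure lborel (cball x r) \<le> M / measure lborel (cball x r)"
    using M by (intro divide_right_mono) auto
  then show ?thesis
    using psh_ball_submean[OF \<Omega> u r(1) T] by (meson ereal_less_eq(3) order_trans)
qed

lemma ball_sup_ge_L1: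
  fixes u :: "complex ^ 'n \<Rightarrow> ereal"
  assumes \<Omega>: "open \<Omega>" and u: "plurisubharmonic_on \<Omega> u" "u \<in> L1loc \<Omega>"
    and L: "compact L" "L \<subseteq> \<Omega>" and M: "(LINT x:L|lborel. \<bar>rval u x\<bar>) \<le> M" and r: "0 < r" "cball x r \<subseteq> L"
  shows "- (M / measure lborel (cball x r)) \<le> ball_sup u x r"
proof -
  have T: "cball x r \<subseteq> \<Omega>" using r L by auto
  note I = psh_L1loc_integrable[OF \<Omega> u]
  have "(LINT y:cball x r|lborel. - \<bar>rval u y\<bar>) \<le> (LINT y:cball x r|lborel. ball_sup u x r)"
  proof (rule set_integral_mono_AE)
    show "set_integrable lborel (cball x r) (\<lambda>y. - \<bar>rval u y\<bar>)"
      using set_integrable_abs[OF I(2)[OF compact_cball T]] by (simp add: set_integrable_def)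
    show "set_integrable lborel (cball x r) (\<lambda>y. ball_sup u x r)"
      using emeasure_compact_finite[OF compact_cball, of x r] by (auto simp: set_integrable_def)
    show "AE y\<in>cball x r in lborel. - \<bar>rval u y\<bar> \<le> ball_sup u x r"
      using I(1)[OF compact_cball T]
    proof eventually_elim
      fix y assume "y \<in> cball x r \<longrightarrow> \<bar>u y\<bar> \<noteq> \<infinity>"
      then show "y \<in> cball x r \<longrightarrow> - \<bar>rval u y\<bar> \<le> ball_sup u x r"
        using ball_sup_upper[OF \<Omega> u r(1) T, of y] by (cases "u y") (auto simp: rval_def)
    qed
  qed
  also have "\<dots> = ball_sup u x r * measure lborel (cball x r)"
    by (simp add: set_lebesgue_integral_def)
  also have "(LINT y:cball x r|lborel. - \<bar>rval u y\<bar>) = - (LINT y:cball x r|lborel. \<bar>rval u y\<bar>)"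
    by (simp add: set_lebesgue_integral_def)
  finally have "- (LINT y:cball x r|lborel. \<bar>rval u y\<bar>) \<le> ball_sup u x r * measure lborel (cball x r)" .
  moreover have "(LINT y:cball x r|lborel. \<bar>rval u y\<bar>) \<le> (LINT x:L|lborel. \<bar>rval u x\<bar>)"
    by (rule set_integral_mono_superset) (use r in \<open>auto intro!: set_integrable_abs I L\<close>)
  ultimately have "- M \<le> ball_sup u x r * measure lborel (cball x r)" using M by linarith
  then show ?thesis using measure_cball_pos[OF r(1), of x] by (simp add: field_simps)
qed

lemma slope_le_L1:
  fixes u :: "complex ^ 'n \<Rightarrow> ereal"
  assumes \<Omega>: "open \<Omega>" and u: "plurisubharmonic_on \<Omega> u" "u \<in> L1loc \<Omega>"
    and L: "compact L" "L \<subseteq> \<Omega>" and M: "(LINT x:L|lborel. \<bar>rval u x\<bar>) \<le> M" and r: "0 < r" "cball z (3 * r) \<subseteq> L"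
  shows "slope u z r (2 * r) \<le> 2 * M / measure lborel (cball (0::complex^'n) r) / ln 2"
proof -
  have vol: "measure lborel (cball x r) = measure lborel (cball (0::complex^'n) r)" for x :: "complex^'n"
    using r by (simp add: content_cball)
  have sub: "cball z r \<subseteq> L" "cball z (2 * r) \<subseteq> L" using r subset_cball[of _ "3 * r" z] by force+
  have r2: "0 < 2 * r" using r by simp
  have "ball_sup u z (2 * r) \<le> M / measure lborel (cball (0::complex^'n) r)"
  proof (rule ball_sup_le[OF \<Omega> u r2])
    show "cball z (2 * r) \<subseteq> \<Omega>" using sub L by blast
    fix x assume x: "x \<in> cball z (2 * r)"
    have "cball x r \<subseteq> cball z (3 * r)"
      using x by (intro cball_subset_cball_iff[THEN iffD2] disjI1) (simp add: dist_commute)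
    from psh_le_L1[OF \<Omega> u L M r(1) order_trans[OF this r(2)]]
    show "u x \<le> ereal (M / measure lborel (cball (0::complex^'n) r))"
      by (simp only: vol[of x])
  qed
  moreover have "- (M / measure lborel (cball (0::complex^'n) r)) \<le> ball_sup u z r"
    using ball_sup_ge_L1[OF \<Omega> u L M r(1) sub(1)] unfolding vol[of z] .
  ultimately have "ball_sup u z (2 * r) - ball_sup u z r \<le> 2 * M / measure lborel (cball (0::complex^'n) r)"
    by simp
  moreover have "ln (2 * r) - ln r = ln 2" using r by (simp add: ln_mult)
  moreover have "0 \<le> ln (2::real)" by simp
  ultimately show ?thesis unfolding slope_def by (simp only: divide_right_mono)
qed

text \<open>On a ball of radius \<open>2\<rho>\<close> the mean of \<open>u\<close> stays within a bounded distance of its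
  supremum as soon as the supremum does not drop much from radius \<open>4\<rho>\<close> to radius \<open>\<rho>\<close>: apply the
  mean inequality at a point where \<open>u\<close> almost attains its supremum over the small ball.\<close>

lemma psh_mean_oscillation:
  fixes u :: "complex ^ 'n \<Rightarrow> ereal"
  assumes \<Omega>: "open \<Omega>" and u: "plurisubharmonic_on \<Omega> u" "u \<in> L1loc \<Omega>" and \<rho>: "0 < \<rho>" "cball z (4 * \<rho>) \<subseteq> \<Omega>"
  shows "(LINT x:cball z (2 * \<rho>)|lborel. ball_sup u z (4 * \<rho>) - rval u x)
      \<le> measure lborel (cball (0::complex^'n) (3 * \<rho>)) * (ball_sup u z (4 * \<rho>) - ball_sup u z \<rho> + 1)"
proof -
  define p where "p = ball_sup u z (4 * \<rho>)"
  have sub: "cball z \<rho> \<subseteq> \<Omega>" using \<rho> subset_cball[of \<rho> "4 * \<rho>" z] by auto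
  have "ereal (ball_sup u z \<rho> - 1) < (SUP x\<in>cball z \<rho>. u x)"
    unfolding ball_sup_eq[OF \<Omega> u \<rho>(1) sub] by simp
  then obtain w where w: "w \<in> cball z \<rho>" "ereal (ball_sup u z \<rho> - 1) < u w"
    by (auto simp: less_SUP_iff)
  have sub3: "cball w (3 * \<rho>) \<subseteq> cball z (4 * \<rho>)"
    using w by (intro cball_subset_cball_iff[THEN iffD2] disjI1) (simp add: dist_commute)
  have sub2: "cball z (2 * \<rho>) \<subseteq> cball w (3 * \<rho>)"
    using w by (intro cball_subset_cball_iff[THEN iffD2] disjI1) simp
  have T: "cball w (3 * \<rho>) \<subseteq> \<Omega>" using sub3 \<rho> by blast
  have r3: "0 < 3 * \<rho>" "0 < 4 * \<rho>" using \<rho> by auto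
  have up: "u x \<le> ereal p" if "x \<in> cball w (3 * \<rho>)" for x
    unfolding p_def using that sub3 by (intro ball_sup_upper[OF \<Omega> u r3(2) \<rho>(2)]) blast
  note D = nn_integral_deficit[OF \<Omega> u compact_cball T up]
  have vol: "measure lborel (cball w (3 * \<rho>)) = measure lborel (cball (0::complex^'n) (3 * \<rho>))"
    using \<rho> by (simp add: content_cball)
  have "ereal (ball_sup u z \<rho> - 1) \<le> ereal ((LINT y:cball w (3 * \<rho>)|lborel. rval u y) / measure lborel (cball w (3 * \<rho>)))"
    using psh_ball_submean[OF \<Omega> u r3(1) T] w(2) by order
  then have le: "(ball_sup u z \<rho> - 1) * measure lborel (cball w (3 * \<rho>)) \<le> (LINT y:cball w (3 * \<rho>)|lborel. rval u y)"
    using measure_cball_pos[OF r3(1), of w] by (simp add: pos_le_divide_eq)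
  have "(LINT x:cball z (2 * \<rho>)|lborel. p - rval u x) \<le> (LINT x:cball w (3 * \<rho>)|lborel. p - rval u x)"
    by (rule set_integral_mono_superset[OF D(3)]) (use sub2 D(2) in auto)
  also have "\<dots> = p * measure lborel (cball w (3 * \<rho>)) - (LINT y:cball w (3 * \<rho>)|lborel. rval u y)"
    using psh_L1loc_integrable(2)[OF \<Omega> u compact_cball T]
      emeasure_compact_finite[OF compact_cball, of w "3 * \<rho>"]
    by (subst set_integral_diff) (auto simp: set_integrable_def set_lebesgue_integral_def)
  also have "\<dots> \<le> measure lborel (cball w (3 * \<rho>)) * (p - ball_sup u z \<rho> + 1)"
    using le by (simp add: algebra_simps)
  finally show ?thesis unfolding p_def vol .
qed

section \<open>Positivity of the Laplacian against caps\<close>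

definition cap :: "real \<Rightarrow> complex ^ 'n \<Rightarrow> complex ^ 'n \<Rightarrow> real" where
  "cap \<tau> z x = max 0 (\<tau> - (norm (x - z))\<^sup>2)"

lemma cap_nonneg [simp]: "0 \<le> cap \<tau> z x"
  and cap_le: "0 \<le> \<tau> \<Longrightarrow> cap \<tau> z x \<le> \<tau>"
  by (auto simp: cap_def)

lemma continuous_on_cap [continuous_intros]:
  "continuous_on S f \<Longrightarrow> continuous_on S (\<lambda>x. cap \<tau> z (f x))"
  unfolding cap_def by (intro continuous_intros)

lemma borel_measurable_cap [measurable]: "cap \<tau> z \<in> borel_measurable borel"
  by (intro borel_measurable_continuous_onI continuous_intros)

lemma cube_pos_part_taylor:
  fixes q h :: real
  shows "\<bar>(max 0 (q + h)) ^ 3 - (max 0 q) ^ 3 - 3 * (max 0 q)\<^sup>2 * h - 3 * max 0 q * h\<^sup>2\<bar> \<le> \<bar>h\<bar> ^ 3"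
proof -
  consider "0 \<le> q" "0 \<le> q + h" | "0 \<le> q" "q + h < 0" | "q < 0" "0 \<le> q + h" | "q < 0" "q + h < 0"
    by linarith
  then show ?thesis
  proof cases
    case 1
    then have "(max 0 (q + h)) ^ 3 - (max 0 q) ^ 3 - 3 * (max 0 q)\<^sup>2 * h - 3 * max 0 q * h\<^sup>2 = h ^ 3"
      by (simp add: power2_eq_square power3_eq_cube algebra_simps)
    then show ?thesis by (simp add: power_abs)
  next
    case 2
    have eq: "(max 0 (q + h)) ^ 3 - (max 0 q) ^ 3 - 3 * (max 0 q)\<^sup>2 * h - 3 * max 0 q * h\<^sup>2 = (- h) ^ 3 * - 1 + (- (q + h)) ^ 3"
      using 2 by (simp add: power2_eq_square power3_eq_cube algebra_simps)
    have "0 \<le> (- (q + h)) ^ 3" using 2 by simp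
    moreover have "(- (q + h)) ^ 3 \<le> (- h) ^ 3" using 2 by (intro power_mono) auto
    moreover have "\<bar>h\<bar> ^ 3 = (- h) ^ 3" using 2 by simp
    ultimately show ?thesis unfolding eq by linarith
  next
    case 3
    then have "(q + h) ^ 3 \<le> h ^ 3" "0 \<le> h" "0 \<le> (q + h) ^ 3" by (auto intro: power_mono)
    then show ?thesis using 3 by simp
  qed (auto simp: max_def)
qed

lemma norm_minus_axis_squared:
  fixes x :: "complex ^ 'n"
  shows "(norm (x - c *s axis k 1))\<^sup>2 = (norm x)\<^sup>2 - 2 * Re (c * cnj (x $ k)) + (cmod c)\<^sup>2"
proof -
  have n2: "(norm v)\<^sup>2 = (\<Sum>i\<in>UNIV. (cmod (v $ i))\<^sup>2)" for v :: "complex ^ 'n"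
    by (simp add: norm_vec_def L2_set_def sum_nonneg)
  have "(cmod ((x - c *s axis k 1) $ i))\<^sup>2 = (cmod (x $ i))\<^sup>2 + (if i = k then - 2 * Re (c * cnj (x $ k)) + (cmod c)\<^sup>2 else 0)" for i
  proof (cases "i = k")
    case True
    have "(cmod (x $ k - c))\<^sup>2 = (cmod (x $ k))\<^sup>2 + (- 2 * Re (c * cnj (x $ k)) + (cmod c)\<^sup>2)"
      unfolding cmod_power2 by (simp add: power2_eq_square algebra_simps)
    then show ?thesis using True by (simp add: axis_def)
  qed (simp add: axis_def)
  then show ?thesis unfolding n2[of "x - c *s axis k 1"] by (simp add: sum.distrib n2)
qed

lemma trig_integral:
  fixes A B C D :: real
  shows "set_integrable lborel {0..2*pi} (\<lambda>\<theta>. A + B * cos \<theta> + C * sin \<theta> + D * (B * cos \<theta> + C * sin \<theta>)\<^sup>2)"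
    and "(LINT \<theta>:{0..2*pi}|lborel. A + B * cos \<theta> + C * sin \<theta> + D * (B * cos \<theta> + C * sin \<theta>)\<^sup>2)
        = 2 * pi * (A + D * (B\<^sup>2 + C\<^sup>2) / 2)"
proof -
  define h where "h \<theta> = A + B * cos \<theta> + C * sin \<theta> + D * (B * cos \<theta> + C * sin \<theta>)\<^sup>2" for \<theta>
  define H where "H \<theta> = A * \<theta> + B * sin \<theta> - C * cos \<theta> + D * (B\<^sup>2 * (\<theta> + sin \<theta> * cos \<theta>) / 2
      + B * C * (sin \<theta>)\<^sup>2 + C\<^sup>2 * (\<theta> - sin \<theta> * cos \<theta>) / 2)" for \<theta>
  have D: "(H has_real_derivative h \<theta>) (at \<theta>)" for \<theta>
  proof -
    have "(H has_real_derivative (A + B * cos \<theta> + C * sin \<theta> + D * (B\<^sup>2 * (1 + (cos \<theta> * cos \<theta> - sin \<theta> * sin \<theta>)) / 2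
      + B * C * (2 * sin \<theta> * cos \<theta>) + C\<^sup>2 * (1 - (cos \<theta> * cos \<theta> - sin \<theta> * sin \<theta>)) / 2))) (at \<theta>)"
      unfolding H_def by (auto intro!: derivative_eq_intros)
    moreover have "B\<^sup>2 * (1 + (cos \<theta> * cos \<theta> - sin \<theta> * sin \<theta>)) / 2
      + B * C * (2 * sin \<theta> * cos \<theta>) + C\<^sup>2 * (1 - (cos \<theta> * cos \<theta> - sin \<theta> * sin \<theta>)) / 2 = (B * cos \<theta> + C * sin \<theta>)\<^sup>2"
    proof -
      have sc: "sin \<theta> * sin \<theta> = 1 - cos \<theta> * cos \<theta>"
        using sin_cos_squared_add[of \<theta>] by (simp add: power2_eq_square algebra_simps)
      have "B\<^sup>2 * (1 + (cos \<theta> * cos \<theta> - sin \<theta> * sin \<theta>))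
        + 2 * (B * C * (2 * sin \<theta> * cos \<theta>)) + C\<^sup>2 * (1 - (cos \<theta> * cos \<theta> - sin \<theta> * sin \<theta>)) = 2 * (B * cos \<theta> + C * sin \<theta>)\<^sup>2"
        using sc by algebra
      then show ?thesis by simp
    qed
    ultimately show ?thesis unfolding h_def by simp
  qed
  have C: "isCont h \<theta>" for \<theta> unfolding h_def by (intro continuous_intros)
  have int: "integrable lborel (\<lambda>\<theta>. h \<theta> * indicator {0..2*pi} \<theta>)"
    "(LINT \<theta>|lborel. h \<theta> * indicator {0..2*pi} \<theta>) = H (2*pi) - H 0"
    using has_bochner_integral_FTC_Icc_real[of 0 "2*pi" H h] D C
    by (auto simp: has_bochner_integral_iff)
  have "H (2*pi) - H 0 = 2 * pi * (A + D * (B\<^sup>2 + C\<^sup>2) / 2)" unfolding H_def by (simp add: field_simps)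
  then show "set_integrable lborel {0..2*pi} (\<lambda>\<theta>. A + B * cos \<theta> + C * sin \<theta> + D * (B * cos \<theta> + C * sin \<theta>)\<^sup>2)"
    "(LINT \<theta>:{0..2*pi}|lborel. A + B * cos \<theta> + C * sin \<theta> + D * (B * cos \<theta> + C * sin \<theta>)\<^sup>2)
        = 2 * pi * (A + D * (B\<^sup>2 + C\<^sup>2) / 2)"
    using int unfolding set_integrable_def set_lebesgue_integral_def h_def[symmetric] by (simp_all add: mult.commute)
qed

text \<open>A quarter of the Laplacian, in the \<open>k\<close>-th complex coordinate, of the cube of the cap.\<close>

definition cap_lap :: "'n \<Rightarrow> real \<Rightarrow> complex ^ 'n \<Rightarrow> complex ^ 'n \<Rightarrow> real" where
  "cap_lap k \<tau> z x = 6 * cap \<tau> z x * (cmod ((x - z) $ k))\<^sup>2 - 3 * (cap \<tau> z x)\<^sup>2"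

text \<open>The integral, over a circle of radius \<open>s\<close> about \<open>y\<close> in the \<open>k\<close>-th coordinate, of the cubed cap.
  The cube is used because it is twice differentiable with Lipschitz second derivatives, which makes
  the expansion in \<open>s\<close> below uniform.\<close>

definition cap_circle :: "'n \<Rightarrow> real \<Rightarrow> real \<Rightarrow> complex ^ 'n \<Rightarrow> complex ^ 'n \<Rightarrow> real" where
  "cap_circle k s \<tau> z y = (LINT \<theta>:{0..2*pi}|lborel. cap \<tau> z (y - (of_real s * cis \<theta>) *s axis k 1) ^ 3)"

text \<open>Taylor expansion with remainder of third order along the circle: the linear terms in
  \<open>cos \<theta>\<close> and \<open>sin \<theta>\<close> integrate to zero, and the quadratic ones give the Laplacian.\<close>

lemma cap_circle_expansion:
  fixes y z :: "complex ^ 'n"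
  assumes \<tau>: "0 \<le> \<tau>" and D: "norm (y - z) \<le> D" and s: "0 < s" "s \<le> 1"
  shows "\<bar>cap_circle k s \<tau> z y - 2 * pi * (cap \<tau> z y ^ 3 + s\<^sup>2 * cap_lap k \<tau> z y)\<bar>
      \<le> 2 * pi * (s ^ 3 * (3 * \<tau> * (4 * D + 1) + (2 * D + 1) ^ 3))"
proof -
  define Q where "Q = cap \<tau> z y"
  define x where "x = y - z"
  define q where "q = \<tau> - (norm x)\<^sup>2"
  define a where "a = Re (x $ k)"
  define b where "b = Im (x $ k)"
  define w where "w \<theta> = a * cos \<theta> + b * sin \<theta>" for \<theta>
  define h where "h \<theta> = 2 * s * w \<theta> - s\<^sup>2" for \<theta>
  define P where "P \<theta> = (cap \<tau> z (y - (of_real s * cis \<theta>) *s axis k 1)) ^ 3" for \<theta>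
  define E where "E = 3 * \<tau> * (4 * D + 1) + (2 * D + 1) ^ 3"
  define T where "T \<theta> = (Q ^ 3 - 3 * Q\<^sup>2 * s\<^sup>2) + (6 * Q\<^sup>2 * s * a) * cos \<theta> + (6 * Q\<^sup>2 * s * b) * sin \<theta>
      + 12 * Q * s\<^sup>2 * (w \<theta>)\<^sup>2" for \<theta>
  have Q: "Q = max 0 q" "0 \<le> Q" "Q \<le> \<tau>" using \<tau> by (auto simp: Q_def q_def x_def cap_def)
  have P: "P \<theta> = (max 0 (q + h \<theta>)) ^ 3" for \<theta>
  proof -
    have "y - (of_real s * cis \<theta>) *s axis k 1 - z = x - (of_real s * cis \<theta>) *s axis k 1" by (simp add: x_def)
    moreover have "Re (of_real s * cis \<theta> * cnj (x $ k)) = s * w \<theta>" by (simp add: w_def a_def b_def algebra_simps)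
    moreover have "cmod (of_real s * cis \<theta>) = s" using s by (simp add: norm_mult)
    ultimately show ?thesis
      unfolding P_def cap_def norm_minus_axis_squared by (simp add: q_def h_def norm_minus_axis_squared algebra_simps)
  qed
  have D0: "0 \<le> D" using D norm_ge_zero order_trans by blast
  have wD: "\<bar>w \<theta>\<bar> \<le> D" for \<theta>
  proof -
    have "w \<theta> = Re (cis \<theta> * cnj (x $ k))" by (simp add: w_def a_def b_def algebra_simps)
    then have "\<bar>w \<theta>\<bar> \<le> cmod (cis \<theta> * cnj (x $ k))" using abs_Re_le_cmod by metis
    also have "\<dots> = cmod (x $ k)" by (simp add: norm_mult)
    also have "\<dots> \<le> norm x" by (rule Finite_Cartesian_Product.norm_nth_le)
    finally show ?thesis using D by (simp add: x_def)
  qed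
  have s3: "s ^ 4 \<le> s ^ 3" "s\<^sup>2 \<le> s" using s by (auto simp: power_decreasing power2_eq_square mult_left_le)
  have PT: "\<bar>P \<theta> - T \<theta>\<bar> \<le> s ^ 3 * E" for \<theta>
  proof -
    have "\<bar>h \<theta>\<bar> \<le> 2 * s * \<bar>w \<theta>\<bar> + s\<^sup>2"
      unfolding h_def using s by (intro abs_triangle_ineq4[THEN order_trans]) (simp add: abs_mult)
    also have "\<dots> \<le> 2 * s * D + s" using wD[of \<theta>] s s3 by (intro add_mono mult_left_mono) auto
    finally have "\<bar>h \<theta>\<bar> \<le> s * (2 * D + 1)" by (simp add: algebra_simps)
    then have h3: "\<bar>h \<theta>\<bar> ^ 3 \<le> s ^ 3 * (2 * D + 1) ^ 3"
      using power_mono[of "\<bar>h \<theta>\<bar>" "s * (2 * D + 1)" 3] by (simp add: power_mult_distrib)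
    have "P \<theta> - T \<theta> = (P \<theta> - Q ^ 3 - 3 * Q\<^sup>2 * h \<theta> - 3 * Q * (h \<theta>)\<^sup>2) + 3 * Q * (s ^ 4 - 4 * s ^ 3 * w \<theta>)"
      unfolding T_def h_def by (simp add: w_def power2_eq_square power3_eq_cube power4_eq_xxxx algebra_simps)
    moreover have "\<bar>P \<theta> - Q ^ 3 - 3 * Q\<^sup>2 * h \<theta> - 3 * Q * (h \<theta>)\<^sup>2\<bar> \<le> \<bar>h \<theta>\<bar> ^ 3"
      unfolding P Q(1) by (rule cube_pos_part_taylor)
    moreover have "\<bar>3 * Q * (s ^ 4 - 4 * s ^ 3 * w \<theta>)\<bar> \<le> s ^ 3 * (3 * \<tau> * (4 * D + 1))"
    proof -
      define e where "e = s ^ 4 - 4 * s ^ 3 * w \<theta>"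
      have "\<bar>e\<bar> \<le> s ^ 4 + 4 * s ^ 3 * \<bar>w \<theta>\<bar>"
        unfolding e_def using s by (intro abs_triangle_ineq4[THEN order_trans]) (simp add: abs_mult)
      also have "\<dots> \<le> s ^ 3 + 4 * s ^ 3 * D" using wD[of \<theta>] s s3 by (intro add_mono mult_left_mono) auto
      finally have "\<bar>e\<bar> \<le> s ^ 3 * (4 * D + 1)" by (simp add: algebra_simps)
      then have "Q * \<bar>e\<bar> \<le> \<tau> * (s ^ 3 * (4 * D + 1))"
        using Q \<tau> by (intro mult_mono) auto
      moreover have "\<bar>3 * Q * e\<bar> = 3 * (Q * \<bar>e\<bar>)" using Q(2) by (simp add: abs_mult)
      moreover have "s ^ 3 * (3 * \<tau> * (4 * D + 1)) = 3 * (\<tau> * (s ^ 3 * (4 * D + 1)))" by algebra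
      ultimately show ?thesis unfolding e_def[symmetric] by linarith
    qed
    ultimately show ?thesis unfolding E_def using h3 by (simp add: distrib_left)
  qed
  have Tw: "T \<theta> = (Q ^ 3 - 3 * Q\<^sup>2 * s\<^sup>2) + (6 * Q\<^sup>2 * s) * (a * cos \<theta> + b * sin \<theta>) + 12 * Q * s\<^sup>2 * (a * cos \<theta> + b * sin \<theta>)\<^sup>2" for \<theta>
    by (simp add: T_def w_def algebra_simps)
  have Tint: "set_integrable lborel {0..2*pi} T"
    and Tval: "(LINT \<theta>:{0..2*pi}|lborel. T \<theta>) = 2 * pi * (Q ^ 3 + s\<^sup>2 * cap_lap k \<tau> z y)"
  proof -
    define T1 where "T1 \<theta> = (Q ^ 3 - 3 * Q\<^sup>2 * s\<^sup>2) + a * cos \<theta> + b * sin \<theta> + 12 * Q * s\<^sup>2 * (a * cos \<theta> + b * sin \<theta>)\<^sup>2" for \<theta>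
    define T2 where "T2 \<theta> = 0 + a * cos \<theta> + b * sin \<theta> + 0 * (a * cos \<theta> + b * sin \<theta>)\<^sup>2" for \<theta>
    note t1 = trig_integral[of "Q ^ 3 - 3 * Q\<^sup>2 * s\<^sup>2" a b "12 * Q * s\<^sup>2", folded T1_def]
    note t2 = trig_integral[of 0 a b 0, folded T2_def]
    have eq: "T = (\<lambda>\<theta>. T1 \<theta> + (6 * Q\<^sup>2 * s - 1) * T2 \<theta>)"
      by (auto simp: fun_eq_iff Tw T1_def T2_def algebra_simps)
    have i2: "set_integrable lborel {0..2*pi} (\<lambda>\<theta>. (6 * Q\<^sup>2 * s - 1) * T2 \<theta>)"
      using t2(1) by (intro set_integrable_mult_right)
    show "set_integrable lborel {0..2*pi} T"
      unfolding eq by (rule set_integral_add(1)[OF t1(1) i2])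
    have ab: "a\<^sup>2 + b\<^sup>2 = (cmod ((y - z) $ k))\<^sup>2" by (simp add: a_def b_def x_def cmod_power2)
    show "(LINT \<theta>:{0..2*pi}|lborel. T \<theta>) = 2 * pi * (Q ^ 3 + s\<^sup>2 * cap_lap k \<tau> z y)"
    proof -
      have "(LINT \<theta>:{0..2*pi}|lborel. (6 * Q\<^sup>2 * s - 1) * T2 \<theta>) = 0"
        using t2(2) by (subst set_integral_mult_right) simp
      then have "(LINT \<theta>:{0..2*pi}|lborel. T \<theta>) = 2 * pi * (Q ^ 3 - 3 * Q\<^sup>2 * s\<^sup>2 + 12 * Q * s\<^sup>2 * (a\<^sup>2 + b\<^sup>2) / 2)"
        unfolding eq using set_integral_add(2)[OF t1(1) i2] t1(2) by simp
      also have "\<dots> = 2 * pi * (Q ^ 3 + s\<^sup>2 * cap_lap k \<tau> z y)"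
        unfolding ab cap_lap_def Q_def[symmetric] by (simp add: algebra_simps)
      finally show ?thesis .
    qed
  qed
  have Pint: "set_integrable lborel {0..2*pi} P"
    unfolding P_def set_integrable_def
    by (rule borel_integrable_compact) (auto intro!: continuous_intros)
  have "\<bar>(LINT \<theta>:{0..2*pi}|lborel. P \<theta>) - (LINT \<theta>:{0..2*pi}|lborel. T \<theta>)\<bar> = \<bar>LINT \<theta>:{0..2*pi}|lborel. P \<theta> - T \<theta>\<bar>"
    using set_integral_diff(2)[OF Pint Tint] by simp
  also have "\<dots> \<le> (LINT \<theta>:{0..2*pi}|lborel. \<bar>P \<theta> - T \<theta>\<bar>)"
    using set_integral_norm_bound[OF set_integral_diff(1)[OF Pint Tint]] by simp
  also have "\<dots> \<le> (LINT \<theta>:{0..2*pi}|lborel. s ^ 3 * E)"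
    by (intro set_integral_mono set_integrable_abs set_integral_diff Pint Tint PT) (simp add: set_integrable_def)
  also have "\<dots> = 2 * pi * (s ^ 3 * E)" by (simp add: set_lebesgue_integral_def)
  finally show ?thesis unfolding Tval cap_circle_def P_def E_def Q_def .
qed


lemma integrable_mult_bounded:
  fixes f g :: "'a \<Rightarrow> real"
  assumes f: "integrable M f" and [measurable]: "g \<in> borel_measurable M" and C: "\<And>x. f x \<noteq> 0 \<Longrightarrow> \<bar>g x\<bar> \<le> C"
  shows "integrable M (\<lambda>x. f x * g x)"
proof (rule Bochner_Integration.integrable_bound[OF integrable_mult_left[OF f, of C]])
  show "(\<lambda>x. f x * g x) \<in> borel_measurable M" using f by measurable
  have "norm (f x * g x) \<le> norm (f x * C)" for x
  proof (cases "f x = 0")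
    case False
    then have "\<bar>g x\<bar> \<le> \<bar>C\<bar>" using C by (meson abs_ge_self order_trans)
    then show ?thesis by (simp add: abs_mult mult_left_mono)
  qed simp
  then show "AE x in M. norm (f x * g x) \<le> norm (f x * C)" by simp
qed

lemma enn2real_integrable:
  assumes F[measurable]: "F \<in> borel_measurable M" and fin: "(\<integral>\<^sup>+x. F x \<partial>M) < \<infinity>"
  shows "AE x in M. F x = ennreal (enn2real (F x))"
    and "integrable M (\<lambda>x. enn2real (F x))"
proof -
  have "AE x in M. F x \<noteq> \<infinity>" using fin by (intro nn_integral_PInf_AE) auto
  then show A: "AE x in M. F x = ennreal (enn2real (F x))" by eventually_elim (simp add: less_top)
  have "(\<integral>\<^sup>+x. ennreal (enn2real (F x)) \<partial>M) = (\<integral>\<^sup>+x. F x \<partial>M)"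
    by (intro nn_integral_cong_AE) (use A in auto)
  then show "integrable M (\<lambda>x. enn2real (F x))" using fin by (intro integrableI_nonneg) auto
qed

text \<open>Testing the circle inequality for discs in the direction of the \<open>k\<close>-th axis against a
  nonnegative function, with Tonelli's theorem and translation invariance.\<close>

lemma circle_super_test:
  fixes F :: "complex ^ 'n \<Rightarrow> ennreal" and \<phi> :: "complex ^ 'n \<Rightarrow> real" and k :: 'n
  assumes F[measurable]: "F \<in> borel_measurable borel" and fin: "(\<integral>\<^sup>+x. F x \<partial>lborel) < \<infinity>"
    and sup: "circle_super F L" and s: "0 < s"
    and \<phi>: "continuous_on UNIV \<phi>" "\<And>x. 0 \<le> \<phi> x" "\<And>x. \<phi> x \<le> C"
    and supp: "\<And>x. \<phi> x \<noteq> 0 \<Longrightarrow> cball x s \<subseteq> L"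
  defines "M \<equiv> \<lambda>y. LINT \<theta>:{0..2*pi}|lborel. \<phi> (y - (of_real s * cis \<theta>) *s axis k 1)"
  shows "integrable lborel (\<lambda>x. enn2real (F x) * (2 * pi * \<phi> x - M x))"
    and "0 \<le> (LINT x|lborel. enn2real (F x) * (2 * pi * \<phi> x - M x))"
proof -
  define w where "w \<theta> = (of_real s * cis \<theta>) *s axis k 1" for \<theta> :: real
  define f where "f x = enn2real (F x)" for x
  have cw: "continuous_on UNIV w" unfolding w_def by (intro continuous_intros)
  have [measurable]: "\<phi> \<in> borel_measurable borel" "w \<in> borel_measurable borel"
    using \<phi>(1) cw by (auto intro: borel_measurable_continuous_onI)
  have [measurable]: "f \<in> borel_measurable borel" unfolding f_def by measurable
  have AEF: "AE x in lborel. F x = ennreal (f x)" and fint: "integrable lborel f"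
    unfolding f_def using F fin by (auto intro: enn2real_integrable)
  have f0: "0 \<le> f x" for x by (simp add: f_def)
  have C0: "0 \<le> C" using \<phi>(2,3) order_trans by blast
  have M: "M y = (LINT \<theta>|lborel. indicator {0..2*pi} \<theta> *\<^sub>R \<phi> (y - w \<theta>))" for y
    unfolding M_def w_def set_lebesgue_integral_def ..
  have [measurable]: "M \<in> borel_measurable borel" unfolding M by measurable
  have Pint: "set_integrable lborel {0..2*pi} (\<lambda>\<theta>. \<phi> (y - w \<theta>))" for y
    unfolding set_integrable_def
    by (rule borel_integrable_compact)
       (auto intro!: continuous_intros continuous_on_compose2[OF \<phi>(1)] continuous_on_subset[OF cw])
  have Mnn: "ennreal (M y) = (\<integral>\<^sup>+\<theta>. ennreal (\<phi> (y - w \<theta>)) * indicator {0..2*pi} \<theta> \<partial>lborel)" for y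
  proof -
    have "ennreal (M y) = (\<integral>\<^sup>+\<theta>. ennreal (indicator {0..2*pi} \<theta> *\<^sub>R \<phi> (y - w \<theta>)) \<partial>lborel)"
      unfolding M using Pint[of y] \<phi>(2)
      by (intro nn_integral_eq_integral[symmetric]) (auto simp: set_integrable_def)
    also have "\<dots> = (\<integral>\<^sup>+\<theta>. ennreal (\<phi> (y - w \<theta>)) * indicator {0..2*pi} \<theta> \<partial>lborel)"
      by (intro nn_integral_cong) (auto simp: indicator_def)
    finally show ?thesis .
  qed
  have M0: "0 \<le> M y" for y
    unfolding M using \<phi>(2) by (intro Bochner_Integration.integral_nonneg) auto
  have MC: "M y \<le> 2 * pi * C" for y
  proof -
    have "M y \<le> (LINT \<theta>:{0..2*pi}|lborel. C)"
      unfolding M set_lebesgue_integral_def[symmetric] using \<phi>(3) by (intro set_integral_mono Pint) (auto simp: set_integrable_def)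
    then show ?thesis by (simp add: set_lebesgue_integral_def)
  qed
  have i1: "integrable lborel (\<lambda>x. f x * (2 * pi * \<phi> x))"
    by (rule integrable_mult_bounded[OF fint, of _ "2 * pi * C"]) (use \<phi>(2,3) in \<open>auto simp: abs_mult\<close>)
  have i2: "integrable lborel (\<lambda>x. f x * M x)"
    by (rule integrable_mult_bounded[OF fint, of _ "2 * pi * C"]) (use MC M0 in auto)
  have "(\<integral>\<^sup>+y. ennreal (f y * M y) \<partial>lborel) = (\<integral>\<^sup>+y. F y * ennreal (M y) \<partial>lborel)"
    by (intro nn_integral_cong_AE) (use AEF f0 M0 in \<open>auto simp: ennreal_mult elim!: eventually_mono\<close>)
  also have "\<dots> = (\<integral>\<^sup>+y. (\<integral>\<^sup>+\<theta>. F y * (ennreal (\<phi> (y - w \<theta>)) * indicator {0..2*pi} \<theta>) \<partial>lborel) \<partial>lborel)"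
    unfolding Mnn by (rule nn_integral_cong, rule nn_integral_cmult[symmetric]) measurable
  also have "\<dots> = (\<integral>\<^sup>+\<theta>. (\<integral>\<^sup>+y. F y * (ennreal (\<phi> (y - w \<theta>)) * indicator {0..2*pi} \<theta>) \<partial>lborel) \<partial>lborel)"
    by (rule lborel_pair.Fubini') measurable
  also have "\<dots> = (\<integral>\<^sup>+\<theta>. (\<integral>\<^sup>+x. F (x + w \<theta>) * (ennreal (\<phi> x) * indicator {0..2*pi} \<theta>) \<partial>lborel) \<partial>lborel)"
  proof (rule nn_integral_cong)
    fix \<theta> :: real
    show "(\<integral>\<^sup>+y. F y * (ennreal (\<phi> (y - w \<theta>)) * indicator {0..2*pi} \<theta>) \<partial>lborel)
        = (\<integral>\<^sup>+x. F (x + w \<theta>) * (ennreal (\<phi> x) * indicator {0..2*pi} \<theta>) \<partial>lborel)"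
      by (subst nn_integral_lborel_translate[of _ "w \<theta>", symmetric]) (measurable, simp add: add.commute)
  qed
  also have "\<dots> = (\<integral>\<^sup>+x. (\<integral>\<^sup>+\<theta>. F (x + w \<theta>) * (ennreal (\<phi> x) * indicator {0..2*pi} \<theta>) \<partial>lborel) \<partial>lborel)"
    by (rule lborel_pair.Fubini') measurable
  also have "\<dots> \<le> (\<integral>\<^sup>+x. F x * ennreal (2 * pi * \<phi> x) \<partial>lborel)"
  proof (rule nn_integral_mono)
    fix x :: "complex ^ 'n"
    show "(\<integral>\<^sup>+\<theta>. F (x + w \<theta>) * (ennreal (\<phi> x) * indicator {0..2*pi} \<theta>) \<partial>lborel) \<le> F x * ennreal (2 * pi * \<phi> x)"
    proof (cases "\<phi> x = 0")
      case False
      define e :: "complex ^ 'n" where "e = of_real s *s axis k 1"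
      have "norm e = s" using s by (simp add: e_def norm_cscale)
      then have "(\<integral>\<^sup>+\<theta>\<in>{0..2*pi}. F (x + cis \<theta> *s e) \<partial>lborel) \<le> ennreal (2*pi) * F x"
        using circle_superD[OF sup] circle_super_disc_in[OF supp[OF False], of e] by force
      moreover have "cis \<theta> *s e = w \<theta>" for \<theta> by (simp add: e_def w_def vector_smult_assoc mult.commute)
      ultimately have le: "(\<integral>\<^sup>+\<theta>\<in>{0..2*pi}. F (x + w \<theta>) \<partial>lborel) \<le> ennreal (2*pi) * F x" by simp
      have "(\<integral>\<^sup>+\<theta>. F (x + w \<theta>) * (ennreal (\<phi> x) * indicator {0..2*pi} \<theta>) \<partial>lborel)
          = (\<integral>\<^sup>+\<theta>. ennreal (\<phi> x) * (F (x + w \<theta>) * indicator {0..2*pi} \<theta>) \<partial>lborel)"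
        by (simp add: mult_ac)
      also have "\<dots> = ennreal (\<phi> x) * (\<integral>\<^sup>+\<theta>\<in>{0..2*pi}. F (x + w \<theta>) \<partial>lborel)"
        by (rule nn_integral_cmult) measurable
      also have "\<dots> \<le> ennreal (\<phi> x) * (ennreal (2*pi) * F x)" by (rule mult_left_mono[OF le]) simp
      also have "\<dots> = F x * ennreal (2 * pi * \<phi> x)" using \<phi>(2)[of x] by (simp add: ennreal_mult mult_ac)
      finally show ?thesis .
    qed simp
  qed
  also have "\<dots> = (\<integral>\<^sup>+y. ennreal (f y * (2 * pi * \<phi> y)) \<partial>lborel)"
    by (intro nn_integral_cong_AE) (use AEF f0 \<phi>(2) in \<open>auto simp: ennreal_mult elim!: eventually_mono\<close>)
  finally have le: "(\<integral>\<^sup>+y. ennreal (f y * M y) \<partial>lborel) \<le> (\<integral>\<^sup>+y. ennreal (f y * (2 * pi * \<phi> y)) \<partial>lborel)" .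
  have e1: "(\<integral>\<^sup>+y. ennreal (f y * M y) \<partial>lborel) = ennreal (LINT y|lborel. f y * M y)"
    using i2 f0 M0 by (intro nn_integral_eq_integral) auto
  have e2: "(\<integral>\<^sup>+y. ennreal (f y * (2 * pi * \<phi> y)) \<partial>lborel) = ennreal (LINT y|lborel. f y * (2 * pi * \<phi> y))"
    using i1 f0 \<phi>(2) by (intro nn_integral_eq_integral) auto
  have n0: "0 \<le> (LINT y|lborel. f y * (2 * pi * \<phi> y))"
    using f0 \<phi>(2) by (intro Bochner_Integration.integral_nonneg) auto
  have le': "(LINT y|lborel. f y * M y) \<le> (LINT y|lborel. f y * (2 * pi * \<phi> y))"
    using le unfolding e1 e2 using n0 by simp
  show "integrable lborel (\<lambda>x. enn2real (F x) * (2 * pi * \<phi> x - M x))"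
    unfolding f_def[symmetric] right_diff_distrib by (rule Bochner_Integration.integrable_diff[OF i1 i2])
  show "0 \<le> (LINT x|lborel. enn2real (F x) * (2 * pi * \<phi> x - M x))"
    unfolding f_def[symmetric] right_diff_distrib Bochner_Integration.integral_diff[OF i1 i2] using le' by simp
qed


text \<open>Summing \<open>cap_lap\<close> over all coordinates gives \<open>-3\<close> times this weight, which depends on the
  distance to \<open>z\<close> only and equals the radial expression found when the weighted mean
  \<open>\<tau>\<^bsup>-n-2\<^esup> \<integral> f (cap \<tau> z)\<^sup>2\<close> is differentiated in \<open>\<tau>\<close>.\<close>

definition cap_weight :: "real \<Rightarrow> complex ^ 'n \<Rightarrow> complex ^ 'n \<Rightarrow> real" where
  "cap_weight \<tau> z x = (real CARD('n) + 2) * (cap \<tau> z x)\<^sup>2 - 2 * \<tau> * cap \<tau> z x"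

lemma borel_measurable_cap_weight [measurable]: "cap_weight \<tau> z \<in> borel_measurable borel"
  unfolding cap_weight_def by measurable

lemma cap_weight_bounds:
  fixes z :: "complex ^ 'n"
  assumes \<tau>: "0 \<le> \<tau>"
  shows "cap_weight \<tau> z x \<le> (real CARD('n) + 2) * \<tau>\<^sup>2"
    and "\<bar>cap_weight \<tau> z x\<bar> \<le> (real CARD('n) + 2) * \<tau>\<^sup>2 + 2 * \<tau> * \<tau>"
proof -
  have "(real CARD('n) + 2) * (cap \<tau> z x)\<^sup>2 \<le> (real CARD('n) + 2) * \<tau>\<^sup>2"
    "2 * \<tau> * cap \<tau> z x \<le> 2 * \<tau> * \<tau>"
    using \<tau> cap_le[OF \<tau>] by (auto intro!: mult_left_mono power_mono)
  moreover have "0 \<le> (real CARD('n) + 2) * (cap \<tau> z x)\<^sup>2" "0 \<le> 2 * \<tau> * cap \<tau> z x"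
    "0 \<le> (real CARD('n) + 2) * \<tau>\<^sup>2" "0 \<le> 2 * \<tau> * \<tau>" using \<tau> by auto
  ultimately show "cap_weight \<tau> z x \<le> (real CARD('n) + 2) * \<tau>\<^sup>2"
    "\<bar>cap_weight \<tau> z x\<bar> \<le> (real CARD('n) + 2) * \<tau>\<^sup>2 + 2 * \<tau> * \<tau>"
    unfolding cap_weight_def abs_le_iff by linarith+
qed

definition excess :: "(complex ^ 'n \<Rightarrow> real) \<Rightarrow> complex ^ 'n \<Rightarrow> real \<Rightarrow> real" where
  "excess f z \<tau> = (LINT x|lborel. f x * cap_weight \<tau> z x)"

lemma sum_cap_lap:
  fixes x z :: "complex ^ 'n"
  shows "(\<Sum>k\<in>UNIV. cap_lap k \<tau> z x) = - 3 * cap_weight \<tau> z x"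
proof -
  define Q where "Q = cap \<tau> z x"
  have n2: "(\<Sum>k\<in>UNIV. (cmod ((x - z) $ k))\<^sup>2) = (norm (x - z))\<^sup>2"
    by (simp add: norm_vec_def L2_set_def sum_nonneg)
  have "(\<Sum>k\<in>UNIV. cap_lap k \<tau> z x) = 6 * Q * (norm (x - z))\<^sup>2 - 3 * real CARD('n) * Q\<^sup>2"
    unfolding cap_lap_def Q_def[symmetric] sum_subtractf n2[symmetric] sum_distrib_left[symmetric] by simp
  moreover have "Q * (norm (x - z))\<^sup>2 = Q * (\<tau> - Q)"
    unfolding Q_def cap_def by (auto simp: max_def)
  ultimately show ?thesis
    unfolding cap_weight_def Q_def[symmetric] by (simp add: power2_eq_square algebra_simps)
qed

text \<open>Up to the factor \<open>-3\<close>, \<open>excess f z \<tau>\<close> is the integral of \<open>f\<close> against a quarter of the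
  Laplacian of \<open>(\<tau> - \<bar>x - z\<bar>\<^sup>2)\<^sub>+\<^sup>3\<close>. So the lemma says that the distributional Laplacian of the
  superharmonic \<open>f\<close> is nonpositive on nonnegative combinations of such caps.\<close>

lemma excess_combination_nonneg:
  fixes F :: "complex ^ 'n \<Rightarrow> ennreal" and z :: "'i \<Rightarrow> complex ^ 'n"
  assumes F[measurable]: "F \<in> borel_measurable borel" and fin: "(\<integral>\<^sup>+x. F x \<partial>lborel) < \<infinity>"
    and sup: "circle_super F L" and L: "bounded L" and F0: "\<And>x. x \<notin> L \<Longrightarrow> F x = 0"
    and I: "finite I" and \<tau>: "\<And>i. i \<in> I \<Longrightarrow> 0 \<le> \<tau> i" and \<epsilon>: "0 < \<epsilon>"
    and supp: "\<And>i x. i \<in> I \<Longrightarrow> (norm (x - z i))\<^sup>2 \<le> \<tau> i \<Longrightarrow> cball x \<epsilon> \<subseteq> L"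
    and nn: "\<And>x. 0 \<le> (\<Sum>i\<in>I. c i * cap (\<tau> i) (z i) x ^ 3)"
  shows "0 \<le> (\<Sum>i\<in>I. c i * excess (\<lambda>x. enn2real (F x)) (z i) (\<tau> i))"
proof -
  define f where "f x = enn2real (F x)" for x
  have f0: "0 \<le> f x" for x by (simp add: f_def)
  have [measurable]: "f \<in> borel_measurable borel" unfolding f_def by measurable
  have fint: "integrable lborel f" unfolding f_def using F fin by (intro enn2real_integrable) auto
  have fL: "x \<in> L" if "f x \<noteq> 0" for x using that F0[of x] by (cases "x \<in> L") (auto simp: f_def)
  obtain R where R: "\<And>x. x \<in> L \<Longrightarrow> norm x \<le> R" using L by (auto simp: bounded_iff)
  define D where "D = \<bar>R\<bar> + (\<Sum>i\<in>I. norm (z i))"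
  have D: "norm (x - z i) \<le> D" if "x \<in> L" "i \<in> I" for x i
  proof -
    have "norm (z i) \<le> (\<Sum>i\<in>I. norm (z i))" using that I by (intro member_le_sum) auto
    then show ?thesis using R[OF that(1)] norm_triangle_ineq4[of x "z i"] unfolding D_def by linarith
  qed
  have lapb: "\<bar>cap_lap k (\<tau> i) (z i) x\<bar> \<le> 6 * \<tau> i * D\<^sup>2 + 3 * (\<tau> i)\<^sup>2" if "x \<in> L" "i \<in> I" for x i k
  proof -
    have "cmod ((x - z i) $ k) \<le> D"
      using D[OF that] Finite_Cartesian_Product.norm_nth_le[of "x - z i" k] by linarith
    then have "(cmod ((x - z i) $ k))\<^sup>2 \<le> D\<^sup>2" by (intro power_mono) auto
    then have "6 * cap (\<tau> i) (z i) x * (cmod ((x - z i) $ k))\<^sup>2 \<le> 6 * \<tau> i * D\<^sup>2"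
      using \<tau>[OF that(2)] cap_le by (intro mult_mono) auto
    moreover have "(cap (\<tau> i) (z i) x)\<^sup>2 \<le> (\<tau> i)\<^sup>2" using \<tau>[OF that(2)] cap_le by (intro power_mono) auto
    moreover have "0 \<le> 6 * cap (\<tau> i) (z i) x * (cmod ((x - z i) $ k))\<^sup>2" "0 \<le> (cap (\<tau> i) (z i) x)\<^sup>2" by simp_all
    ultimately show ?thesis unfolding cap_lap_def abs_le_iff by linarith
  qed
  define E where "E = (\<Sum>i\<in>I. \<bar>c i\<bar> * (3 * \<tau> i * (4 * D + 1) + (2 * D + 1) ^ 3))"
  have mlap[measurable]: "(\<lambda>x. cap_lap k (\<tau> i) (z i) x) \<in> borel_measurable borel" for i k
    unfolding cap_lap_def by (intro borel_measurable_continuous_onI continuous_intros)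
  have intlap: "integrable lborel (\<lambda>x. f x * cap_lap k (\<tau> i) (z i) x)" if "i \<in> I" for i k
    by (rule integrable_mult_bounded[OF fint]) (use lapb[OF fL that] in auto)
  have key: "(\<Sum>i\<in>I. c i * (LINT x|lborel. f x * cap_lap k (\<tau> i) (z i) x)) \<le> 0" for k
  proof -
    define \<Lambda> where "\<Lambda> x = (\<Sum>i\<in>I. c i * cap_lap k (\<tau> i) (z i) x)" for x
    define \<phi> where "\<phi> x = (\<Sum>i\<in>I. c i * cap (\<tau> i) (z i) x ^ 3)" for x
    have fL': "f x * \<Lambda> x = (\<Sum>i\<in>I. c i * (f x * cap_lap k (\<tau> i) (z i) x))" for x
      by (simp add: \<Lambda>_def sum_distrib_left mult_ac)
    have int\<Lambda>: "integrable lborel (\<lambda>x. f x * \<Lambda> x)"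
      unfolding fL' using intlap by (intro Bochner_Integration.integrable_sum integrable_mult_right) auto
    have val\<Lambda>: "(LINT x|lborel. f x * \<Lambda> x) = (\<Sum>i\<in>I. c i * (LINT x|lborel. f x * cap_lap k (\<tau> i) (z i) x))"
      unfolding fL' using intlap by (subst Bochner_Integration.integral_sum) auto
    have small: "(LINT x|lborel. f x * \<Lambda> x) \<le> s * (E * (LINT x|lborel. f x))" if s: "0 < s" "s \<le> min \<epsilon> 1" for s
    proof -
      define M where "M y = (LINT \<theta>:{0..2*pi}|lborel. \<phi> (y - (of_real s * cis \<theta>) *s axis k 1))" for y
      have \<phi>c: "continuous_on UNIV \<phi>" unfolding \<phi>_def by (intro continuous_intros)
      have \<phi>C: "\<phi> x \<le> (\<Sum>i\<in>I. \<bar>c i\<bar> * \<tau> i ^ 3)" for x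
        unfolding \<phi>_def
      proof (rule sum_mono)
        fix i assume i: "i \<in> I"
        have "c i * cap (\<tau> i) (z i) x ^ 3 \<le> \<bar>c i\<bar> * cap (\<tau> i) (z i) x ^ 3" by (intro mult_right_mono) auto
        also have "\<dots> \<le> \<bar>c i\<bar> * \<tau> i ^ 3" using cap_le[OF \<tau>[OF i]] by (intro mult_left_mono power_mono) auto
        finally show "c i * cap (\<tau> i) (z i) x ^ 3 \<le> \<bar>c i\<bar> * \<tau> i ^ 3" .
      qed
      have \<phi>s: "cball x s \<subseteq> L" if "\<phi> x \<noteq> 0" for x
      proof -
        have "\<exists>i\<in>I. c i * cap (\<tau> i) (z i) x ^ 3 \<noteq> 0" using that unfolding \<phi>_def by (meson sum.neutral)
        then obtain i where "i \<in> I" "cap (\<tau> i) (z i) x \<noteq> 0" by auto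
        then have "cball x \<epsilon> \<subseteq> L" by (intro supp[of i]) (auto simp: cap_def max_def split: if_splits)
        then show ?thesis using s subset_cball[of s \<epsilon> x] by auto
      qed
      note T = circle_super_test[OF F fin sup s(1) \<phi>c nn[folded \<phi>_def] \<phi>C \<phi>s, where k = k, folded f_def M_def]
      have pw: "f y * (2 * pi * \<phi> y - M y) \<le> 2 * pi * s ^ 3 * E * f y - 2 * pi * s\<^sup>2 * (f y * \<Lambda> y)" for y
      proof (cases "f y = 0")
        case False
        have Pint: "set_integrable lborel {0..2*pi} (\<lambda>\<theta>. cap (\<tau> i) (z i) (y - (of_real s * cis \<theta>) *s axis k 1) ^ 3)" for i
          unfolding set_integrable_def by (rule borel_integrable_compact) (auto intro!: continuous_intros)
        have "M y = (\<Sum>i\<in>I. c i * cap_circle k s (\<tau> i) (z i) y)"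
        proof -
          have "M y = (LINT \<theta>|lborel. (\<Sum>i\<in>I. c i * (indicator {0..2*pi} \<theta> *\<^sub>R cap (\<tau> i) (z i) (y - (of_real s * cis \<theta>) *s axis k 1) ^ 3)))"
            unfolding M_def \<phi>_def set_lebesgue_integral_def by (simp add: sum_distrib_left mult_ac)
          also have "\<dots> = (\<Sum>i\<in>I. LINT \<theta>|lborel. c i * (indicator {0..2*pi} \<theta> *\<^sub>R cap (\<tau> i) (z i) (y - (of_real s * cis \<theta>) *s axis k 1) ^ 3))"
            using Pint by (intro Bochner_Integration.integral_sum integrable_mult_right) (simp add: set_integrable_def)
          finally show ?thesis unfolding cap_circle_def set_lebesgue_integral_def by simp
        qed
        then have "2 * pi * (\<phi> y + s\<^sup>2 * \<Lambda> y) - M y = (\<Sum>i\<in>I. c i * (2 * pi * (cap (\<tau> i) (z i) y ^ 3 + s\<^sup>2 * cap_lap k (\<tau> i) (z i) y)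
            - cap_circle k s (\<tau> i) (z i) y))"
          unfolding \<phi>_def \<Lambda>_def by (simp add: sum_distrib_left sum_subtractf sum.distrib algebra_simps)
        also have "\<dots> \<le> (\<Sum>i\<in>I. \<bar>c i\<bar> * (2 * pi * (s ^ 3 * (3 * \<tau> i * (4 * D + 1) + (2 * D + 1) ^ 3))))"
        proof (rule sum_mono)
          fix i assume i: "i \<in> I"
          have "\<bar>cap_circle k s (\<tau> i) (z i) y
              - 2 * pi * (cap (\<tau> i) (z i) y ^ 3 + s\<^sup>2 * cap_lap k (\<tau> i) (z i) y)\<bar>
              \<le> 2 * pi * (s ^ 3 * (3 * \<tau> i * (4 * D + 1) + (2 * D + 1) ^ 3))"
            using s by (intro cap_circle_expansion \<tau>[OF i] D[OF fL[OF False] i]) auto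
          then have "\<bar>c i * (2 * pi * (cap (\<tau> i) (z i) y ^ 3 + s\<^sup>2 * cap_lap k (\<tau> i) (z i) y)
            - cap_circle k s (\<tau> i) (z i) y)\<bar>
            \<le> \<bar>c i\<bar> * (2 * pi * (s ^ 3 * (3 * \<tau> i * (4 * D + 1) + (2 * D + 1) ^ 3)))"
            unfolding abs_mult by (intro mult_left_mono) (simp_all only: abs_minus_commute abs_ge_zero)
          then show "c i * (2 * pi * (cap (\<tau> i) (z i) y ^ 3 + s\<^sup>2 * cap_lap k (\<tau> i) (z i) y)
            - cap_circle k s (\<tau> i) (z i) y)
            \<le> \<bar>c i\<bar> * (2 * pi * (s ^ 3 * (3 * \<tau> i * (4 * D + 1) + (2 * D + 1) ^ 3)))"
            by (rule order_trans[OF abs_ge_self])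
        qed
        also have "\<dots> = 2 * pi * s ^ 3 * E" unfolding E_def by (simp add: sum_distrib_left mult_ac)
        finally have "2 * pi * \<phi> y - M y \<le> 2 * pi * s ^ 3 * E - 2 * pi * s\<^sup>2 * \<Lambda> y" by (simp add: algebra_simps)
        then have "f y * (2 * pi * \<phi> y - M y) \<le> f y * (2 * pi * s ^ 3 * E - 2 * pi * s\<^sup>2 * \<Lambda> y)"
          using f0 by (rule mult_left_mono)
        then show ?thesis by (simp add: algebra_simps)
      qed simp
      have ia: "integrable lborel (\<lambda>y. 2 * pi * s ^ 3 * E * f y)" "integrable lborel (\<lambda>y. 2 * pi * s\<^sup>2 * (f y * \<Lambda> y))"
        using fint int\<Lambda> by (auto intro: integrable_mult_right)
      have "0 \<le> (LINT y|lborel. f y * (2 * pi * \<phi> y - M y))" by (rule T(2))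
      also have "\<dots> \<le> (LINT y|lborel. 2 * pi * s ^ 3 * E * f y - 2 * pi * s\<^sup>2 * (f y * \<Lambda> y))"
        by (rule integral_mono[OF T(1) Bochner_Integration.integrable_diff[OF ia] pw])
      also have "\<dots> = 2 * pi * s ^ 3 * E * (LINT x|lborel. f x) - 2 * pi * s\<^sup>2 * (LINT y|lborel. f y * \<Lambda> y)"
        unfolding Bochner_Integration.integral_diff[OF ia] by simp
      finally have "(2 * pi * s\<^sup>2) * (LINT y|lborel. f y * \<Lambda> y) \<le> (2 * pi * s\<^sup>2) * (s * (E * (LINT x|lborel. f x)))"
        by (simp add: power2_eq_square power3_eq_cube mult_ac)
      then show ?thesis using s(1) by simp
    qed
    have "((\<lambda>s. s * (E * (LINT x|lborel. f x))) \<longlongrightarrow> 0 * (E * (LINT x|lborel. f x))) (at_right 0)"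
      by (intro tendsto_intros)
    moreover have "eventually (\<lambda>s. 0 < s \<and> s \<le> min \<epsilon> 1) (at_right (0::real))"
      using \<epsilon> eventually_at_right_real[of 0 "min \<epsilon> 1"] by (auto elim: eventually_mono)
    then have "eventually (\<lambda>s. (LINT x|lborel. f x * \<Lambda> x) \<le> s * (E * (LINT x|lborel. f x))) (at_right 0)"
      by eventually_elim (use small in auto)
    ultimately have "(LINT x|lborel. f x * \<Lambda> x) \<le> 0 * (E * (LINT x|lborel. f x))"
      by (intro tendsto_lowerbound) auto
    then show ?thesis unfolding val\<Lambda> by simp
  qed
  have ex: "excess f (z i) (\<tau> i) = - (\<Sum>k\<in>UNIV. LINT x|lborel. f x * cap_lap k (\<tau> i) (z i) x) / 3" if "i \<in> I" for i
  proof -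
    have "(\<Sum>k\<in>UNIV. LINT x|lborel. f x * cap_lap k (\<tau> i) (z i) x) = (LINT x|lborel. f x * (\<Sum>k\<in>UNIV. cap_lap k (\<tau> i) (z i) x))"
      unfolding sum_distrib_left by (rule Bochner_Integration.integral_sum[symmetric]) (rule intlap[OF that])
    also have "\<dots> = (LINT x|lborel. (- 3) * (f x * cap_weight (\<tau> i) (z i) x))"
      unfolding sum_cap_lap by (intro Bochner_Integration.integral_cong) (auto simp: algebra_simps)
    also have "\<dots> = - 3 * excess f (z i) (\<tau> i)" unfolding excess_def by (rule integral_mult_right_zero)
    finally show ?thesis by simp
  qed
  have "(\<Sum>i\<in>I. c i * excess f (z i) (\<tau> i)) = - (\<Sum>i\<in>I. \<Sum>k\<in>UNIV. c i * (LINT x|lborel. f x * cap_lap k (\<tau> i) (z i) x)) / 3"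
    by (simp add: ex sum_distrib_left sum_divide_distrib sum_negf)
  also have "(\<Sum>i\<in>I. \<Sum>k\<in>UNIV. c i * (LINT x|lborel. f x * cap_lap k (\<tau> i) (z i) x)) = (\<Sum>k\<in>UNIV. \<Sum>i\<in>I. c i * (LINT x|lborel. f x * cap_lap k (\<tau> i) (z i) x))"
    by (rule sum.swap)
  finally show ?thesis
    using sum_nonpos[of UNIV "\<lambda>k. \<Sum>i\<in>I. c i * (LINT x|lborel. f x * cap_lap k (\<tau> i) (z i) x)"] key
    unfolding f_def[symmetric] by simp
qed

section \<open>The excess of disjoint balls\<close>

lemma cap_le_one:
  assumes "0 < t"
  shows "cap (t\<^sup>2) z x ^ 3 / t ^ 6 \<le> 1"
proof -
  have "cap (t\<^sup>2) z x ^ 3 \<le> (t\<^sup>2) ^ 3" by (intro power_mono cap_le) auto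
  then show ?thesis using assms by (simp add: power_mult[symmetric])
qed

lemma excess_le:
  fixes z :: "complex ^ 'n"
  assumes f: "integrable lborel f" "\<And>x. 0 \<le> f x" and \<tau>: "0 \<le> \<tau>"
  shows "excess f z \<tau> \<le> (real CARD('n) + 2) * \<tau>\<^sup>2 * (LINT x|lborel. f x)"
proof -
  have "excess f z \<tau> \<le> (LINT x|lborel. f x * ((real CARD('n) + 2) * \<tau>\<^sup>2))"
    unfolding excess_def
    by (rule integral_mono[OF integrable_mult_bounded[OF f(1) _ cap_weight_bounds(2)[OF \<tau>]] integrable_mult_left[OF f(1)]])
       (use cap_weight_bounds(1)[OF \<tau>] f(2) in \<open>auto intro: mult_left_mono\<close>)
  also have "\<dots> = (real CARD('n) + 2) * \<tau>\<^sup>2 * (LINT x|lborel. f x)" by simp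
  finally show ?thesis .
qed

text \<open>The cubed caps over disjoint balls, normalised to have maximum one, add up to at most one, so their sum is dominated by a fixed
  finite sum of large caps whose balls cover a neighbourhood of \<open>K\<close>; positivity of the difference bounds the total excess.\<close>

lemma excess_disjoint_balls:
  fixes F :: "complex ^ 'n \<Rightarrow> ennreal" and t :: "complex ^ 'n \<Rightarrow> real"
  assumes F: "F \<in> borel_measurable borel" and fin: "(\<integral>\<^sup>+x. F x \<partial>lborel) < \<infinity>"
    and sup: "circle_super F L" and L: "bounded L" and F0: "\<And>x. x \<notin> L \<Longrightarrow> F x = 0"
    and R: "0 < R" "\<And>a. a \<in> K \<Longrightarrow> cball a (3 * R) \<subseteq> L"
    and A: "finite A" "A \<subseteq> K" "K \<subseteq> (\<Union>a\<in>A. ball a R)"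
    and J: "finite J" "J \<subseteq> K" and t: "\<And>z. z \<in> J \<Longrightarrow> 0 < t z \<and> t z \<le> R / 2"
    and disj: "pairwise (\<lambda>y z. disjnt (cball y (t y)) (cball z (t z))) J"
  shows "(\<Sum>z\<in>J. excess (\<lambda>x. enn2real (F x)) z ((t z)\<^sup>2) / t z ^ 6)
      \<le> real (card A) * (16 * (real CARD('n) + 2) / R\<^sup>2 * (LINT x|lborel. enn2real (F x)))"
proof -
  define f where "f x = enn2real (F x)" for x
  have f0: "0 \<le> f x" for x by (simp add: f_def)
  have fint: "integrable lborel f" unfolding f_def using F fin by (intro enn2real_integrable) auto
  define zz where "zz = (\<lambda>i::(complex^'n) + (complex^'n). case i of Inl a \<Rightarrow> a | Inr z \<Rightarrow> z)"
  define tt where "tt = (\<lambda>i::(complex^'n) + (complex^'n). case i of Inl a \<Rightarrow> (2 * R)\<^sup>2 | Inr z \<Rightarrow> (t z)\<^sup>2)"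
  define cc where "cc = (\<lambda>i::(complex^'n) + (complex^'n). case i of Inl a \<Rightarrow> 1 / R ^ 6 | Inr z \<Rightarrow> - (1 / t z ^ 6))"
  have "0 \<le> (\<Sum>i\<in>A <+> J. cc i * excess (\<lambda>x. enn2real (F x)) (zz i) (tt i))"
  proof (rule excess_combination_nonneg[OF F fin sup L F0 _ _ R(1)])
    show "finite (A <+> J)" using A J by simp
    show "0 \<le> tt i" if "i \<in> A <+> J" for i by (cases i) (auto simp: tt_def)
    show "cball x R \<subseteq> L" if "i \<in> A <+> J" "(norm (x - zz i))\<^sup>2 \<le> tt i" for i x
    proof -
      have zK: "zz i \<in> K" using that(1) A J by (auto simp: zz_def)
      have "tt i \<le> (2 * R)\<^sup>2"
      proof (cases i)
        case (Inr y)
        then have "0 < t y" "t y \<le> 2 * R" using that(1) t[of y] R(1) by auto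
        then have "(t y)\<^sup>2 \<le> (2 * R)\<^sup>2" by (intro power_mono) auto
        then show ?thesis by (simp add: tt_def Inr)
      qed (simp add: tt_def)
      then have "(norm (x - zz i))\<^sup>2 \<le> (2 * R)\<^sup>2" using that(2) by linarith
      then have "norm (x - zz i) \<le> 2 * R" by (rule power2_le_imp_le) (use R(1) in simp)
      then have "cball x R \<subseteq> cball (zz i) (3 * R)"
        by (intro cball_subset_cball_iff[THEN iffD2] disjI1) (simp add: dist_norm)
      then show ?thesis using R(2)[OF zK] by blast
    qed
    fix x :: "complex ^ 'n"
    have split: "(\<Sum>i\<in>A <+> J. cc i * cap (tt i) (zz i) x ^ 3)
        = (\<Sum>a\<in>A. cap ((2 * R)\<^sup>2) a x ^ 3 / R ^ 6) - (\<Sum>z\<in>J. cap ((t z)\<^sup>2) z x ^ 3 / t z ^ 6)"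
      using A(1) J(1) by (subst sum.Plus) (auto simp: cc_def tt_def zz_def sum_negf)
    have pos: "0 \<le> (\<Sum>a\<in>A. cap ((2 * R)\<^sup>2) a x ^ 3 / R ^ 6)" using R(1) by (intro sum_nonneg) auto
    have capz: "x \<in> cball z (t z)" if "z \<in> J" "cap ((t z)\<^sup>2) z x \<noteq> 0" for z
    proof -
      have "(norm (x - z))\<^sup>2 < (t z)\<^sup>2" using that(2) by (auto simp: cap_def max_def split: if_splits)
      then have "norm (x - z) < t z" using t[OF that(1)] by (meson less_imp_le power2_less_imp_less)
      then show ?thesis by (simp add: dist_norm norm_minus_commute)
    qed
    have "(\<Sum>z\<in>J. cap ((t z)\<^sup>2) z x ^ 3 / t z ^ 6) \<le> (\<Sum>a\<in>A. cap ((2 * R)\<^sup>2) a x ^ 3 / R ^ 6)"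
    proof (cases "\<exists>z\<in>J. cap ((t z)\<^sup>2) z x \<noteq> 0")
      case True
      then obtain z where z: "z \<in> J" "cap ((t z)\<^sup>2) z x \<noteq> 0" by blast
      have xz: "x \<in> cball z (t z)" using capz z by blast
      have "cap ((t y)\<^sup>2) y x = 0" if "y \<in> J - {z}" for y
      proof (rule ccontr)
        assume "cap ((t y)\<^sup>2) y x \<noteq> 0"
        then have "x \<in> cball y (t y)" using capz that by blast
        moreover have "disjnt (cball y (t y)) (cball z (t z))" using disj that z(1) by (auto simp: pairwise_def)
        ultimately show False using xz by (auto simp: disjnt_iff)
      qed
      then have "(\<Sum>y\<in>J. cap ((t y)\<^sup>2) y x ^ 3 / t y ^ 6) = cap ((t z)\<^sup>2) z x ^ 3 / t z ^ 6"
        using J(1) z(1) by (subst sum.remove[of J z]) auto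
      also have "\<dots> \<le> 1" using cap_le_one t[OF z(1)] by blast
      also have "1 \<le> (\<Sum>a\<in>A. cap ((2 * R)\<^sup>2) a x ^ 3 / R ^ 6)"
      proof -
        obtain a where a: "a \<in> A" "z \<in> ball a R" using A(3) J(2) z(1) by blast
        have "norm (x - a) \<le> norm (x - z) + norm (z - a)" using norm_triangle_ineq[of "x - z" "z - a"] by simp
        also have "\<dots> \<le> 3 / 2 * R" using xz a(2) t[OF z(1)] by (auto simp: dist_norm norm_minus_commute)
        finally have "(norm (x - a))\<^sup>2 \<le> (3 / 2 * R)\<^sup>2" by (intro power_mono) auto
        then have "R\<^sup>2 \<le> (2 * R)\<^sup>2 - (norm (x - a))\<^sup>2"
        proof -
          have "(3 / 2 * R)\<^sup>2 + R\<^sup>2 \<le> (2 * R)\<^sup>2" unfolding power_mult_distrib by (simp add: power2_eq_square)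
          moreover assume "(norm (x - a))\<^sup>2 \<le> (3 / 2 * R)\<^sup>2"
          ultimately show ?thesis by linarith
        qed
        then have "R\<^sup>2 \<le> cap ((2 * R)\<^sup>2) a x" unfolding cap_def by simp
        then have "(R\<^sup>2) ^ 3 \<le> cap ((2 * R)\<^sup>2) a x ^ 3" by (intro power_mono) auto
        then have "1 \<le> cap ((2 * R)\<^sup>2) a x ^ 3 / R ^ 6" using R(1) by (simp add: power_mult[symmetric])
        also have "\<dots> \<le> (\<Sum>a\<in>A. cap ((2 * R)\<^sup>2) a x ^ 3 / R ^ 6)"
          using A(1) a(1) R(1) by (intro member_le_sum) auto
        finally show ?thesis .
      qed
      finally show ?thesis .
    next
      case False
      then show ?thesis using pos by (simp add: sum.neutral)
    qed
    then show "0 \<le> (\<Sum>i\<in>A <+> J. cc i * cap (tt i) (zz i) x ^ 3)" unfolding split by simp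
  qed
  also have "(\<Sum>i\<in>A <+> J. cc i * excess (\<lambda>x. enn2real (F x)) (zz i) (tt i))
      = (\<Sum>a\<in>A. excess f a ((2 * R)\<^sup>2) / R ^ 6) - (\<Sum>z\<in>J. excess f z ((t z)\<^sup>2) / t z ^ 6)"
    using A(1) J(1) by (subst sum.Plus) (auto simp: cc_def tt_def zz_def sum_negf f_def[abs_def])
  finally have "(\<Sum>z\<in>J. excess f z ((t z)\<^sup>2) / t z ^ 6) \<le> (\<Sum>a\<in>A. excess f a ((2 * R)\<^sup>2) / R ^ 6)" by simp
  also have "\<dots> \<le> (\<Sum>a\<in>A. 16 * (real CARD('n) + 2) / R\<^sup>2 * (LINT x|lborel. f x))"
  proof (rule sum_mono)
    fix a assume "a \<in> A"
    have "excess f a ((2 * R)\<^sup>2) / R ^ 6 \<le> (real CARD('n) + 2) * ((2 * R)\<^sup>2)\<^sup>2 * (LINT x|lborel. f x) / R ^ 6"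
      using R(1) by (intro divide_right_mono excess_le[OF fint f0]) auto
    also have "\<dots> = 16 * (real CARD('n) + 2) / R\<^sup>2 * (LINT x|lborel. f x)"
      using R(1) by (simp add: field_simps power2_eq_square eval_nat_numeral)
    finally show "excess f a ((2 * R)\<^sup>2) / R ^ 6 \<le> 16 * (real CARD('n) + 2) / R\<^sup>2 * (LINT x|lborel. f x)" .
  qed
  also have "\<dots> = real (card A) * (16 * (real CARD('n) + 2) / R\<^sup>2 * (LINT x|lborel. f x))" by simp
  finally show ?thesis unfolding f_def .
qed

section \<open>Weighted means at a point of small excess\<close>

text \<open>The power of \<open>\<tau>\<close> is the one for which the mean of a constant does not depend on \<open>\<tau>\<close>, as the
  real dimension is \<open>2 * CARD('n)\<close> and \<open>\<tau>\<close> is a squared radius. The total weight is not normalised to one.\<close>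

definition cap_mean :: "(complex ^ 'n \<Rightarrow> real) \<Rightarrow> complex ^ 'n \<Rightarrow> real \<Rightarrow> real" where
  "cap_mean h z \<tau> = (LINT x|lborel. h x * (cap \<tau> z x)\<^sup>2) / \<tau> ^ (CARD('n) + 2)"

lemma square_pos_part_taylor:
  fixes q d :: real
  shows "\<bar>(max 0 (q + d))\<^sup>2 - (max 0 q)\<^sup>2 - 2 * d * max 0 q\<bar> \<le> d\<^sup>2"
proof -
  consider "0 \<le> q" "0 \<le> q + d" | "0 \<le> q" "q + d < 0" | "q < 0" "0 \<le> q + d" | "q < 0" "q + d < 0"
    by linarith
  then show ?thesis
  proof cases
    case 1
    then have "(max 0 (q + d))\<^sup>2 - (max 0 q)\<^sup>2 - 2 * d * max 0 q = d\<^sup>2"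
      by (simp add: power2_eq_square algebra_simps)
    then show ?thesis by simp
  next
    case 2
    have "(max 0 (q + d))\<^sup>2 - (max 0 q)\<^sup>2 - 2 * d * max 0 q = d\<^sup>2 - (q + d)\<^sup>2"
      using 2 by (simp add: power2_eq_square algebra_simps)
    moreover have "(- (q + d))\<^sup>2 \<le> (- d)\<^sup>2" using 2 by (intro power_mono) auto
    then have "(q + d)\<^sup>2 \<le> d\<^sup>2" by (simp only: power2_minus)
    moreover have "0 \<le> (q + d)\<^sup>2" by simp
    ultimately show ?thesis by linarith
  next
    case 3
    then have "(q + d)\<^sup>2 \<le> d\<^sup>2" by (intro power_mono) auto
    then show ?thesis using 3 by simp
  qed (auto simp: max_def)
qed

lemma cap_mean_has_derivative:
  fixes z :: "complex ^ 'n"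
  assumes h: "integrable lborel h" and \<tau>: "0 < \<tau>"
  shows "(cap_mean h z has_real_derivative - excess h z \<tau> / \<tau> ^ (CARD('n) + 3)) (at \<tau>)"
proof -
  define P1 where "P1 \<tau> = (LINT x|lborel. h x * cap \<tau> z x)" for \<tau>
  define P2 where "P2 \<tau> = (LINT x|lborel. h x * (cap \<tau> z x)\<^sup>2)" for \<tau>
  have capb: "\<bar>cap \<tau> z x\<bar> \<le> \<bar>\<tau>\<bar>" for \<tau> x
    using zero_le_power2[of "norm (x - z)"] unfolding cap_def by linarith
  have i1: "integrable lborel (\<lambda>x. h x * cap \<tau> z x)" for \<tau>
    by (rule integrable_mult_bounded[OF h _ capb]) measurable
  have i2: "integrable lborel (\<lambda>x. h x * (cap \<tau> z x)\<^sup>2)" for \<tau>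
    by (rule integrable_mult_bounded[OF h, of _ "\<tau>\<^sup>2"]) (use capb in \<open>auto simp: abs_le_square_iff[symmetric]\<close>)
  have taylor: "\<bar>P2 (\<tau> + d) - P2 \<tau> - d * (2 * P1 \<tau>)\<bar> \<le> d\<^sup>2 * (LINT x|lborel. \<bar>h x\<bar>)" for d
  proof -
    have eq: "P2 (\<tau> + d) - P2 \<tau> - d * (2 * P1 \<tau>) = (LINT x|lborel. h x * (cap (\<tau> + d) z x)\<^sup>2 - h x * (cap \<tau> z x)\<^sup>2 - (2 * d) * (h x * cap \<tau> z x))"
      unfolding P1_def P2_def using i1 i2 by simp
    have "\<bar>P2 (\<tau> + d) - P2 \<tau> - d * (2 * P1 \<tau>)\<bar> \<le> (LINT x|lborel. \<bar>h x * (cap (\<tau> + d) z x)\<^sup>2 - h x * (cap \<tau> z x)\<^sup>2 - (2 * d) * (h x * cap \<tau> z x)\<bar>)"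
      unfolding eq by (rule integral_abs_bound)
    also have "\<dots> \<le> (LINT x|lborel. d\<^sup>2 * \<bar>h x\<bar>)"
    proof (rule integral_mono)
      fix x
      have "h x * (cap (\<tau> + d) z x)\<^sup>2 - h x * (cap \<tau> z x)\<^sup>2 - (2 * d) * (h x * cap \<tau> z x)
          = h x * ((cap (\<tau> + d) z x)\<^sup>2 - (cap \<tau> z x)\<^sup>2 - 2 * d * cap \<tau> z x)" by (simp add: algebra_simps)
      moreover have "\<bar>(cap (\<tau> + d) z x)\<^sup>2 - (cap \<tau> z x)\<^sup>2 - 2 * d * cap \<tau> z x\<bar> \<le> d\<^sup>2"
        using square_pos_part_taylor[of "\<tau> - (norm (x - z))\<^sup>2" d] unfolding cap_def by (simp add: algebra_simps)
      ultimately show "\<bar>h x * (cap (\<tau> + d) z x)\<^sup>2 - h x * (cap \<tau> z x)\<^sup>2 - (2 * d) * (h x * cap \<tau> z x)\<bar> \<le> d\<^sup>2 * \<bar>h x\<bar>"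
        by (simp only: abs_mult mult.commute[of "d\<^sup>2"] mult_left_mono abs_ge_zero)
    qed (use i1 i2 h in auto)
    also have "\<dots> = d\<^sup>2 * (LINT x|lborel. \<bar>h x\<bar>)" by simp
    finally show ?thesis .
  qed
  have D2: "(P2 has_real_derivative 2 * P1 \<tau>) (at \<tau>)"
    unfolding DERIV_def
  proof (rule LIM_zero_cancel, rule Lim_null_comparison)
    show "eventually (\<lambda>d. norm ((P2 (\<tau> + d) - P2 \<tau>) / d - 2 * P1 \<tau>) \<le> \<bar>d\<bar> * (LINT x|lborel. \<bar>h x\<bar>)) (at 0)"
      unfolding eventually_at_filter
    proof (rule always_eventually, intro allI impI)
      fix d :: real assume d: "d \<noteq> 0"
      have "(P2 (\<tau> + d) - P2 \<tau>) / d - 2 * P1 \<tau> = (P2 (\<tau> + d) - P2 \<tau> - d * (2 * P1 \<tau>)) / d"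
        using d by (simp add: field_simps)
      then have "\<bar>(P2 (\<tau> + d) - P2 \<tau>) / d - 2 * P1 \<tau>\<bar> = \<bar>P2 (\<tau> + d) - P2 \<tau> - d * (2 * P1 \<tau>)\<bar> / \<bar>d\<bar>" by simp
      also have "\<dots> \<le> d\<^sup>2 * (LINT x|lborel. \<bar>h x\<bar>) / \<bar>d\<bar>" by (rule divide_right_mono[OF taylor]) simp
      also have "\<dots> = \<bar>d\<bar> * (LINT x|lborel. \<bar>h x\<bar>)"
        using d by (cases "0 < d") (simp_all add: power2_eq_square abs_if)
      finally show "norm ((P2 (\<tau> + d) - P2 \<tau>) / d - 2 * P1 \<tau>) \<le> \<bar>d\<bar> * (LINT x|lborel. \<bar>h x\<bar>)" by simp
    qed
    have "((\<lambda>d. \<bar>d\<bar> * (LINT x|lborel. \<bar>h x\<bar>)) \<longlongrightarrow> \<bar>0\<bar> * (LINT x|lborel. \<bar>h x\<bar>)) (at (0::real))"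
      by (intro tendsto_intros)
    then show "((\<lambda>d. \<bar>d\<bar> * (LINT x|lborel. \<bar>h x\<bar>)) \<longlongrightarrow> 0) (at (0::real))" by simp
  qed
  have "excess h z \<tau> = (LINT x|lborel. (real CARD('n) + 2) * (h x * (cap \<tau> z x)\<^sup>2) - (2 * \<tau>) * (h x * cap \<tau> z x))"
    unfolding excess_def cap_weight_def by (intro Bochner_Integration.integral_cong) (auto simp: algebra_simps)
  also have "\<dots> = (real CARD('n) + 2) * P2 \<tau> - 2 * \<tau> * P1 \<tau>"
    unfolding P1_def P2_def using i1 i2 by simp
  finally have ex: "excess h z \<tau> = (real CARD('n) + 2) * P2 \<tau> - 2 * \<tau> * P1 \<tau>" .
  have Dp: "((\<lambda>\<tau>. \<tau> ^ (CARD('n) + 2)) has_real_derivative real (CARD('n) + 2) * \<tau> ^ (CARD('n) + 1)) (at \<tau>)"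
    using DERIV_pow[of "CARD('n) + 2" \<tau>] by simp
  have "((\<lambda>\<tau>. P2 \<tau> / \<tau> ^ (CARD('n) + 2)) has_real_derivative
      (2 * P1 \<tau> * \<tau> ^ (CARD('n) + 2) - P2 \<tau> * (real (CARD('n) + 2) * \<tau> ^ (CARD('n) + 1))) / (\<tau> ^ (CARD('n) + 2) * \<tau> ^ (CARD('n) + 2))) (at \<tau>)"
    by (rule DERIV_divide[OF D2 Dp]) (use \<tau> in simp)
  moreover have "(2 * P1 \<tau> * \<tau> ^ (CARD('n) + 2) - P2 \<tau> * (real (CARD('n) + 2) * \<tau> ^ (CARD('n) + 1))) / (\<tau> ^ (CARD('n) + 2) * \<tau> ^ (CARD('n) + 2))
      = - excess h z \<tau> / \<tau> ^ (CARD('n) + 3)"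
  proof -
    define Y where "Y = \<tau> ^ (CARD('n) + 1)"
    have n: "CARD('n) + 2 = Suc (CARD('n) + 1)" "CARD('n) + 3 = Suc (Suc (CARD('n) + 1))" by simp_all
    have "\<tau> ^ (CARD('n) + 2) = Y * \<tau>" "\<tau> ^ (CARD('n) + 3) = Y * \<tau> * \<tau>" "Y \<noteq> 0"
      unfolding Y_def n power_Suc2 using \<tau> by auto
    moreover have "real (CARD('n) + 2) = real CARD('n) + 2" by simp
    ultimately show ?thesis
      unfolding ex Y_def[symmetric] using \<tau> by (simp add: field_simps)
  qed
  moreover have "cap_mean h z = (\<lambda>\<tau>. P2 \<tau> / \<tau> ^ (CARD('n) + 2))"
    by (simp add: fun_eq_iff cap_mean_def P2_def)
  ultimately show ?thesis by simp
qed

text \<open>The bound on the excess makes \<open>cap_mean h z \<tau> + k * \<tau> powr \<beta>\<close> nondecreasing in \<open>\<tau>\<close>.\<close>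

lemma cap_mean_le:
  fixes z :: "complex ^ 'n"
  assumes h: "integrable lborel h" and \<tau>: "0 < \<tau>" "\<tau> \<le> \<tau>0" and \<beta>: "0 < \<beta>"
    and ex: "\<And>s. 0 < s \<Longrightarrow> s < \<tau>0 \<Longrightarrow> excess h z s \<le> k * \<beta> * s ^ (CARD('n) + 2) * s powr \<beta>"
  shows "cap_mean h z \<tau> \<le> cap_mean h z \<tau>0 + k * \<tau>0 powr \<beta> - k * \<tau> powr \<beta>"
proof (cases "\<tau> = \<tau>0")
  case False
  define G where "G s = cap_mean h z s + k * s powr \<beta>" for s
  have D: "(G has_real_derivative (- excess h z s / s ^ (CARD('n) + 3) + k * (\<beta> * s powr (\<beta> - 1)))) (at s)" if "0 < s" for s
    unfolding G_def using that by (auto intro!: derivative_eq_intros cap_mean_has_derivative[OF h])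
  have "G \<tau> \<le> G \<tau>0"
  proof (rule DERIV_nonneg_imp_increasing_open[of \<tau> \<tau>0 G])
    show "\<tau> \<le> \<tau>0" by fact
    fix s assume s: "\<tau> < s" "s < \<tau>0"
    then have s0: "0 < s" using \<tau> by simp
    have "excess h z s / s ^ (CARD('n) + 3) \<le> k * \<beta> * s ^ (CARD('n) + 2) * s powr \<beta> / s ^ (CARD('n) + 3)"
      using ex[OF s0 s(2)] s0 by (intro divide_right_mono) auto
    also have "\<dots> = k * (\<beta> * s powr (\<beta> - 1))"
    proof -
      have "s powr \<beta> = s powr (\<beta> - 1) * s" using powr_diff[of s \<beta> 1] s0 by simp
      moreover have "s ^ (CARD('n) + 3) = s ^ (CARD('n) + 2) * s"
      proof -
        have "CARD('n) + 3 = Suc (CARD('n) + 2)" by simp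
        then show ?thesis by (simp only: power_Suc2)
      qed
      ultimately show ?thesis using s0 by simp
    qed
    finally show "\<exists>y. (G has_real_derivative y) (at s) \<and> 0 \<le> y"
      using D[OF s0] by (intro exI conjI) auto
  next
    show "continuous_on {\<tau>..\<tau>0} G"
    proof (intro continuous_at_imp_continuous_on ballI)
      fix s assume "s \<in> {\<tau>..\<tau>0}"
      then have "0 < s" using \<tau>(1) by simp
      then show "isCont G s" using D DERIV_isCont by blast
    qed
  qed
  then show ?thesis by (simp add: G_def)
qed simp

lemma measure_cball_scale:
  fixes z :: "complex ^ 'n"
  assumes "0 \<le> r"
  shows "measure lborel (cball z r) = measure lborel (cball (0::complex^'n) 1) * (r\<^sup>2) ^ CARD('n)"
  using assms content_cball[of r z] content_cball[of 1 "0::complex^'n"]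
  by (simp add: power_mult[symmetric] mult.commute)

lemma cap_square_le: "0 \<le> \<tau> \<Longrightarrow> (cap \<tau> z x)\<^sup>2 \<le> \<tau>\<^sup>2"
  by (intro power_mono cap_le) auto

lemma cap_mean_ge:
  fixes z :: "complex ^ 'n"
  assumes h: "integrable lborel h" "AE x in lborel. 0 \<le> h x" and r: "0 < r"
    and v: "0 \<le> v" "AE x in lborel. x \<in> cball z r \<longrightarrow> v \<le> h x"
  shows "v * measure lborel (cball (0::complex^'n) 1) / 2 ^ (CARD('n) + 2) \<le> cap_mean h z (2 * r\<^sup>2)"
proof -
  have i2: "integrable lborel (\<lambda>x. h x * (cap (2 * r\<^sup>2) z x)\<^sup>2)"
    using cap_square_le[of "2 * r\<^sup>2" z]
    by (intro integrable_mult_bounded[OF h(1), of _ "(2 * r\<^sup>2)\<^sup>2"]) simp_all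
  have "v * r ^ 4 * measure lborel (cball z r) = (LINT x|lborel. v * r ^ 4 * indicator (cball z r) x)"
    by simp
  also have "\<dots> \<le> (LINT x|lborel. h x * (cap (2 * r\<^sup>2) z x)\<^sup>2)"
  proof (rule integral_mono_AE[OF _ i2])
    show "integrable lborel (\<lambda>x. v * r ^ 4 * indicator (cball z r) x)"
      using emeasure_compact_finite[OF compact_cball, of z r] by auto
    show "AE x in lborel. v * r ^ 4 * indicator (cball z r) x \<le> h x * (cap (2 * r\<^sup>2) z x)\<^sup>2"
      using h(2) v(2)
    proof eventually_elim
      fix x assume hx: "0 \<le> h x" "x \<in> cball z r \<longrightarrow> v \<le> h x"
      show "v * r ^ 4 * indicator (cball z r) x \<le> h x * (cap (2 * r\<^sup>2) z x)\<^sup>2"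
      proof (cases "x \<in> cball z r")
        case True
        then have "(norm (x - z))\<^sup>2 \<le> r\<^sup>2" by (intro power_mono) (auto simp: dist_norm norm_minus_commute)
        then have "r\<^sup>2 \<le> cap (2 * r\<^sup>2) z x" unfolding cap_def by linarith
        then have "(r\<^sup>2)\<^sup>2 \<le> (cap (2 * r\<^sup>2) z x)\<^sup>2" by (intro power_mono) auto
        then have "r ^ 4 \<le> (cap (2 * r\<^sup>2) z x)\<^sup>2" by (simp add: power_mult[symmetric])
        then show ?thesis using True hx v(1) by (simp add: mult_mono)
      qed (use hx in simp)
    qed
  qed
  finally have "v * r ^ 4 * measure lborel (cball z r) / (2 * r\<^sup>2) ^ (CARD('n) + 2) \<le> cap_mean h z (2 * r\<^sup>2)"
    unfolding cap_mean_def by (intro divide_right_mono) auto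
  moreover have "v * r ^ 4 * measure lborel (cball z r) / (2 * r\<^sup>2) ^ (CARD('n) + 2)
      = v * measure lborel (cball (0::complex^'n) 1) / 2 ^ (CARD('n) + 2)"
  proof -
    define X where "X = (r\<^sup>2) ^ CARD('n)"
    have "(2 * r\<^sup>2) ^ (CARD('n) + 2) = 2 ^ (CARD('n) + 2) * (X * r ^ 4)"
      by (simp add: power_mult_distrib power_add X_def power_mult[symmetric])
    moreover have X0: "X * r ^ 4 \<noteq> 0" using r by (simp add: X_def)
    moreover have "v * r ^ 4 * measure lborel (cball z r) = (v * measure lborel (cball (0::complex^'n) 1)) * (X * r ^ 4)"
      using r by (simp only: measure_cball_scale[of r z, OF less_imp_le] X_def mult_ac)
    ultimately show ?thesis by (simp only: mult_divide_mult_cancel_right[OF X0])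
  qed
  ultimately show ?thesis by simp
qed

text \<open>The derivative of the weighted mean in \<open>\<tau>\<close> is controlled by the excess, and by upper
  semicontinuity the mean of \<open>p - u\<close> dominates \<open>p - u z\<close> in the limit \<open>\<tau> \<rightarrow> 0\<close>.\<close>

lemma psh_lower_bound_of_small_excess:
  fixes u :: "complex ^ 'n \<Rightarrow> ereal" and z :: "complex ^ 'n"
  assumes \<Omega>: "open \<Omega>" and u: "plurisubharmonic_on \<Omega> u" "u \<in> L1loc \<Omega>" and \<sigma>: "0 < \<sigma>" "cball z \<sigma> \<subseteq> \<Omega>"
    and p: "\<And>x. x \<in> cball z \<sigma> \<Longrightarrow> u x \<le> ereal p" and \<beta>: "0 < \<beta>" and k: "0 \<le> k"
    and ex: "\<And>s. 0 < s \<Longrightarrow> s < \<sigma>\<^sup>2 \<Longrightarrow>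
      excess (\<lambda>x. indicator (cball z \<sigma>) x * (p - rval u x)) z s \<le> k * \<beta> * s ^ (CARD('n) + 2) * s powr \<beta>"
    and A: "(LINT x:cball z \<sigma>|lborel. p - rval u x) / (\<sigma>\<^sup>2) ^ CARD('n) + k * (\<sigma>\<^sup>2) powr \<beta> \<le> A"
  shows "ereal (p - 2 ^ (CARD('n) + 2) / measure lborel (cball (0::complex^'n) 1) * A) \<le> u z"
proof (rule ccontr)
  define h where "h x = indicator (cball z \<sigma>) x * (p - rval u x)" for x
  define V where "V = measure lborel (cball (0::complex^'n) 1)"
  define y where "y = p - 2 ^ (CARD('n) + 2) / V * A"
  have V: "0 < V" unfolding V_def by (rule measure_cball_pos) simp
  have D: "AE x in lborel. x \<in> cball z \<sigma> \<longrightarrow> 0 \<le> p - rval u x" "set_integrable lborel (cball z \<sigma>) (\<lambda>x. p - rval u x)"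
    by (rule nn_integral_deficit(2)[OF \<Omega> u compact_cball \<sigma>(2)], erule p,
        rule nn_integral_deficit(3)[OF \<Omega> u compact_cball \<sigma>(2)], erule p)
  have h: "integrable lborel h" using D(2) unfolding set_integrable_def h_def by simp
  have h0: "AE x in lborel. 0 \<le> h x" using D(1) by eventually_elim (auto simp: h_def indicator_def)
  have hint: "(LINT x:cball z \<sigma>|lborel. p - rval u x) = (LINT x|lborel. h x)"
    unfolding set_lebesgue_integral_def h_def by simp
  have I0: "0 \<le> (LINT x|lborel. h x)" by (rule integral_nonneg_AE[OF h0])
  have A0: "0 \<le> A"
  proof -
    have "0 \<le> (LINT x|lborel. h x) / (\<sigma>\<^sup>2) ^ CARD('n) + k * (\<sigma>\<^sup>2) powr \<beta>" using I0 k by (intro add_nonneg_nonneg) auto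
    then show ?thesis using A unfolding hint by linarith
  qed
  assume "\<not> ereal (p - 2 ^ (CARD('n) + 2) / measure lborel (cball (0::complex^'n) 1) * A) \<le> u z"
  then have "u z < ereal y" unfolding y_def V_def by simp
  then obtain q where q: "u z < ereal q" "q < y" using ereal_dense2[of "u z" "ereal y"] by auto
  have "open {x \<in> \<Omega>. u x < ereal q}"
    using psh_usc[OF u(1)] \<Omega> unfolding usc_on_def by (blast intro: openin_open_trans)
  moreover have "z \<in> {x \<in> \<Omega>. u x < ereal q}" using q(1) \<sigma> by auto
  ultimately obtain \<delta> where \<delta>: "0 < \<delta>" "cball z \<delta> \<subseteq> {x \<in> \<Omega>. u x < ereal q}"
    using open_contains_cball by blast
  define r where "r = min \<delta> (\<sigma> / 2)"
  have r: "0 < r" "r \<le> \<delta>" "r \<le> \<sigma> / 2" using \<delta> \<sigma> by (auto simp: r_def)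
  have yp: "y \<le> p" unfolding y_def using A0 V by simp
  have r\<sigma>: "2 * r\<^sup>2 \<le> \<sigma>\<^sup>2"
  proof -
    have "r\<^sup>2 \<le> (\<sigma> / 2)\<^sup>2" using r by (intro power_mono) auto
    moreover have "(\<sigma> / 2)\<^sup>2 = \<sigma>\<^sup>2 / 4" by (simp add: power_divide)
    moreover have "0 \<le> \<sigma>\<^sup>2" by simp
    ultimately show ?thesis by linarith
  qed
  have fin: "AE x in lborel. x \<in> cball z \<sigma> \<longrightarrow> \<bar>u x\<bar> \<noteq> \<infinity>"
    by (rule psh_L1loc_integrable(1)[OF \<Omega> u compact_cball \<sigma>(2)])
  have "(p - q) * V / 2 ^ (CARD('n) + 2) \<le> cap_mean h z (2 * r\<^sup>2)"
    unfolding V_def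
  proof (rule cap_mean_ge[OF h h0 r(1)])
    show "0 \<le> p - q" using q yp by simp
    show "AE x in lborel. x \<in> cball z r \<longrightarrow> p - q \<le> h x"
      using fin
    proof eventually_elim
      fix x assume f: "x \<in> cball z \<sigma> \<longrightarrow> \<bar>u x\<bar> \<noteq> \<infinity>"
      show "x \<in> cball z r \<longrightarrow> p - q \<le> h x"
      proof
        assume "x \<in> cball z r"
        then have "x \<in> cball z \<sigma>" "x \<in> cball z \<delta>" using r \<sigma> by auto
        then show "p - q \<le> h x" using f \<delta>(2) by (cases "u x") (auto simp: h_def rval_def)
      qed
    qed
  qed
  also have "\<dots> \<le> cap_mean h z (\<sigma>\<^sup>2) + k * (\<sigma>\<^sup>2) powr \<beta> - k * (2 * r\<^sup>2) powr \<beta>"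
    by (rule cap_mean_le[OF h _ r\<sigma> \<beta>]) (use r ex in \<open>auto simp: h_def[abs_def]\<close>)
  also have "\<dots> \<le> cap_mean h z (\<sigma>\<^sup>2) + k * (\<sigma>\<^sup>2) powr \<beta>" using k by simp
  also have "cap_mean h z (\<sigma>\<^sup>2) \<le> (LINT x|lborel. h x) / (\<sigma>\<^sup>2) ^ CARD('n)"
  proof -
    have i2: "integrable lborel (\<lambda>x. h x * (cap (\<sigma>\<^sup>2) z x)\<^sup>2)"
      using cap_square_le[of "\<sigma>\<^sup>2" z]
      by (intro integrable_mult_bounded[OF h, of _ "(\<sigma>\<^sup>2)\<^sup>2"]) simp_all
    have "(LINT x|lborel. h x * (cap (\<sigma>\<^sup>2) z x)\<^sup>2) \<le> (LINT x|lborel. h x * (\<sigma>\<^sup>2)\<^sup>2)"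
      by (rule integral_mono_AE[OF i2 integrable_mult_left[OF h]])
         (use h0 in eventually_elim, intro mult_left_mono cap_square_le, simp_all)
    then have "cap_mean h z (\<sigma>\<^sup>2) \<le> (LINT x|lborel. h x) * (\<sigma>\<^sup>2)\<^sup>2 / (\<sigma>\<^sup>2) ^ (CARD('n) + 2)"
      unfolding cap_mean_def by (intro divide_right_mono) auto
    also have "\<dots> = (LINT x|lborel. h x) / (\<sigma>\<^sup>2) ^ CARD('n)" using \<sigma>(1) by (simp add: power_add)
    finally show ?thesis .
  qed
  finally have "(p - q) * V / 2 ^ (CARD('n) + 2) \<le> A" using A unfolding hint by linarith
  then have "(p - q) * V \<le> A * 2 ^ (CARD('n) + 2)" by (simp add: pos_divide_le_eq)
  then have "p - q \<le> 2 ^ (CARD('n) + 2) / V * A" using V by (simp add: field_simps)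
  then show False using q(2) unfolding y_def by linarith
qed

lemma circle_super_indicator: "circle_super (indicator L) L" for L :: "(complex ^ 'n) set"
  unfolding circle_super_def
proof (intro allI impI)
  fix a w :: "complex ^ 'n"
  assume *: "\<forall>\<zeta>. cmod \<zeta> \<le> 1 \<longrightarrow> a + \<zeta> *s w \<in> L"
  have "a \<in> L" using *[rule_format, of 0] by simp
  moreover have "a + cis \<theta> *s w \<in> L" for \<theta> using * by simp
  ultimately show "(\<integral>\<^sup>+\<theta>\<in>{0..2*pi}. indicator L (a + cis \<theta> *s w) \<partial>lborel) \<le> ennreal (2*pi) * indicator L a"
    by simp
qed

text \<open>Constants have nonnegative excess, so lowering the constant from which \<open>u\<close> is subtracted
  does not increase the excess.\<close>

lemma excess_deficit_mono:
  fixes u :: "complex ^ 'n \<Rightarrow> ereal" and z :: "complex ^ 'n"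
  assumes \<Omega>: "open \<Omega>" and u: "plurisubharmonic_on \<Omega> u" "u \<in> L1loc \<Omega>" and L: "compact L" "L \<subseteq> \<Omega>"
    and \<sigma>: "0 < \<sigma>" "cball z (2 * \<sigma>) \<subseteq> L" and \<tau>: "0 < \<tau>" "\<tau> < \<sigma>\<^sup>2"
    and B: "\<And>x. x \<in> L \<Longrightarrow> u x \<le> ereal B" and p: "p \<le> B"
  shows "excess (\<lambda>x. indicator (cball z \<sigma>) x * (p - rval u x)) z \<tau> \<le> excess (\<lambda>x. enn2real (deficit u B L x)) z \<tau>"
proof -
  define e where "e = cap_weight \<tau> z"
  define h where "h x = indicator (cball z \<sigma>) x * (p - rval u x)" for x
  define f where "f x = enn2real (deficit u B L x)" for x
  have \<sigma>L: "cball z \<sigma> \<subseteq> L" using \<sigma> subset_cball[of \<sigma> "2 * \<sigma>" z] by auto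
  have e0: "e x = 0" if "x \<notin> cball z \<sigma>" for x
  proof -
    have "\<sigma> < norm (x - z)" using that by (simp add: dist_norm norm_minus_commute)
    then have "\<sigma>\<^sup>2 < (norm (x - z))\<^sup>2" using \<sigma>(1) by (intro power_strict_mono) auto
    then show ?thesis using \<tau>(2) by (simp add: e_def cap_weight_def cap_def)
  qed
  have [measurable]: "e \<in> borel_measurable borel" unfolding e_def by measurable
  have eb: "\<bar>e x\<bar> \<le> (real CARD('n) + 2) * \<tau>\<^sup>2 + 2 * \<tau> * \<tau>" for x
    unfolding e_def using \<tau>(1) by (intro cap_weight_bounds) simp
  have Lm: "L \<in> sets borel" using L(1) by (simp add: borel_compact)
  have Lfin: "emeasure lborel L < \<infinity>" by (rule emeasure_compact_finite[OF L(1)])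
  have I1: "integrable lborel (\<lambda>x. indicator L x * e x)"
    by (rule integrable_mult_bounded[OF _ _ eb]) (use Lm Lfin in auto)
  have h: "integrable lborel h"
  proof -
    have "set_integrable lborel (cball z \<sigma>) (\<lambda>x. p - rval u x)"
      using psh_L1loc_integrable(2)[OF \<Omega> u compact_cball, of z \<sigma>] \<sigma>L L
        emeasure_compact_finite[OF compact_cball, of z \<sigma>]
      by (intro set_integral_diff) (auto simp: set_integrable_def)
    then show ?thesis unfolding set_integrable_def h_def by simp
  qed
  have Ih: "integrable lborel (\<lambda>x. h x * e x)" by (rule integrable_mult_bounded[OF h _ eb]) measurable
  have "0 \<le> (\<Sum>i\<in>{()}. 1 * excess (\<lambda>x. enn2real (indicator L x)) z \<tau>)"
  proof (rule excess_combination_nonneg[OF _ _ circle_super_indicator, where \<epsilon> = \<sigma>])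
    show "cball x \<sigma> \<subseteq> L" if "(norm (x - z))\<^sup>2 \<le> \<tau>" for x
    proof -
      have "(norm (x - z))\<^sup>2 \<le> \<sigma>\<^sup>2" using that \<tau> by linarith
      then have "norm (x - z) \<le> \<sigma>" by (rule power2_le_imp_le) (use \<sigma> in simp)
      then have "cball x \<sigma> \<subseteq> cball z (2 * \<sigma>)"
        by (intro cball_subset_cball_iff[THEN iffD2] disjI1) (simp add: dist_norm)
      then show ?thesis using \<sigma> by blast
    qed
  qed (use \<tau> \<sigma> Lm Lfin L in \<open>auto simp: compact_imp_bounded\<close>)
  then have E1: "0 \<le> (LINT x|lborel. indicator L x * e x)"
  proof -
    have "enn2real (indicator L x) = indicator L x" for x by (simp add: indicator_def)
    then show ?thesis using \<open>0 \<le> (\<Sum>i\<in>{()}. 1 * excess (\<lambda>x. enn2real (indicator L x)) z \<tau>)\<close>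
      by (simp add: excess_def e_def)
  qed
  have "excess f z \<tau> = (LINT x|lborel. h x * e x + (B - p) * (indicator L x * e x))"
    unfolding excess_def e_def[symmetric]
  proof (rule integral_cong_AE)
    show "AE x in lborel. f x * e x = h x * e x + (B - p) * (indicator L x * e x)"
      using psh_L1loc_integrable(1)[OF \<Omega> u L]
    proof eventually_elim
      fix x assume fx: "x \<in> L \<longrightarrow> \<bar>u x\<bar> \<noteq> \<infinity>"
      show "f x * e x = h x * e x + (B - p) * (indicator L x * e x)"
      proof (cases "x \<in> cball z \<sigma>")
        case True
        then have xL: "x \<in> L" using \<sigma>L by blast
        have "f x = B - rval u x"
          using xL fx B[OF xL] by (cases "u x") (auto simp: f_def deficit_def rval_def)
        moreover have "(B - rval u x) * e x = (p - rval u x) * e x + (B - p) * e x" by (simp add: algebra_simps)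
        ultimately show ?thesis using True xL by (simp add: h_def)
      qed (simp add: e0)
    qed
    show "(\<lambda>x. f x * e x) \<in> borel_measurable lborel"
      using deficit_borel_measurable[OF \<Omega> u(1) L(2) Lm, of B] unfolding f_def by measurable
    show "(\<lambda>x. h x * e x + (B - p) * (indicator L x * e x)) \<in> borel_measurable lborel"
      using Ih I1 by measurable
  qed
  also have "\<dots> = excess h z \<tau> + (B - p) * (LINT x|lborel. indicator L x * e x)"
    unfolding excess_def e_def[symmetric] using Ih I1 by simp
  finally show ?thesis using E1 p unfolding f_def h_def by simp
qed

section \<open>The exceptional balls\<close>

lemma compact_neighbourhood:
  fixes K :: "(complex ^ 'n) set"
  assumes "open \<Omega>" "compact K" "K \<subseteq> \<Omega>"
  obtains R where "0 < R" "compact {x + y | x y. x \<in> K \<and> y \<in> cball 0 (4 * R)}"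
    "{x + y | x y. x \<in> K \<and> y \<in> cball 0 (4 * R)} \<subseteq> \<Omega>"
proof -
  obtain e where e: "0 < e" "\<And>x. x \<in> K \<Longrightarrow> ball x e \<subseteq> \<Omega>"
  proof (cases "K = {}")
    case False
    show ?thesis
    proof (cases "\<Omega> = UNIV")
      case True
      then show ?thesis using that[of 1] by simp
    next
      case F: False
      have ne: "- \<Omega> \<noteq> {}" using F by auto
      have "setdist K (- \<Omega>) > 0"
        using assms False ne setdist_gt_0_compact_closed[of K "- \<Omega>"] by auto
      moreover have "ball x (setdist K (- \<Omega>)) \<subseteq> \<Omega>" if "x \<in> K" for x
      proof
        fix y assume y: "y \<in> ball x (setdist K (- \<Omega>))"
        show "y \<in> \<Omega>"
        proof (rule ccontr)
          assume "y \<notin> \<Omega>"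
          then have "setdist K (- \<Omega>) \<le> dist x y" using that by (intro setdist_le_dist) auto
          then show False using y by simp
        qed
      qed
      ultimately show ?thesis using that by blast
    qed
  qed (use that[of 1] in simp)
  define R where "R = e / 8"
  have "compact {x + y | x y. x \<in> K \<and> y \<in> cball 0 (4 * R)}"
    by (intro compact_sums assms compact_cball)
  moreover have "{x + y | x y. x \<in> K \<and> y \<in> cball 0 (4 * R)} \<subseteq> \<Omega>"
  proof clarify
    fix x y :: "complex^'n" assume "x \<in> K" "y \<in> cball 0 (4 * R)"
    then have "x + y \<in> ball x e" using e(1) by (simp add: dist_norm R_def)
    then show "x + y \<in> \<Omega>" using e(2) \<open>x \<in> K\<close> by blast
  qed
  ultimately show ?thesis using that[of R] e(1) by (simp add: R_def)
qed

text \<open>The disjoint balls of a Vitali selection, enlarged five times, cover the bad points. Their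
  normalised excess \<open>g\<close> sums to at most \<open>M\<close>, while badness bounds it below by a power of the radius.
  The enlargement costs a factor \<open>5 powr (2 * n - 2 + \<alpha>) \<le> 25 ^ n\<close>, which the threshold compensates.\<close>

lemma exceptional_balls:
  fixes bad :: "complex ^ 'n \<Rightarrow> real \<Rightarrow> bool" and g :: "complex ^ 'n \<Rightarrow> real \<Rightarrow> real"
  assumes \<sigma>: "0 < \<sigma>" and \<alpha>: "0 < \<alpha>" "\<alpha> \<le> 2" and M: "0 \<le> M"
    and bad: "\<And>z t. bad z t \<Longrightarrow> 0 < t \<and> t < \<sigma> \<and> 4 * 25 ^ CARD('n) * (M + 1) * \<alpha> * t powr (2 * real CARD('n) - 2 + \<alpha>) \<le> \<sigma> powr \<alpha> * g z t"
    and mass: "\<And>J t. finite J \<Longrightarrow> (\<And>z. z \<in> J \<Longrightarrow> z \<in> K \<and> bad z (t z)) \<Longrightarrow>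
        pairwise (\<lambda>y z. disjnt (cball y (t y)) (cball z (t z))) J \<Longrightarrow> (\<Sum>z\<in>J. g z (t z)) \<le> M"
  obtains J :: "nat set" and c :: "nat \<Rightarrow> complex ^ 'n" and r :: "nat \<Rightarrow> real" where
    "\<And>j. j \<in> J \<Longrightarrow> 0 < r j \<and> r j < 5 * \<sigma>"
    "(\<lambda>j. r j powr (2 * real CARD('n) - 2 + \<alpha>)) summable_on J"
    "(\<Sum>\<^sub>\<infinity>j\<in>J. r j powr (2 * real CARD('n) - 2 + \<alpha>)) \<le> \<sigma> powr \<alpha> / \<alpha> / 4"
    "\<And>z t. z \<in> K \<Longrightarrow> bad z t \<Longrightarrow> z \<in> (\<Union>j\<in>J. ball (c j) (r j))"
proof -
  define s where "s = 2 * real CARD('n) - 2 + \<alpha>"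
  define Z where "Z = {z \<in> K. \<exists>t. bad z t}"
  define t where "t z = (SOME t. bad z t)" for z
  have t: "bad z (t z)" if "z \<in> Z" for z using that unfolding Z_def t_def by (auto intro: someI_ex)
  have n1: "1 \<le> real CARD('n)" by (simp add: Suc_le_eq)
  have s: "0 \<le> s" "s \<le> 2 * real CARD('n)" using \<alpha> n1 by (auto simp: s_def)
  have tb: "0 < t z \<and> t z \<le> \<sigma>" if "z \<in> Z" for z using bad[OF t[OF that]] by auto
  obtain C where C: "countable C" "C \<subseteq> Z"
    "pairwise (\<lambda>i j. disjnt (cball i (t i)) (cball j (t j))) C"
    "\<And>i. i \<in> Z \<Longrightarrow> \<exists>j. j \<in> C \<and> \<not> disjnt (cball i (t i)) (cball j (t j)) \<and> cball i (t i) \<subseteq> ball j (5 * t j)"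
    using Vitali_covering_lemma_cballs_balls[of Z t \<sigma> "\<lambda>z. z"] tb by blast
  have fin: "(\<Sum>z\<in>F. (5 * t z) powr s) \<le> \<sigma> powr \<alpha> / \<alpha> / 4" if F: "finite F" "F \<subseteq> C" for F
  proof -
    have "4 * (M + 1) * \<alpha> * (5 * t z) powr s \<le> \<sigma> powr \<alpha> * g z (t z)" if "z \<in> F" for z
    proof -
      have zZ: "z \<in> Z" using that F C by blast
      have "(5::real) powr s \<le> 5 powr (2 * real CARD('n))" using s by simp
      also have "5 powr (2 * real CARD('n)) = (25::real) ^ CARD('n)"
        by (simp add: powr_powr[symmetric] powr_realpow)
      finally have "(5 * t z) powr s \<le> 25 ^ CARD('n) * t z powr s"
        using tb[OF zZ] by (simp add: powr_mult mult_right_mono)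
      then have "4 * (M + 1) * \<alpha> * (5 * t z) powr s \<le> 4 * (M + 1) * \<alpha> * (25 ^ CARD('n) * t z powr s)"
        using M \<alpha> by (intro mult_left_mono) auto
      also have "\<dots> = 4 * 25 ^ CARD('n) * (M + 1) * \<alpha> * t z powr s" by (simp add: mult_ac)
      also have "\<dots> \<le> \<sigma> powr \<alpha> * g z (t z)" using bad[OF t[OF zZ]] by (simp add: s_def)
      finally show ?thesis .
    qed
    then have "(\<Sum>z\<in>F. 4 * (M + 1) * \<alpha> * (5 * t z) powr s) \<le> (\<Sum>z\<in>F. \<sigma> powr \<alpha> * g z (t z))"
      by (rule sum_mono)
    then have "4 * (M + 1) * \<alpha> * (\<Sum>z\<in>F. (5 * t z) powr s) \<le> \<sigma> powr \<alpha> * (\<Sum>z\<in>F. g z (t z))"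
      by (simp add: sum_distrib_left)
    also have "\<dots> \<le> \<sigma> powr \<alpha> * M"
    proof (intro mult_left_mono mass F)
      show "z \<in> K \<and> bad z (t z)" if "z \<in> F" for z
        using t[of z] that F C(2) by (auto simp: Z_def)
      show "pairwise (\<lambda>y z. disjnt (cball y (t y)) (cball z (t z))) F"
        using C(3) F(2) by (rule pairwise_subset)
    qed simp
    also have "\<dots> \<le> \<sigma> powr \<alpha> * (M + 1)" by (intro mult_left_mono) auto
    finally have "(M + 1) * (4 * \<alpha> * (\<Sum>z\<in>F. (5 * t z) powr s)) \<le> (M + 1) * \<sigma> powr \<alpha>" by (simp only: mult_ac)
    then have "4 * \<alpha> * (\<Sum>z\<in>F. (5 * t z) powr s) \<le> \<sigma> powr \<alpha>"
      using M by (simp only: mult_le_cancel_left_pos)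
    then show ?thesis using \<alpha> by (simp add: field_simps)
  qed
  define e where "e = to_nat_on C"
  have e: "inj_on e C" unfolding e_def by (rule inj_on_to_nat_on[OF C(1)])
  define c where "c = inv_into C e"
  define r where "r j = 5 * t (c j)" for j
  define J where "J = e ` C"
  have cJ: "c j \<in> C" if "j \<in> J" for j using that unfolding c_def J_def by (rule inv_into_into)
  have ce: "c (e z) = z" if "z \<in> C" for z unfolding c_def using e that by (rule inv_into_f_f)
  have finJ: "(\<Sum>j\<in>F. r j powr s) \<le> \<sigma> powr \<alpha> / \<alpha> / 4" if F: "finite F" "F \<subseteq> J" for F
  proof -
    have "inj_on c F" unfolding c_def using F(2) unfolding J_def by (rule inj_on_inv_into)
    then have "(\<Sum>j\<in>F. r j powr s) = (\<Sum>z\<in>c ` F. (5 * t z) powr s)"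
      by (simp add: sum.reindex r_def)
    also have "\<dots> \<le> \<sigma> powr \<alpha> / \<alpha> / 4" using F cJ by (intro fin) auto
    finally show ?thesis .
  qed
  have summ: "(\<lambda>j. r j powr s) summable_on J"
    by (rule nonneg_bdd_above_summable_on) (use finJ in \<open>auto intro!: bdd_aboveI\<close>)
  show ?thesis
  proof (rule that[of J r c])
    show "0 < r j \<and> r j < 5 * \<sigma>" if "j \<in> J" for j
    proof -
      have "c j \<in> Z" using cJ[OF that] C(2) by blast
      then show ?thesis using bad[OF t[of "c j"]] by (simp add: r_def)
    qed
    show "(\<lambda>j. r j powr (2 * real CARD('n) - 2 + \<alpha>)) summable_on J" using summ unfolding s_def .
    show "(\<Sum>\<^sub>\<infinity>j\<in>J. r j powr (2 * real CARD('n) - 2 + \<alpha>)) \<le> \<sigma> powr \<alpha> / \<alpha> / 4"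
      unfolding s_def[symmetric] by (rule infsum_le_finite_sums[OF summ finJ])
    show "z \<in> (\<Union>j\<in>J. ball (c j) (r j))" if "z \<in> K" "bad z t'" for z t'
    proof -
      have zZ: "z \<in> Z" using that by (auto simp: Z_def)
      then obtain j where j: "j \<in> C" "cball z (t z) \<subseteq> ball j (5 * t j)" using C(4) by blast
      then have "z \<in> ball j (5 * t j)" using tb[OF zZ] by (auto simp: subset_iff)
      then have "z \<in> ball (c (e j)) (r (e j))" using ce[OF j(1)] by (simp add: r_def)
      then show ?thesis using j(1) unfolding J_def by blast
    qed
  qed
qed


section \<open>The sublevel estimate\<close>

text \<open>A point outside the balls has small excess at all radii \<open>t = sqrt s < \<sigma>\<close>: the threshold
  \<open>t ^ 6 * t powr (2 * n - 2 + \<alpha>)\<close> equals \<open>s ^ (n + 2) * s powr (\<alpha> / 2)\<close>, which is the form required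
  by the pointwise bound with exponent \<open>\<beta> = \<alpha> / 2\<close>. There \<open>p - u\<close>, with \<open>p\<close> the supremum over the ball
  of radius \<open>2 * \<sigma>\<close>, is used instead of \<open>B - u\<close>, so that its mean is bounded independently of \<open>\<sigma>\<close>.\<close>

lemma psh_lower_bound_outside_balls:
  fixes u :: "complex ^ 'n \<Rightarrow> ereal" and K L :: "(complex ^ 'n) set"
  assumes \<Omega>: "open \<Omega>" and u: "plurisubharmonic_on \<Omega> u" "u \<in> L1loc \<Omega>" and L: "compact L" "L \<subseteq> \<Omega>"
    and B: "\<And>x. x \<in> L \<Longrightarrow> u x \<le> ereal B" and \<sigma>: "0 < \<sigma>" and K: "\<And>z. z \<in> K \<Longrightarrow> cball z (2 * \<sigma>) \<subseteq> L"
    and S: "\<And>z. z \<in> K \<Longrightarrow> ball_sup u z (2 * \<sigma>) - ball_sup u z (\<sigma> / 2) \<le> S"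
    and \<alpha>: "0 < \<alpha>" "\<alpha> \<le> 2" and M: "0 \<le> M"
    and mass: "\<And>J t. finite J \<Longrightarrow> J \<subseteq> K \<Longrightarrow> (\<And>z. z \<in> J \<Longrightarrow> 0 < t z \<and> t z < \<sigma>) \<Longrightarrow>
        pairwise (\<lambda>y z. disjnt (cball y (t y)) (cball z (t z))) J \<Longrightarrow>
        (\<Sum>z\<in>J. excess (\<lambda>x. enn2real (deficit u B L x)) z ((t z)\<^sup>2) / t z ^ 6) \<le> M"
  defines "V \<equiv> measure lborel (cball (0::complex^'n) 1)"
  obtains J :: "nat set" and c :: "nat \<Rightarrow> complex ^ 'n" and r :: "nat \<Rightarrow> real" where
    "\<And>j. j \<in> J \<Longrightarrow> 0 < r j \<and> r j < 5 * \<sigma>"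
    "(\<lambda>j. r j powr (2 * real CARD('n) - 2 + \<alpha>)) summable_on J"
    "(\<Sum>\<^sub>\<infinity>j\<in>J. r j powr (2 * real CARD('n) - 2 + \<alpha>)) \<le> \<sigma> powr \<alpha> / \<alpha> / 4"
    "\<And>z. z \<in> K - (\<Union>j\<in>J. ball (c j) (r j)) \<Longrightarrow>
      ereal (ball_sup u z (2 * \<sigma>) - 2 ^ (CARD('n) + 2) / V * (V * (9 / 4) ^ CARD('n) * (S + 1) + 8 * 25 ^ CARD('n) * (M + 1))) \<le> u z"
proof -
  define f where "f x = enn2real (deficit u B L x)" for x
  define bad where "bad z t \<longleftrightarrow> 0 < t \<and> t < \<sigma> \<and>
    4 * 25 ^ CARD('n) * (M + 1) * \<alpha> * t powr (2 * real CARD('n) - 2 + \<alpha>) \<le> \<sigma> powr \<alpha> * (excess f z (t\<^sup>2) / t ^ 6)" for z t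
  obtain J :: "nat set" and c :: "nat \<Rightarrow> complex ^ 'n" and r :: "nat \<Rightarrow> real" where J:
    "\<And>j. j \<in> J \<Longrightarrow> 0 < r j \<and> r j < 5 * \<sigma>"
    "(\<lambda>j. r j powr (2 * real CARD('n) - 2 + \<alpha>)) summable_on J"
    "(\<Sum>\<^sub>\<infinity>j\<in>J. r j powr (2 * real CARD('n) - 2 + \<alpha>)) \<le> \<sigma> powr \<alpha> / \<alpha> / 4"
    and bJ: "\<And>z t. z \<in> K \<Longrightarrow> bad z t \<Longrightarrow> z \<in> (\<Union>j\<in>J. ball (c j) (r j))"
  proof (rule exceptional_balls[where bad = bad and g = "\<lambda>z t. excess f z (t\<^sup>2) / t ^ 6" and K = K, OF \<sigma> \<alpha> M])
    show "0 < t \<and> t < \<sigma> \<and> 4 * 25 ^ CARD('n) * (M + 1) * \<alpha> * t powr (2 * real CARD('n) - 2 + \<alpha>) \<le> \<sigma> powr \<alpha> * (excess f z (t\<^sup>2) / t ^ 6)"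
      if "bad z t" for z t using that unfolding bad_def .
    show "(\<Sum>z\<in>J. excess f z ((t z)\<^sup>2) / t z ^ 6) \<le> M"
      if "finite J" "\<And>z. z \<in> J \<Longrightarrow> z \<in> K \<and> bad z (t z)" "pairwise (\<lambda>y z. disjnt (cball y (t y)) (cball z (t z))) J" for J t
      unfolding f_def using that by (intro mass) (auto simp: bad_def)
  qed (use that in blast)
  show ?thesis
  proof (rule that[OF J])
    fix z assume z: "z \<in> K - (\<Union>j\<in>J. ball (c j) (r j))"
    then have zK: "z \<in> K" and good: "\<not> bad z t" for t using bJ by blast+
    define p where "p = ball_sup u z (2 * \<sigma>)"
    define k where "k = 8 * 25 ^ CARD('n) * (M + 1) / \<sigma> powr \<alpha>"
    have k0: "0 \<le> k" using M by (simp add: k_def)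
    have s2: "0 < 2 * \<sigma>" "0 < \<sigma> / 2" using \<sigma> by auto
    have zL: "cball z (2 * \<sigma>) \<subseteq> L" by (rule K[OF zK])
    have z\<Omega>: "cball z (2 * \<sigma>) \<subseteq> \<Omega>" using zL L by blast
    have sub: "cball z \<sigma> \<subseteq> cball z (2 * \<sigma>)" using \<sigma> by (intro subset_cball) simp
    have up: "u x \<le> ereal p" if "x \<in> cball z \<sigma>" for x
      unfolding p_def using that sub by (intro ball_sup_upper[OF \<Omega> u s2(1) z\<Omega>]) blast
    have pB: "p \<le> B" unfolding p_def using B zL by (intro ball_sup_le[OF \<Omega> u s2(1) z\<Omega>]) blast
    have ex: "excess (\<lambda>x. indicator (cball z \<sigma>) x * (p - rval u x)) z s \<le> k * (\<alpha> / 2) * s ^ (CARD('n) + 2) * s powr (\<alpha> / 2)"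
      if s: "0 < s" "s < \<sigma>\<^sup>2" for s
    proof -
      define t where "t = sqrt s"
      have st: "s = t\<^sup>2" "0 < t" using s by (auto simp: t_def)
      have "t < \<sigma>" using s(2) st \<sigma> by (metis less_imp_le power2_less_imp_less)
      then have "\<sigma> powr \<alpha> * (excess f z (t\<^sup>2) / t ^ 6) < 4 * 25 ^ CARD('n) * (M + 1) * \<alpha> * t powr (2 * real CARD('n) - 2 + \<alpha>)"
        using good[of t] st unfolding bad_def by auto
      then have "excess f z s \<le> 4 * 25 ^ CARD('n) * (M + 1) * \<alpha> * t powr (2 * real CARD('n) - 2 + \<alpha>) * t ^ 6 / \<sigma> powr \<alpha>"
        using st \<sigma> by (simp add: field_simps)
      also have "\<dots> = k * (\<alpha> / 2) * (t powr (2 * real CARD('n) - 2 + \<alpha>) * t ^ 6)"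
        by (simp add: k_def)
      also have "t powr (2 * real CARD('n) - 2 + \<alpha>) * t ^ 6 = s ^ (CARD('n) + 2) * s powr (\<alpha> / 2)"
      proof -
        have "t powr (2 * real CARD('n) - 2 + \<alpha>) * t ^ 6 = t powr (2 * real CARD('n) - 2 + \<alpha>) * t powr 6"
          using st(2) by simp
        also have "\<dots> = t powr (2 * real (CARD('n) + 2)) * t powr (2 * (\<alpha> / 2))"
          unfolding powr_add[symmetric] by (simp add: algebra_simps)
        also have "\<dots> = (t powr 2) powr (real (CARD('n) + 2)) * (t powr 2) powr (\<alpha> / 2)"
          unfolding powr_powr ..
        also have "t powr 2 = s" using st by simp
        also have "s powr (real (CARD('n) + 2)) = s ^ (CARD('n) + 2)" using s by (rule_tac powr_realpow)
        finally show ?thesis .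
      qed
      finally have "excess f z s \<le> k * (\<alpha> / 2) * s ^ (CARD('n) + 2) * s powr (\<alpha> / 2)" by (simp only: mult.assoc)
      moreover have "excess (\<lambda>x. indicator (cball z \<sigma>) x * (p - rval u x)) z s \<le> excess f z s"
        unfolding f_def by (rule excess_deficit_mono[OF \<Omega> u L \<sigma> zL s B pB])
      ultimately show ?thesis by linarith
    qed
    have A: "(LINT x:cball z \<sigma>|lborel. p - rval u x) / (\<sigma>\<^sup>2) ^ CARD('n) + k * (\<sigma>\<^sup>2) powr (\<alpha> / 2)
        \<le> V * (9 / 4) ^ CARD('n) * (S + 1) + 8 * 25 ^ CARD('n) * (M + 1)"
    proof (rule add_mono)
      have "(LINT x:cball z (2 * (\<sigma> / 2))|lborel. ball_sup u z (4 * (\<sigma> / 2)) - rval u x)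
        \<le> measure lborel (cball (0::complex^'n) (3 * (\<sigma> / 2))) * (ball_sup u z (4 * (\<sigma> / 2)) - ball_sup u z (\<sigma> / 2) + 1)"
        by (rule psh_mean_oscillation[OF \<Omega> u s2(2)]) (use z\<Omega> in simp)
      then have "(LINT x:cball z \<sigma>|lborel. p - rval u x) \<le> measure lborel (cball (0::complex^'n) (3 / 2 * \<sigma>)) * (p - ball_sup u z (\<sigma> / 2) + 1)"
        by (simp add: p_def)
      also have "\<dots> \<le> measure lborel (cball (0::complex^'n) (3 / 2 * \<sigma>)) * (S + 1)"
        using S[OF zK] by (intro mult_left_mono) (auto simp: p_def)
      also have "measure lborel (cball (0::complex^'n) (3 / 2 * \<sigma>)) = V * ((9 / 4) ^ CARD('n) * (\<sigma>\<^sup>2) ^ CARD('n))"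
      proof -
        have "measure lborel (cball (0::complex^'n) (3 / 2 * \<sigma>)) = V * ((3 / 2 * \<sigma>)\<^sup>2) ^ CARD('n)"
          unfolding V_def using \<sigma> by (intro measure_cball_scale) simp
        also have "(3 / 2 * \<sigma>)\<^sup>2 = 9 / 4 * \<sigma>\<^sup>2" unfolding power_mult_distrib by (simp add: power2_eq_square)
        finally show ?thesis by (simp only: power_mult_distrib)
      qed
      finally have "(LINT x:cball z \<sigma>|lborel. p - rval u x) \<le> V * (9 / 4) ^ CARD('n) * (S + 1) * (\<sigma>\<^sup>2) ^ CARD('n)"
        by (simp only: mult_ac)
      then show "(LINT x:cball z \<sigma>|lborel. p - rval u x) / (\<sigma>\<^sup>2) ^ CARD('n) \<le> V * (9 / 4) ^ CARD('n) * (S + 1)"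
        using \<sigma> by (simp add: pos_divide_le_eq)
      have "(\<sigma>\<^sup>2) powr (\<alpha> / 2) = \<sigma> powr \<alpha>"
      proof -
        have "(\<sigma> powr 2) powr (\<alpha> / 2) = \<sigma> powr \<alpha>" unfolding powr_powr by simp
        then show ?thesis using \<sigma> by simp
      qed
      then show "k * (\<sigma>\<^sup>2) powr (\<alpha> / 2) \<le> 8 * 25 ^ CARD('n) * (M + 1)" using \<sigma> by (simp add: k_def)
    qed
    have "cball z \<sigma> \<subseteq> \<Omega>" using sub z\<Omega> by blast
    from psh_lower_bound_of_small_excess[OF \<Omega> u \<sigma> this up _ k0 ex A, folded V_def]
    show "ereal (ball_sup u z (2 * \<sigma>) - 2 ^ (CARD('n) + 2) / V * (V * (9 / 4) ^ CARD('n) * (S + 1) + 8 * 25 ^ CARD('n) * (M + 1))) \<le> u z"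
      using \<alpha> by (simp add: p_def)
  qed
qed

lemma deficit_integral_bound:
  fixes u :: "complex ^ 'n \<Rightarrow> ereal"
  assumes \<Omega>: "open \<Omega>" and u: "plurisubharmonic_on \<Omega> u" "u \<in> L1loc \<Omega>" and L: "compact L" "L \<subseteq> \<Omega>"
    and B: "\<And>x. x \<in> L \<Longrightarrow> u x \<le> ereal B" and M: "(LINT x:L|lborel. \<bar>rval u x\<bar>) \<le> M"
  shows "(\<integral>\<^sup>+x. deficit u B L x \<partial>lborel) < \<infinity>"
    and "(LINT x|lborel. enn2real (deficit u B L x)) \<le> B * measure lborel L + M"
proof -
  have Lm: "L \<in> sets borel" using L(1) by (simp add: borel_compact)
  have nn: "(\<integral>\<^sup>+x. deficit u B L x \<partial>lborel) = ennreal (LINT x:L|lborel. B - rval u x)"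
  proof -
    have "(\<integral>\<^sup>+x. deficit u B L x \<partial>lborel) = (\<integral>\<^sup>+x\<in>L. e2ennreal (ereal B - u x) \<partial>lborel)"
      by (intro nn_integral_cong) (auto simp: deficit_def indicator_def)
    also have "\<dots> = ennreal (LINT x:L|lborel. B - rval u x)"
      by (rule nn_integral_deficit(1)[OF \<Omega> u L]) (rule B)
    finally show ?thesis .
  qed
  then show "(\<integral>\<^sup>+x. deficit u B L x \<partial>lborel) < \<infinity>" by simp
  have I: "set_integrable lborel L (rval u)" by (rule psh_L1loc_integrable(2)[OF \<Omega> u L])
  have Ib: "set_integrable lborel L (\<lambda>_. B)"
    using emeasure_compact_finite[OF L(1)] Lm by (auto simp: set_integrable_def)
  have "(LINT x|lborel. enn2real (deficit u B L x)) = (LINT x:L|lborel. B - rval u x)"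
    unfolding set_lebesgue_integral_def
  proof (rule integral_cong_AE)
    show "AE x in lborel. enn2real (deficit u B L x) = indicator L x *\<^sub>R (B - rval u x)"
      using psh_L1loc_integrable(1)[OF \<Omega> u L]
    proof eventually_elim
      fix x assume "x \<in> L \<longrightarrow> \<bar>u x\<bar> \<noteq> \<infinity>"
      then show "enn2real (deficit u B L x) = indicator L x *\<^sub>R (B - rval u x)"
        using B[of x] by (cases "u x") (auto simp: deficit_def rval_def)
    qed
    show "(\<lambda>x. enn2real (deficit u B L x)) \<in> borel_measurable lborel"
      using deficit_borel_measurable[OF \<Omega> u(1) L(2) Lm, of B] by measurable
    show "(\<lambda>x. indicator L x *\<^sub>R (B - rval u x)) \<in> borel_measurable lborel"
      using set_integral_diff(1)[OF Ib I] by (auto simp: set_integrable_def)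
  qed
  also have "\<dots> \<le> (LINT x:L|lborel. B + \<bar>rval u x\<bar>)"
    by (intro set_integral_mono set_integral_diff set_integral_add set_integrable_abs I Ib) auto
  also have "\<dots> = B * measure lborel L + (LINT x:L|lborel. \<bar>rval u x\<bar>)"
    using set_integral_add(2)[OF Ib set_integrable_abs[OF I]] by (simp add: set_lebesgue_integral_def)
  finally show "(LINT x|lborel. enn2real (deficit u B L x)) \<le> B * measure lborel L + M" using M by simp
qed

definition exceptional_cover :: "(complex ^ 'n) set \<Rightarrow> (complex ^ 'n \<Rightarrow> ereal) \<Rightarrow> real \<Rightarrow> real \<Rightarrow> real \<Rightarrow> real \<Rightarrow> bool" where
  "exceptional_cover K u \<nu> C \<eta> \<alpha> \<longleftrightarrow> (\<exists>(J :: nat set) c r.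
     (\<forall>j\<in>J. 0 < r j \<and> r j < \<eta>) \<and>
     (\<lambda>j. r j powr (2 * real CARD('n) - 2 + \<alpha>)) summable_on J \<and>
     (\<Sum>\<^sub>\<infinity>j\<in>J. r j powr (2 * real CARD('n) - 2 + \<alpha>)) < 9 ^ (CARD('n) - 1) * \<eta> powr \<alpha> / \<alpha> \<and>
     (\<forall>z \<in> K - (\<Union>j\<in>J. ball (c j) (r j)). ereal (- \<nu> * ln (C / \<eta>)) \<le> u z))"

text \<open>The radii \<open>R\<close>, \<open>3 * R\<close> and \<open>4 * R\<close> leave room for two steps: the uniform \<open>L\<^sup>1\<close>-bound on the
  \<open>4 * R\<close>-neighbourhood of \<open>K\<close> bounds every \<open>u\<close> from above on the \<open>3 * R\<close>-neighbourhood \<open>L\<close>, and the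
  excess is computed with the deficit on \<open>L\<close>. Balls are selected at radii below \<open>\<sigma> = \<eta> / 5\<close>, as they are
  enlarged five times. The final constant \<open>C = exp (D / \<nu>)\<close> turns the additive loss \<open>D\<close> into the
  required form; this needs \<open>\<nu> > 0\<close>, which follows from Lelong numbers being nonnegative unless \<open>U\<close> or
  \<open>K\<close> is empty.\<close>

lemma sublevel_cover:
  fixes \<Omega> K :: "(complex ^ 'n) set"
  assumes "open \<Omega>" "compact K" "K \<subseteq> \<Omega>" and U: "U \<subseteq> PSH \<Omega>" "compactin (L1loc_topology \<Omega>) U"
  defines "\<theta> \<equiv> Sup {lelong_number u z | u z. u \<in> U \<and> z \<in> K}"
  shows "\<theta> < \<infinity> \<and> (\<forall>\<nu>::real. \<theta> < ereal \<nu> \<longrightarrow> (\<exists>C>0. \<exists>\<eta>0. 0 < \<eta>0 \<and> \<eta>0 < 1 \<and>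
    (\<forall>\<eta> \<alpha>. \<forall>u\<in>U. 0 < \<eta> \<and> \<eta> \<le> \<eta>0 \<and> 0 < \<alpha> \<and> \<alpha> \<le> 2 \<longrightarrow> exceptional_cover K u \<nu> C \<eta> \<alpha>)))"
proof -
  have psh: "plurisubharmonic_on \<Omega> u" "u \<in> L1loc \<Omega>" if "u \<in> U" for u
    using that U(1) compactin_L1loc_subset[OF U(2)] by (auto simp: PSH_def)
  show ?thesis
  proof (cases "U = {} \<or> K = {}")
    case True
    then have "{lelong_number u z | u z. u \<in> U \<and> z \<in> K} = {}" by auto
    then have "\<theta> = -\<infinity>" unfolding \<theta>_def by (metis Sup_empty bot_ereal_def)
    moreover have "exceptional_cover K u \<nu> C \<eta> \<alpha>" if "u \<in> U" "0 < \<eta>" "0 < \<alpha>" for \<nu> C \<eta> \<alpha> u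
    proof -
      have "K = {}" using True that by auto
      then show ?thesis unfolding exceptional_cover_def using that by (intro exI[of _ "{}"]) auto
    qed
    ultimately show ?thesis
      by (auto intro!: exI[of _ "1::real"] exI[of _ "1/2::real"])
  next
    case False
    obtain R where R: "0 < R" "compact {x + y | x y. x \<in> K \<and> y \<in> cball 0 (4 * R)}"
      "{x + y | x y. x \<in> K \<and> y \<in> cball 0 (4 * R)} \<subseteq> \<Omega>"
      using compact_neighbourhood[OF assms(1-3)] by blast
    define L2 where "L2 = {x + y | x y. x \<in> K \<and> y \<in> cball 0 (4 * R)}"
    define L where "L = {x + y | x y. x \<in> K \<and> y \<in> cball 0 (3 * R)}"
    have L2: "compact L2" "L2 \<subseteq> \<Omega>" using R by (simp_all add: L2_def)
    have Lc: "compact L" unfolding L_def by (intro compact_sums assms compact_cball)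
    have LL2: "cball x R \<subseteq> L2" if xL: "x \<in> L" for x
    proof
      fix y assume y: "y \<in> cball x R"
      obtain a b where ab: "x = a + b" "a \<in> K" "norm b \<le> 3 * R" using xL by (auto simp: L_def)
      have "norm (y - a) \<le> norm (y - x) + norm b" using norm_triangle_ineq[of "y - x" b] ab(1) by simp
      then have "norm (y - a) \<le> 4 * R" using y ab(3) by (simp add: dist_norm norm_minus_commute)
      then have "y = a + (y - a)" "y - a \<in> cball 0 (4 * R)" by simp_all
      then show "y \<in> L2" unfolding L2_def using ab(2) by blast
    qed
    have LsubL2: "L \<subseteq> L2" using LL2 R(1) by (meson centre_in_cball less_imp_le subsetI subsetD)
    have L: "compact L" "L \<subseteq> \<Omega>" using Lc LsubL2 L2 by auto
    have KL: "cball z (3 * R) \<subseteq> L" if "z \<in> K" for z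
    proof
      fix y assume "y \<in> cball z (3 * R)"
      then have "y = z + (y - z)" "y - z \<in> cball 0 (3 * R)" by (simp_all add: dist_norm norm_minus_commute)
      then show "y \<in> L" unfolding L_def using that by blast
    qed
    have KL': "cball z r \<subseteq> L" if "z \<in> K" "r \<le> 3 * R" for z r
      using KL[OF that(1)] subset_cball[OF that(2), of z] by blast
    obtain M where M: "0 \<le> M" "\<And>u. u \<in> U \<Longrightarrow> (LINT x:L2|lborel. \<bar>rval u x\<bar>) \<le> M"
      using compact_uniform_L1_bound[OF assms(1) U L2] by blast
    have intL: "(LINT x:L|lborel. \<bar>rval u x\<bar>) \<le> M" if "u \<in> U" for u
    proof -
      have "(LINT x:L|lborel. \<bar>rval u x\<bar>) \<le> (LINT x:L2|lborel. \<bar>rval u x\<bar>)"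
        by (rule set_integral_mono_superset)
          (use Lc LsubL2 psh_L1loc_integrable(2)[OF assms(1) psh[OF that] L2] in
            \<open>auto simp: borel_compact intro: set_integrable_abs\<close>)
      then show ?thesis using M(2)[OF that] by simp
    qed
    define VR where "VR = measure lborel (cball (0::complex^'n) R)"
    have VR: "0 < VR" unfolding VR_def by (rule measure_cball_pos[OF R(1)])
    define B where "B = M / VR"
    have B0: "0 \<le> B" unfolding B_def using M VR by simp
    have B: "u x \<le> ereal B" if "u \<in> U" "x \<in> L" for u x
    proof -
      have "measure lborel (cball x R) = VR" unfolding VR_def using R(1) by (simp add: content_cball)
      then show ?thesis
        using psh_le_L1[OF assms(1) psh[OF that(1)] L2 M(2)[OF that(1)] R(1) LL2[OF that(2)]] by (simp add: B_def)
    qed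
    define \<Lambda> where "\<Lambda> = 2 * M / VR / ln 2"
    have slope: "slope u z R (2 * R) \<le> \<Lambda>" if "u \<in> U" "z \<in> K" for u z
      unfolding \<Lambda>_def VR_def by (rule slope_le_L1[OF assms(1) psh[OF that(1)] L intL[OF that(1)] R(1) KL[OF that(2)]])
    have cb2: "cball z (2 * R) \<subseteq> \<Omega>" if "z \<in> K" for z
      using KL'[OF that, of "2 * R"] L(2) R(1) by auto
    have lel: "0 \<le> lelong_number u z \<and> lelong_number u z \<le> ereal \<Lambda>" if uz: "u \<in> U" "z \<in> K" for u z
    proof -
      have "0 < 2 * R" using R(1) by simp
      from lelong_number_eq_lim_slope[OF assms(1) psh[OF uz(1)] this cb2[OF uz(2)]]
      obtain l where l: "lelong_number u z = ereal l" "0 \<le> l" "\<And>r. 0 < r \<Longrightarrow> r < 2 * R \<Longrightarrow> l \<le> slope u z r (2 * R)"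
        by metis
      have "l \<le> \<Lambda>" using l(3)[OF R(1)] slope[OF uz] R(1) by simp
      then show ?thesis using l by simp
    qed
    have "\<theta> \<le> ereal \<Lambda>" unfolding \<theta>_def using lel by (intro Sup_least) auto
    then have fin: "\<theta> < \<infinity>" by (rule le_less_trans) simp
    have "\<exists>C>0. \<exists>\<eta>\<^sub>0. 0 < \<eta>\<^sub>0 \<and> \<eta>\<^sub>0 < 1 \<and>
          (\<forall>\<eta> \<alpha> :: real. \<forall>u\<in>U. 0 < \<eta> \<and> \<eta> \<le> \<eta>\<^sub>0 \<and> 0 < \<alpha> \<and> \<alpha> \<le> 2 \<longrightarrow> exceptional_cover K u \<nu> C \<eta> \<alpha>)" if \<nu>: "\<theta> < ereal \<nu>" for \<nu>
    proof -
      have lel\<nu>: "lelong_number u z < ereal \<nu>" if "u \<in> U" "z \<in> K" for u z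
      proof -
        have "lelong_number u z \<le> \<theta>" unfolding \<theta>_def using that by (intro Sup_upper) blast
        then show ?thesis using \<nu> by (rule le_less_trans)
      qed
      have \<nu>0: "0 < \<nu>"
      proof -
        obtain u z where uz: "u \<in> U" "z \<in> K" using False by blast
        have "0 < ereal \<nu>" using lel[OF uz] lel\<nu>[OF uz] by (meson le_less_trans)
        then show ?thesis by simp
      qed
      obtain c where c: "\<And>u z s. u \<in> U \<Longrightarrow> z \<in> K \<Longrightarrow> 0 < s \<Longrightarrow> s * c \<le> 1 \<Longrightarrow> \<nu> * ln s - c \<le> ball_sup u z s"
        using ball_sup_uniform_lower_bound[OF assms(1) U assms(2,3) lel\<nu>] by metis
      obtain A where A: "A \<subseteq> K" "finite A" "K \<subseteq> (\<Union>a\<in>A. ball a R)"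
        by (rule compactE_image[OF assms(2), of K "\<lambda>a. ball a R"]) (use R(1) in auto)
      define S where "S = \<Lambda> * ln 4"
      define M1 where "M1 = real (card A) * (16 * (real CARD('n) + 2) / R\<^sup>2 * (B * measure lborel L + M))"
      have M1: "0 \<le> M1" unfolding M1_def using B0 M(1) by simp
      define V where "V = measure lborel (cball (0::complex^'n) 1)"
      define E where "E = 2 ^ (CARD('n) + 2) / V * (V * (9 / 4) ^ CARD('n) * (S + 1) + 8 * 25 ^ CARD('n) * (M1 + 1))"
      define D where "D = c - \<nu> * ln (2 / 5) + E"
      define C where "C = exp (D / \<nu>)"
      define \<eta>0 where "\<eta>0 = min (1 / 2) (min R (1 / (\<bar>c\<bar> + 1)))"
      have \<eta>0: "0 < \<eta>0" "\<eta>0 < 1" using R(1) by (auto simp: \<eta>0_def)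
      have "exceptional_cover K u \<nu> C \<eta> \<alpha>" if uU: "u \<in> U" and \<eta>: "0 < \<eta>" "\<eta> \<le> \<eta>0" and \<alpha>: "0 < \<alpha>" "\<alpha> \<le> 2" for \<eta> \<alpha> u
      proof -
        note u = psh[OF uU]
        define \<sigma> where "\<sigma> = \<eta> / 5"
        have \<sigma>: "0 < \<sigma>" "5 * \<sigma> = \<eta>" using \<eta> by (auto simp: \<sigma>_def)
        have \<eta>R: "\<eta> \<le> R" "\<eta> \<le> 1 / (\<bar>c\<bar> + 1)" using \<eta>(2) by (auto simp: \<eta>0_def)
        have S: "ball_sup u z (2 * \<sigma>) - ball_sup u z (\<sigma> / 2) \<le> S" if z: "z \<in> K" for z
        proof -
          have o: "0 < \<sigma> / 2" "\<sigma> / 2 < R" "R < 2 * R" "\<sigma> / 2 < 2 * \<sigma>" "2 * \<sigma> < 2 * R" using \<sigma> \<eta>R R(1) by auto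
          have "slope u z (\<sigma> / 2) (2 * \<sigma>) \<le> slope u z (\<sigma> / 2) (2 * R)"
            by (rule slope_mono(1)[OF assms(1) u o(1,4,5) cb2[OF z]])
          also have "\<dots> \<le> slope u z R (2 * R)"
            by (rule slope_mono(2)[OF assms(1) u o(1,2,3) cb2[OF z]])
          also have "\<dots> \<le> \<Lambda>" by (rule slope[OF uU z])
          finally have "slope u z (\<sigma> / 2) (2 * \<sigma>) \<le> \<Lambda>" .
          moreover have "ln (2 * \<sigma>) - ln (\<sigma> / 2) = ln 4"
          proof -
            have "ln 4 = ln (2 * \<sigma> / (\<sigma> / 2))" using \<sigma>(1) by simp
            also have "\<dots> = ln (2 * \<sigma>) - ln (\<sigma> / 2)" by (rule ln_divide_pos) (use \<sigma>(1) in auto)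
            finally show ?thesis by simp
          qed
          ultimately have "(ball_sup u z (2 * \<sigma>) - ball_sup u z (\<sigma> / 2)) / ln 4 \<le> \<Lambda>"
            unfolding slope_def by simp
          then show ?thesis unfolding S_def by (simp add: pos_divide_le_eq)
        qed
        have K2: "cball z (2 * \<sigma>) \<subseteq> L" if "z \<in> K" for z using KL'[OF that] \<sigma> \<eta>R by simp
        note F = deficit_integral_bound[OF assms(1) u L _ intL[OF uU], of B]
        have mass: "(\<Sum>z\<in>J. excess (\<lambda>x. enn2real (deficit u B L x)) z ((t z)\<^sup>2) / t z ^ 6) \<le> M1"
          if J: "finite J" "J \<subseteq> K" "\<And>z. z \<in> J \<Longrightarrow> 0 < t z \<and> t z < \<sigma>"
            "pairwise (\<lambda>y z. disjnt (cball y (t y)) (cball z (t z))) J" for J t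
        proof -
          have "(\<Sum>z\<in>J. excess (\<lambda>x. enn2real (deficit u B L x)) z ((t z)\<^sup>2) / t z ^ 6)
            \<le> real (card A) * (16 * (real CARD('n) + 2) / R\<^sup>2 * (LINT x|lborel. enn2real (deficit u B L x)))"
          proof (rule excess_disjoint_balls[OF _ _ _ _ _ R(1) KL A(2,1,3) J(1,2) _ J(4)])
            show "deficit u B L \<in> borel_measurable borel"
              using L by (intro deficit_borel_measurable[OF assms(1) u(1)]) (auto simp: borel_compact)
            show "(\<integral>\<^sup>+x. deficit u B L x \<partial>lborel) < \<infinity>" by (rule F(1)) (rule B[OF uU])
            show "circle_super (deficit u B L) L"
              by (rule circle_super_deficit[OF assms(1) u(1) L(2) B0 B[OF uU]])
            show "bounded L" using L by (intro compact_imp_bounded)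
            show "deficit u B L x = 0" if "x \<notin> L" for x using that by (simp add: deficit_def)
            show "0 < t z \<and> t z \<le> R / 2" if "z \<in> J" for z using J(3)[OF that] \<sigma> \<eta>R R(1) by auto
          qed
          also have "\<dots> \<le> M1"
            unfolding M1_def by (intro mult_left_mono F(2)) (use B[OF uU] in auto)
          finally show ?thesis .
        qed
        obtain J :: "nat set" and cc :: "nat \<Rightarrow> complex ^ 'n" and r :: "nat \<Rightarrow> real" where J:
          "\<And>j. j \<in> J \<Longrightarrow> 0 < r j \<and> r j < 5 * \<sigma>"
          "(\<lambda>j. r j powr (2 * real CARD('n) - 2 + \<alpha>)) summable_on J"
          "(\<Sum>\<^sub>\<infinity>j\<in>J. r j powr (2 * real CARD('n) - 2 + \<alpha>)) \<le> \<sigma> powr \<alpha> / \<alpha> / 4"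
          "\<And>z. z \<in> K - (\<Union>j\<in>J. ball (cc j) (r j)) \<Longrightarrow> ereal (ball_sup u z (2 * \<sigma>) - E) \<le> u z"
          by (rule psh_lower_bound_outside_balls[OF assms(1) u L B[OF uU] \<sigma>(1) K2 S \<alpha> M1 mass, folded V_def, folded E_def]) (assumption | use that in blast)+
        have sum: "(\<Sum>\<^sub>\<infinity>j\<in>J. r j powr (2 * real CARD('n) - 2 + \<alpha>)) < 9 ^ (CARD('n) - 1) * \<eta> powr \<alpha> / \<alpha>"
        proof -
          have "\<sigma> powr \<alpha> \<le> \<eta> powr \<alpha>" using \<sigma> \<alpha> by (intro powr_mono2) auto
          then have "\<sigma> powr \<alpha> / \<alpha> / 4 \<le> \<eta> powr \<alpha> / \<alpha> / 4" using \<alpha> by (simp add: divide_right_mono)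
          also have "\<dots> < \<eta> powr \<alpha> / \<alpha>"
          proof -
            have "x / 4 < x" if "0 < x" for x :: real using that by simp
            moreover have "0 < \<eta> powr \<alpha> / \<alpha>" using \<eta>(1) \<alpha> by simp
            ultimately show ?thesis .
          qed
          also have "\<dots> \<le> 9 ^ (CARD('n) - 1) * (\<eta> powr \<alpha> / \<alpha>)"
          proof -
            have "1 * (\<eta> powr \<alpha> / \<alpha>) \<le> 9 ^ (CARD('n) - 1) * (\<eta> powr \<alpha> / \<alpha>)"
              using \<alpha> by (intro mult_right_mono) auto
            then show ?thesis by simp
          qed
          finally show ?thesis using J(3) by simp
        qed
        have low: "ereal (- \<nu> * ln (C / \<eta>)) \<le> u z" if z: "z \<in> K - (\<Union>j\<in>J. ball (cc j) (r j))" for z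
        proof -
          have "2 * \<sigma> * c \<le> 1"
          proof -
            have "2 * \<sigma> * c \<le> 2 * \<sigma> * \<bar>c\<bar>" using \<sigma> by (intro mult_left_mono) auto
            also have "\<dots> \<le> \<eta> * \<bar>c\<bar>" using \<sigma> by (intro mult_right_mono) auto
            also have "\<dots> \<le> 1 / (\<bar>c\<bar> + 1) * \<bar>c\<bar>" using \<eta>R(2) by (intro mult_right_mono) auto
            also have "\<dots> \<le> 1" by (simp add: divide_le_eq)
            finally show ?thesis .
          qed
          then have "\<nu> * ln (2 * \<sigma>) - c \<le> ball_sup u z (2 * \<sigma>)" using z \<sigma>(1) by (intro c[OF uU]) auto
          moreover have "ln (2 * \<sigma>) = ln (2 / 5) + ln \<eta>"
          proof -
            have "2 * \<sigma> = 2 / 5 * \<eta>" by (simp add: \<sigma>_def)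
            moreover have "ln (2 / 5 * \<eta>) = ln (2 / 5) + ln \<eta>" using \<eta>(1) by (intro ln_mult_pos) auto
            ultimately show ?thesis by (simp only:)
          qed
          moreover have "- \<nu> * ln (C / \<eta>) = \<nu> * ln \<eta> - D"
          proof -
            have "ln (C / \<eta>) = D / \<nu> - ln \<eta>" unfolding C_def using \<eta>(1) by (simp add: ln_div)
            moreover have "\<nu> * (D / \<nu>) = D" using \<nu>0 by simp
            ultimately show ?thesis by (simp only: right_diff_distrib mult_minus_left)
          qed
          ultimately have "- \<nu> * ln (C / \<eta>) \<le> ball_sup u z (2 * \<sigma>) - E" by (simp add: D_def algebra_simps)
          then have "ereal (- \<nu> * ln (C / \<eta>)) \<le> ereal (ball_sup u z (2 * \<sigma>) - E)" by simp
          also have "\<dots> \<le> u z" by (rule J(4)[OF z])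
          finally show ?thesis .
        qed
        show ?thesis
          unfolding exceptional_cover_def using J(1,2) sum low unfolding \<sigma>(2) by blast
      qed
      then show ?thesis using \<eta>0 by (intro exI[of _ C] conjI exI[of _ \<eta>0]) (auto simp: C_def)
    qed
    then show ?thesis using fin by blast
  qed
qed

theorem theorem6p1:
  fixes \<Omega> K :: "(complex ^ 'n) set"
  assumes "open \<Omega>" and "compact K" and "K \<subseteq> \<Omega>"
  shows "\<exists>N::nat. \<forall>U. U \<subseteq> PSH \<Omega> \<and> compactin (L1loc_topology \<Omega>) U \<longrightarrow>
    (let \<theta> = Sup {lelong_number u z | u z. u \<in> U \<and> z \<in> K} in
      \<theta> < \<infinity> \<and>
      (\<forall>\<nu>::real. ereal \<nu> > \<theta> \<longrightarrow>
        (\<exists>C>0. \<exists>\<eta>\<^sub>0. 0 < \<eta>\<^sub>0 \<and> \<eta>\<^sub>0 < 1 \<and>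
          (\<forall>\<eta> \<alpha> :: real. \<forall>u\<in>U. 0 < \<eta> \<and> \<eta> \<le> \<eta>\<^sub>0 \<and> 0 < \<alpha> \<and> \<alpha> \<le> 2 \<longrightarrow>
            (\<exists>(J :: nat set) (c :: nat \<Rightarrow> complex ^ 'n) (r :: nat \<Rightarrow> real).
              (\<forall>j\<in>J. 0 < r j \<and> r j < \<eta>) \<and>
              (\<lambda>j. r j powr (2 * real CARD('n) - 2 + \<alpha>)) summable_on J \<and>
              (\<Sum>\<^sub>\<infinity>j\<in>J. r j powr (2 * real CARD('n) - 2 + \<alpha>))
                < real N * 9 ^ (CARD('n) - 1) * \<eta> powr \<alpha> / \<alpha> \<and>
              (\<forall>z \<in> K - (\<Union>j\<in>J. ball (c j) (r j)).
                u z \<ge> ereal (- \<nu> * ln (C / \<eta>))))))))"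
  using sublevel_cover[OF assms] unfolding Let_def exceptional_cover_def
  by (intro exI[of _ 1]) simp

end
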